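(* Let $q$ be a prime power, let $\beta\geq 2$ be a divisor of $q-1$, and let $A(x)\in\mathbb{F}_q[x]$ be an additive and separable polynomial of degree $\alpha$ that splits (into linear factors) in $\mathbb{F}_q[x]$. Let $\mathcal{X}$ be the curve over $\mathbb{F}_q$ defined by the equation $y^\beta=A(x)$, and assume $n:=\#\mathcal{X}(\mathbb{F}_q)-\alpha-1>0$. Then for any integers $0\le t_1\leq\beta-2$ and $0\le t_2\leq\alpha-2$ there exists a locally recoverable code over $\mathbb{F}_q$ with parameters $$[\,n,\ (t_1+1)(t_2+1),\ d\geq n-\alpha t_1-\beta t_2;\ t_2+1,\ t_1+1\,].$$
   Context: By a curve is meant a smooth, projective, absolutely irreducible curve; a curve given by an affine equation means the smooth projective model of the absolutely irreducible curve given by that equation. A polynomial $A(x)$ over a field of characteristic $p$ is additive if $A(a+b)=A(a)+A(b)$ identically, i.e. $A(x)=\sum_i a_i x^{p^i}$. Locally recoverable codes (LRCs): let $C\subseteq\mathbb{F}_Q^n$ be a linear code over the finite field $\mathbb{F}_Q$ ($Q$ a prime power). For $\gamma\in\mathbb{F}_Q$ and $i\in\{1,\dots,n\}$ let $C(i,\gamma)=\{c\in C: c_i=\gamma\}$, and for nonempty $I\subseteq\{1,\dots,n\}\setminus\{i\}$ let $C_I(i,\gamma)$ be the projection of $C(i,\gamma)$ to $\mathbb{F}_Q^I$. The set $I$ is a recovery set for coordinate $i$ if $C_I(i,\gamma)\cap C_I(i,\gamma')=\emptyset$ for all $\gamma\neq\gamma'$ in $\mathbb{F}_Q$. An $[n,k,d;r_1,\dots,r_t]$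 LRC over $\mathbb{F}_Q$ is a linear code $C\subseteq\mathbb{F}_Q^n$ of length $n$, dimension $k$ and minimum (Hamming) distance $d$ such that every coordinate $i$ has $t$ pairwise disjoint recovery sets, of cardinalities $r_1,\dots,r_t$ respectively. Writing "$d\ge D$" in the parameters means the minimum distance is at least $D$. *)

theory Defs
  imports
    "HOL-Algebra.Subrings"
    "HOL-Library.Cardinality"
    "HOL-Library.Function_Algebras"
    "HOL-Library.Disjoint_Sets"
    "HOL-Computational_Algebra.Computational_Algebra"
begin

hide_const (open) UnivPoly.coeff UnivPoly.monom Module.smult

definition additive_poly :: "'a::field poly \<Rightarrow> bool" where
  "additive_poly A \<longleftrightarrow> (\<forall>i. coeff A i \<noteq> 0 \<longrightarrow> (\<exists>j. i = CHAR('a) ^ j))"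

definition separable_poly :: "'a::field poly \<Rightarrow> bool" where
  "separable_poly A \<longleftrightarrow> coprime A (pderiv A)"

definition splits_poly :: "'a::field poly \<Rightarrow> bool" where
  "splits_poly A \<longleftrightarrow> (\<exists>as. A = smult (lead_coeff A) (\<Prod>a\<leftarrow>as. [:- a, 1:]))"

text \<open>A polynomial in two variables is represented as an element of \<open>k[x][y]\<close>: the outer
  variable is \<open>y\<close>, the coefficients are polynomials in \<open>x\<close>. For \<open>F\<close> irreducible over \<open>k(x)\<close> of
  positive degree in \<open>y\<close>, the function field of the curve \<open>F(x, y) = 0\<close> is \<open>k(x)[y]/(F)\<close>. Its
  elements are represented by the unique remainders modulo \<open>F\<close> in \<open>k(x)[y]\<close>.\<close>

definition function_field :: "'a::field poly poly \<Rightarrow> 'a poly fract poly ring" where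
  "function_field F =
     (let f = map_poly to_fract F in
      \<lparr>carrier = {u. degree u < degree f},
       monoid.mult = (\<lambda>u v. (u * v) mod f),
       one = 1,
       zero = 0,
       add = (\<lambda>u v. u + v)\<rparr>)"

definition constant_field :: "'a::field poly fract poly set" where
  "constant_field = range (\<lambda>c. [:to_fract [:c:]:])"

definition valuation_ring ::
  "('f, 'm) ring_scheme \<Rightarrow> 'f set \<Rightarrow> 'f set \<Rightarrow> bool" where
  "valuation_ring K k R \<longleftrightarrow>
     subring R K \<and> k \<subset> R \<and> R \<subset> carrier K \<and>
     (\<forall>z \<in> carrier K. z \<noteq> \<zero>\<^bsub>K\<^esub> \<longrightarrow> z \<in> R \<or> inv\<^bsub>K\<^esub> z \<in> R)"

text \<open>The maximal ideal of a valuation ring \<open>R\<close> consists of its non-units. The place of \<open>R\<close> has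
  degree one iff \<open>k\<close> maps onto the residue field of \<open>R\<close>.\<close>

definition rational_place ::
  "('f, 'm) ring_scheme \<Rightarrow> 'f set \<Rightarrow> 'f set \<Rightarrow> bool" where
  "rational_place K k R \<longleftrightarrow>
     valuation_ring K k R \<and>
     (\<forall>z \<in> R. \<exists>c \<in> k. z \<ominus>\<^bsub>K\<^esub> c \<in> R - Units (K\<lparr>carrier := R\<rparr>))"

text \<open>The closed points of the smooth projective model of a curve over a perfect field \<open>k\<close> are
  the places of its function field, and a point is \<open>k\<close>-rational iff its residue field is \<open>k\<close>.
  A place is identified with its valuation ring.\<close>

definition rational_points :: "'a::field poly poly \<Rightarrow> 'a poly fract poly set set" where
  "rational_points F = {R. rational_place (function_field F) constant_field R}"

definition superelliptic :: "nat \<Rightarrow> 'a::field poly \<Rightarrow> 'a poly poly" where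
  "superelliptic \<beta> A = monom 1 \<beta> - [:A:]"

text \<open>The space of words of length \<open>n\<close> consists of the functions that vanish outside
  \<open>{..<n}\<close>, so coordinates are numbered from \<open>0\<close>.\<close>

definition words :: "nat \<Rightarrow> (nat \<Rightarrow> 'a::zero) set" where
  "words n = {c. \<forall>i\<ge>n. c i = 0}"

definition word_scale :: "'a::field \<Rightarrow> (nat \<Rightarrow> 'a) \<Rightarrow> nat \<Rightarrow> 'a" where
  "word_scale a c = (\<lambda>i. a * c i)"

lemma vector_space_word_scale: "vector_space word_scale"
  by unfold_locales (auto simp: word_scale_def fun_eq_iff algebra_simps)

definition linear_code :: "nat \<Rightarrow> (nat \<Rightarrow> 'a::field) set \<Rightarrow> bool" where
  "linear_code n C \<longleftrightarrow> C \<subseteq> words n \<and> module.subspace word_scale C"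

definition code_dim :: "(nat \<Rightarrow> 'a::field) set \<Rightarrow> nat" where
  "code_dim C = vector_space.dim word_scale C"

definition hamming_dist :: "nat \<Rightarrow> (nat \<Rightarrow> 'a) \<Rightarrow> (nat \<Rightarrow> 'a) \<Rightarrow> nat" where
  "hamming_dist n c c' = card {i. i < n \<and> c i \<noteq> c' i}"

definition min_dist :: "nat \<Rightarrow> (nat \<Rightarrow> 'a) set \<Rightarrow> nat" where
  "min_dist n C = Inf {hamming_dist n c c' |c c'. c \<in> C \<and> c' \<in> C \<and> c \<noteq> c'}"

definition code_proj :: "nat set \<Rightarrow> nat \<Rightarrow> 'a \<Rightarrow> (nat \<Rightarrow> 'a) set \<Rightarrow> (nat \<Rightarrow> 'a) set" where
  "code_proj I i \<gamma> C = (\<lambda>c. restrict c I) ` {c \<in> C. c i = \<gamma>}"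

definition recovery_set :: "nat \<Rightarrow> (nat \<Rightarrow> 'a) set \<Rightarrow> nat \<Rightarrow> nat set \<Rightarrow> bool" where
  "recovery_set n C i I \<longleftrightarrow>
     I \<noteq> {} \<and> I \<subseteq> {..<n} - {i} \<and>
     (\<forall>\<gamma> \<gamma>'. \<gamma> \<noteq> \<gamma>' \<longrightarrow> code_proj I i \<gamma> C \<inter> code_proj I i \<gamma>' C = {})"

definition lrc ::
  "nat \<Rightarrow> nat \<Rightarrow> nat \<Rightarrow> nat list \<Rightarrow> (nat \<Rightarrow> 'a::field) set \<Rightarrow> bool" where
  "lrc n k d rs C \<longleftrightarrow>
     linear_code n C \<and> code_dim C = k \<and> min_dist n C = d \<and>
     (\<forall>i<n. \<exists>I :: nat \<Rightarrow> nat set.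
        (\<forall>j<length rs. recovery_set n C i (I j) \<and> card (I j) = rs ! j) \<and>
        disjoint_family_on I {..<length rs})"

end

theory Submission
  imports Defs "HOL-Computational_Algebra.Formal_Laurent_Series"
begin

text \<open>
  Write \<open>\<alpha>\<close> for the degree of \<open>A\<close>. The code evaluates the functions
  \<open>\<Sum> c\<^sub>i\<^sub>j x\<^sup>i y\<^sup>j\<close> with \<open>i \<le> t2\<close> and \<open>j \<le> t1\<close> at the affine rational points \<open>(a, b)\<close> of the
  curve that have \<open>b \<noteq> 0\<close>. If \<open>(a, b)\<close> is such a point, then so are all \<open>(a, \<zeta> b)\<close> with
  \<open>\<zeta>\<^sup>\<beta> = 1\<close> and all \<open>(a + k, b)\<close> with \<open>A(k) = 0\<close>, because \<open>A\<close> is additive. Since \<open>\<beta>\<close> divides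
  \<open>q - 1\<close> and \<open>A\<close> splits with simple roots, there are \<open>\<beta>\<close> of the former and \<open>\<alpha>\<close> of the latter. So
  every point lies on a grid of \<open>\<alpha> \<times> \<beta>\<close> points. On a vertical line of the grid a function is a
  polynomial of degree at most \<open>t1 < \<beta> - 1\<close>, and any \<open>t1 + 1\<close> other points of the line recover its
  value; on a horizontal line the same holds with \<open>t2 < \<alpha> - 1\<close>. The two lines meet only in the point
  itself, which gives the disjoint recovery sets. A function that vanishes on one whole grid is zero
  (\<open>vanish_on_grid\<close>), which gives the dimension.

  The minimum distance is a bound on zeros: a nonzero function of degree below \<open>\<beta>\<close> in \<open>y\<close> that is
  polynomial in \<open>x, y\<close> has at most as many affine rational zeros as the order of its pole at infinity
  (\<open>card_zeros_le\<close>). The orders of the poles of \<open>x\<close> and \<open>y\<close> there are \<open>\<beta>\<close> and \<open>\<alpha>\<close>, so this order is at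
  most \<open>\<beta> t2 + \<alpha> t1\<close>. The bound is a count of dimensions in the spaces of functions with a bounded
  pole; since the field is finite, dimensions are compared by cardinalities.

  The length is the number of places: the curve has exactly one rational place for each affine
  solution of \<open>b\<^sup>\<beta> = A(a)\<close>, and exactly one more (\<open>card_rational_points\<close>); the \<open>\<alpha>\<close> solutions with
  \<open>b = 0\<close> are not used. Places are produced by Laurent series. A pair \<open>X, Y\<close> of Laurent series with
  \<open>Y\<^sup>\<beta> = A(X)\<close> and \<open>X\<close> transcendental embeds the function field into the field of Laurent series, and
  the order of a series defines a place. Such pairs come from Hensel's lemma: one centred at each
  affine point (\<open>branch_at_affine_point\<close>), because the affine curve is smooth, and one with poles of
  orders \<open>\<beta>\<close> and \<open>\<alpha>\<close> (\<open>branch_at_infinity\<close>), because \<open>\<alpha>\<close> is a power of the characteristic and hence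
  coprime to \<open>\<beta>\<close>. Conversely, a place at which \<open>x\<close> is regular is centred at an affine
  point, and the centre determines it since the local ring there has a uniformizer
  (\<open>affine_place\<close>); a place at which \<open>x\<close> has a pole is the one at infinity, since the \<open>\<beta>\<close>-th power of
  every term \<open>r(x) y\<^sup>j\<close> is a rational function of \<open>x\<close> (\<open>infinite_place\<close>).

  Coprimality also makes the pole orders of the terms \<open>r\<^sub>j(x) y\<^sup>j\<close>, \<open>j < \<beta>\<close>, distinct, so the embedding at
  infinity is injective on the remainders that represent the function field
  (\<open>subdegree_\<iota>_le\<close>). This shows that the remainders form a field, and it lets all arguments about
  places take place inside the field of Laurent series.\<close>

section \<open>Ring morphisms and evaluation of polynomials\<close>

definition ring_morphism :: "('r::comm_ring_1 \<Rightarrow> 's::comm_ring_1) \<Rightarrow> bool" where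
  "ring_morphism h \<longleftrightarrow> h 1 = 1 \<and> (\<forall>a b. h (a + b) = h a + h b) \<and> (\<forall>a b. h (a * b) = h a * h b)"

lemma ring_morphism_one: "ring_morphism h \<Longrightarrow> h 1 = 1"
  and ring_morphism_add: "ring_morphism h \<Longrightarrow> h (a + b) = h a + h b"
  and ring_morphism_mult: "ring_morphism h \<Longrightarrow> h (a * b) = h a * h b"
  by (auto simp: ring_morphism_def)

lemma ring_morphism_zero: "ring_morphism h \<Longrightarrow> h 0 = 0"
  using ring_morphism_add[of h 0 0] by simp

lemma ring_morphism_uminus: "ring_morphism h \<Longrightarrow> h (- a) = - h a"
  using ring_morphism_add[of h a "- a"] by (simp add: ring_morphism_zero eq_neg_iff_add_eq_0 add.commute)

lemma ring_morphism_diff: "ring_morphism h \<Longrightarrow> h (a - b) = h a - h b"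
  using ring_morphism_add[of h a "- b"] by (simp add: ring_morphism_uminus)

lemma ring_morphism_power: "ring_morphism h \<Longrightarrow> h (a ^ n) = h a ^ n"
  by (induction n) (simp_all add: ring_morphism_one ring_morphism_mult)

lemma ring_morphism_sum: "ring_morphism h \<Longrightarrow> h (sum f I) = (\<Sum>i\<in>I. h (f i))"
  by (induction I rule: infinite_finite_induct)
    (simp_all add: ring_morphism_zero ring_morphism_add)

lemmas ring_morphism_simps = ring_morphism_one ring_morphism_add ring_morphism_mult
  ring_morphism_zero ring_morphism_uminus ring_morphism_diff ring_morphism_power ring_morphism_sum

definition eval_poly :: "('r::comm_ring_1 \<Rightarrow> 's::comm_ring_1) \<Rightarrow> 's \<Rightarrow> 'r poly \<Rightarrow> 's" where
  "eval_poly h x p = poly (map_poly h p) x"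

context
  fixes h :: "'r::comm_ring_1 \<Rightarrow> 's::comm_ring_1"
  assumes h: "ring_morphism h"
begin

lemma eval_poly_pCons: "eval_poly h x (pCons a p) = h a + x * eval_poly h x p"
  by (simp add: eval_poly_def map_poly_pCons ring_morphism_zero[OF h])

lemma eval_poly_const: "eval_poly h x [:a:] = h a"
  by (simp add: eval_poly_def map_poly_pCons ring_morphism_zero[OF h])

lemma eval_poly_0: "eval_poly h x 0 = 0"
  by (simp add: eval_poly_def)

lemma eval_poly_add: "eval_poly h x (p + q) = eval_poly h x p + eval_poly h x q"
proof -
  have "map_poly h (p + q) = map_poly h p + map_poly h q"
    by (rule poly_eqI) (simp add: coeff_map_poly ring_morphism_simps[OF h])
  then show ?thesis by (simp add: eval_poly_def)
qed

lemma eval_poly_smult: "eval_poly h x (smult a p) = h a * eval_poly h x p"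
  by (induction p) (simp_all add: eval_poly_0 eval_poly_pCons ring_morphism_mult[OF h] algebra_simps)

lemma eval_poly_mult: "eval_poly h x (p * q) = eval_poly h x p * eval_poly h x q"
  by (induction p)
    (simp_all add: eval_poly_0 eval_poly_pCons eval_poly_add eval_poly_smult mult_pCons_left
      ring_morphism_zero[OF h] algebra_simps)

lemma ring_morphism_eval_poly: "ring_morphism (eval_poly h x)"
  unfolding ring_morphism_def
  using eval_poly_const[of x 1] by (simp add: one_pCons eval_poly_add eval_poly_mult ring_morphism_one[OF h])

lemma eval_poly_monom: "eval_poly h x (monom a n) = h a * x ^ n"
  by (simp add: eval_poly_def map_poly_monom ring_morphism_zero[OF h] poly_monom)

lemma eval_poly_altdef:
  assumes "degree p < n"
  shows "eval_poly h x p = (\<Sum>i<n. h (coeff p i) * x ^ i)"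
proof -
  have "eval_poly h x p = eval_poly h x (\<Sum>i\<le>degree p. monom (coeff p i) i)"
    by (simp add: poly_as_sum_of_monoms)
  also have "\<dots> = (\<Sum>i\<le>degree p. h (coeff p i) * x ^ i)"
    by (simp add: ring_morphism_sum[OF ring_morphism_eval_poly] eval_poly_monom)
  also have "\<dots> = (\<Sum>i<n. h (coeff p i) * x ^ i)"
    by (rule sum.mono_neutral_left)
      (use assms in \<open>auto simp: coeff_eq_0 not_le ring_morphism_zero[OF h]\<close>)
  finally show ?thesis .
qed

lemma eval_poly_map_poly:
  fixes g :: "'t::comm_ring_1 \<Rightarrow> 'r"
  assumes "ring_morphism g"
  shows "eval_poly h x (map_poly g p) = eval_poly (\<lambda>a. h (g a)) x p"
  by (simp add: eval_poly_def map_poly_map_poly ring_morphism_zero[OF assms]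
      ring_morphism_zero[OF h] o_def)

end

lemma eval_poly_id: "eval_poly (\<lambda>a. a) x p = poly p x"
  by (simp add: eval_poly_def)

text \<open>The unique extension of an injective morphism \<open>h\<close> to the field of fractions. The value
  is chosen through some representation as a fraction, and it is independent of the choice by
  injectivity.\<close>

definition eval_fract :: "('r::idom \<Rightarrow> 's::field) \<Rightarrow> 'r fract \<Rightarrow> 's" where
  "eval_fract h z = (SOME w. \<exists>p q. q \<noteq> 0 \<and> z = Fract p q \<and> w = h p / h q)"

context
  fixes h :: "'r::idom \<Rightarrow> 's::field"
  assumes h: "ring_morphism h" and inj: "\<forall>r. h r = 0 \<longrightarrow> r = 0"
begin

lemma eval_fract_Fract:
  assumes "q \<noteq> 0"
  shows "eval_fract h (Fract p q) = h p / h q"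
proof -
  have "\<exists>w p' q'. q' \<noteq> 0 \<and> Fract p q = Fract p' q' \<and> w = h p' / h q'"
    using assms by blast
  from someI_ex[OF this] obtain p' q' where q': "q' \<noteq> 0" and eq: "Fract p q = Fract p' q'"
    and w: "eval_fract h (Fract p q) = h p' / h q'"
    unfolding eval_fract_def by blast
  have "p * q' = p' * q"
    using eq assms q' by (simp add: eq_fract)
  moreover have "h q \<noteq> 0" "h q' \<noteq> 0" using inj assms q' by blast+
  ultimately have "h p * h q' = h p' * h q"
    by (metis ring_morphism_mult[OF h])
  then show ?thesis
    using w \<open>h q \<noteq> 0\<close> \<open>h q' \<noteq> 0\<close> by (simp add: frac_eq_eq)
qed

lemma eval_fract_to_fract: "eval_fract h (to_fract p) = h p"
  by (simp add: to_fract_def eval_fract_Fract ring_morphism_one[OF h])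

lemma ring_morphism_eval_fract: "ring_morphism (eval_fract h)"
  unfolding ring_morphism_def
proof (intro conjI allI)
  show "eval_fract h 1 = 1"
    by (simp add: One_fract_def eval_fract_Fract ring_morphism_one[OF h])
  fix z w :: "'r fract"
  obtain p q where z: "z = Fract p q" "q \<noteq> 0" by (cases z)
  obtain p' q' where w: "w = Fract p' q'" "q' \<noteq> 0" by (cases w)
  have "h q \<noteq> 0" "h q' \<noteq> 0" using inj z w by auto
  then show "eval_fract h (z + w) = eval_fract h z + eval_fract h w"
    "eval_fract h (z * w) = eval_fract h z * eval_fract h w"
    using z w by (simp_all add: eval_fract_Fract ring_morphism_simps[OF h] field_simps)
qed

end

lemma ring_morphism_to_fract: "ring_morphism to_fract"
  by (simp add: ring_morphism_def)

lemma ring_morphism_fls_const: "ring_morphism (fls_const :: 'a::comm_ring_1 \<Rightarrow> 'a fls)"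
  by (simp add: ring_morphism_def fls_plus_const fls_const_mult_const)

lemma ring_morphism_poly: "ring_morphism (\<lambda>p. poly p (a::'a::comm_ring_1))"
  by (simp add: ring_morphism_def)

lemma eval_at_point: "eval_poly (\<lambda>p. poly p a) b g = poly (poly g [:b:]) (a::'a::comm_ring_1)"
  by (induction g) (simp_all add: eval_poly_0[OF ring_morphism_poly] eval_poly_pCons[OF ring_morphism_poly])

lemma poly_map_poly_poly: "poly (map_poly (\<lambda>p. poly p a) g) b = poly (poly g [:b:]) (a::'a::comm_ring_1)"
  using eval_at_point[of a b g] by (simp add: eval_poly_def)

section \<open>Hensel's lemma for formal power series\<close>

text \<open>The Taylor expansion to first order, in a form without division, so that it also holds in
  positive characteristic.\<close>

lemma poly_taylor_quadratic:
  fixes p :: "'r::idom poly"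
  shows "\<exists>r. poly p (s + d) = poly p s + d * poly (pderiv p) s + d\<^sup>2 * r"
proof (induction p)
  case 0
  show ?case by simp
next
  case (pCons a p)
  then obtain r where r: "poly p (s + d) = poly p s + d * poly (pderiv p) s + d\<^sup>2 * r"
    by blast
  have "poly (pCons a p) (s + d) = a + (s + d) * (poly p s + d * poly (pderiv p) s + d\<^sup>2 * r)"
    by (simp add: r)
  also have "\<dots> = poly (pCons a p) s + d * poly (pderiv (pCons a p)) s
      + d\<^sup>2 * (poly (pderiv p) s + s * r + d * r)"
    by (simp add: pderiv_pCons algebra_simps power2_eq_square)
  finally show ?case by blast
qed

lemma diff_dvd_poly_diff:
  fixes p :: "'r::comm_ring_1 poly"
  shows "a - b dvd poly p a - poly p b"
proof (induction p)
  case (pCons c p)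
  have "a * poly p a - b * poly p b = a * (poly p a - poly p b) + (a - b) * poly p b"
    by (simp add: algebra_simps)
  with pCons show ?case by (metis add_diff_cancel_left dvd_add dvd_mult dvd_triv_left poly_pCons)
qed simp

lemma fps_X_power_dvd_iff:
  fixes f :: "'a::field fps"
  shows "fps_X ^ n dvd f \<longleftrightarrow> (\<forall>i<n. fps_nth f i = 0)"
proof (cases "f = 0")
  case False
  then have "fps_X ^ n dvd f \<longleftrightarrow> n \<le> subdegree f"
    by (subst fps_dvd_iff) auto
  then show ?thesis
    using False by (metis nth_less_subdegree_zero nth_subdegree_nonzero not_le subdegree_geI order_less_le_trans)
qed simp

text \<open>Newton's iteration: if \<open>p(s) \<equiv> 0\<close> modulo \<open>X\<^sup>n\<^sup>+\<^sup>1\<close>, then subtracting \<open>p(s) / p'(s)\<close> from \<open>s\<close> squares the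
  error by the Taylor expansion. The derivative stays invertible because the constant coefficient
  of \<open>s\<close> never changes. The diagonal of the approximations is the root.\<close>

lemma fps_hensel:
  fixes p :: "'a::field fps poly"
  assumes root: "fps_nth (poly p (fps_const c)) 0 = 0"
    and simple: "fps_nth (poly (pderiv p) (fps_const c)) 0 \<noteq> 0"
  shows "\<exists>s. poly p s = 0 \<and> fps_nth s 0 = c"
proof -
  let ?Q = "\<lambda>n s. fps_nth s 0 = c \<and> fps_X ^ Suc n dvd poly p s"
  have "\<exists>s. ?Q 0 s"
    using root by (intro exI[of _ "fps_const c"]) (simp add: fps_X_power_dvd_iff[of 1, simplified])
  moreover have "\<exists>s'. ?Q (Suc n) s' \<and> fps_X ^ Suc n dvd s' - s" if Q: "?Q n s" for n s
  proof -
    obtain e where e: "poly p s = fps_X ^ Suc n * e" using Q unfolding dvd_def by blast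
    define D where "D = poly (pderiv p) s"
    have "fps_X dvd s - fps_const c"
      using that fps_X_power_dvd_iff[of 1 "s - fps_const c"] by simp
    then have "fps_X dvd D - poly (pderiv p) (fps_const c)"
      unfolding D_def by (rule dvd_trans[OF _ diff_dvd_poly_diff])
    then have "fps_nth D 0 \<noteq> 0"
      using simple fps_X_power_dvd_iff[of 1 "D - poly (pderiv p) (fps_const c)"] by simp
    then have D: "D * inverse D = 1" by (rule inverse_mult_eq_1')
    \<comment> \<open>The Newton correction \<open>- p(s) / p'(s)\<close>.\<close>
    define d where "d = - (fps_X ^ Suc n * (e * inverse D))"
    obtain r where r: "poly p (s + d) = poly p s + d * D + d\<^sup>2 * r"
      using poly_taylor_quadratic unfolding D_def by blast
    have "d * D = - (fps_X ^ Suc n * e * (D * inverse D))"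
      unfolding d_def by (simp add: algebra_simps del: power_Suc)
    then have "poly p (s + d) = d\<^sup>2 * r"
      using r D e by simp
    also have "\<dots> = fps_X ^ (2 * Suc n) * ((e * inverse D)\<^sup>2 * r)"
      unfolding d_def power2_minus power_even_eq power_mult_distrib by (simp only: mult.assoc)
    finally have "fps_X ^ (2 * Suc n) dvd poly p (s + d)" by simp
    moreover have "fps_X ^ Suc (Suc n) dvd (fps_X :: 'a fps) ^ (2 * Suc n)"
      by (rule le_imp_power_dvd) simp
    ultimately have "fps_X ^ Suc (Suc n) dvd poly p (s + d)" by (blast intro: dvd_trans)
    moreover have "fps_nth (s + d) 0 = c" using that by (simp add: d_def)
    moreover have "fps_X ^ Suc n dvd (s + d) - s" by (simp add: d_def del: power_Suc)
    ultimately show ?thesis by blast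
  qed
  ultimately obtain s where s: "\<And>n. ?Q n (s n)" and
    step: "\<And>n. fps_X ^ Suc n dvd s (Suc n) - s n"
    using dependent_nat_choice[of ?Q "\<lambda>n s s'. fps_X ^ Suc n dvd s' - s"] by metis
  have stable: "fps_nth (s (n + k)) i = fps_nth (s n) i" if "i \<le> n" for n k i
  proof (induction k)
    case (Suc k)
    then show ?case
      using step[of "n + k"] that fps_X_power_dvd_iff[of "Suc (n + k)" "s (Suc (n + k)) - s (n + k)"]
      by (simp del: power_Suc)
  qed simp
  define S where "S = Abs_fps (\<lambda>n. fps_nth (s n) n)"
  have close: "fps_X ^ Suc n dvd S - s n" for n
    unfolding fps_X_power_dvd_iff
  proof safe
    fix i assume "i < Suc n"
    then show "fps_nth (S - s n) i = 0"
      using stable[of i i "n - i"] by (simp add: S_def)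
  qed
  have "fps_X ^ Suc n dvd poly p S" for n
  proof -
    have "fps_X ^ Suc n dvd poly p S - poly p (s n)"
      using close diff_dvd_poly_diff by (rule dvd_trans)
    then have "fps_X ^ Suc n dvd (poly p S - poly p (s n)) + poly p (s n)"
      using s by (blast intro: dvd_add)
    then show ?thesis by (simp del: power_Suc)
  qed
  then have "fps_nth (poly p S) n = 0" for n
    using fps_X_power_dvd_iff[of "Suc n" "poly p S"] by (simp del: power_Suc)
  then have "poly p S = 0" by (simp add: fps_eq_iff)
  moreover have "fps_nth S 0 = c" using s[of 0] by (simp add: S_def)
  ultimately show ?thesis by blast
qed

lemma fps_root:
  fixes u :: "'a::field fps"
  assumes "fps_nth u 0 = d ^ n" "d \<noteq> 0" "of_nat n \<noteq> (0 :: 'a)"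
  shows "\<exists>w. w ^ n = u \<and> fps_nth w 0 = d"
proof -
  define p where "p = monom 1 n - [:u:]"
  have n: "n > 0" using assms(3) by (cases n) auto
  have "pderiv p = monom (of_nat n) (n - 1)"
    by (simp add: p_def pderiv_diff pderiv_monom pderiv_pCons)
  moreover have "poly p s = s ^ n - u" for s
    by (simp add: p_def poly_monom)
  ultimately show ?thesis
    using fps_hensel[of p d] assms by (auto simp: poly_monom fps_power_zeroth)
qed

section \<open>Rational valuation subrings of a field\<close>

text \<open>For a valuation ring this is the maximal ideal.\<close>

definition nonunits :: "'b::field set \<Rightarrow> 'b set" where
  "nonunits S = {z \<in> S. z = 0 \<or> inverse z \<notin> S}"

text \<open>A valuation ring \<open>S\<close> of the subfield \<open>K\<close> whose residue field is the field of constants, embedded by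
  \<open>\<kappa>\<close>. Working with subsets of an ambient field gives access to its arithmetic. The locale is used for
  the places of the function field, seen inside the Laurent series, and for the ring of power series
  itself.\<close>

locale rational_valuation_subring =
  fixes \<kappa> :: "'a::field \<Rightarrow> 'b::field" and K S :: "'b set"
  assumes \<kappa>: "ring_morphism \<kappa>"
    and K_mult: "\<And>a b. a \<in> K \<Longrightarrow> b \<in> K \<Longrightarrow> a * b \<in> K"
    and K_inverse: "\<And>a. a \<in> K \<Longrightarrow> inverse a \<in> K"
    and subset: "S \<subseteq> K" and proper: "S \<noteq> K"
    and const_mem: "\<And>c. \<kappa> c \<in> S"
    and diff_mem: "\<And>a b. a \<in> S \<Longrightarrow> b \<in> S \<Longrightarrow> a - b \<in> S"
    and mult_mem: "\<And>a b. a \<in> S \<Longrightarrow> b \<in> S \<Longrightarrow> a * b \<in> S"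
    and total: "\<And>z. z \<in> K \<Longrightarrow> z \<in> S \<or> inverse z \<in> S"
    and residue: "\<And>z. z \<in> S \<Longrightarrow> \<exists>c. z - \<kappa> c \<in> nonunits S"
begin

lemma zero_mem: "0 \<in> S" and one_mem: "1 \<in> S"
  using const_mem[of 0] const_mem[of 1] by (simp_all add: ring_morphism_simps[OF \<kappa>])

lemma uminus_mem: "a \<in> S \<Longrightarrow> - a \<in> S"
  using diff_mem[OF zero_mem, of a] by simp

lemma add_mem: "a \<in> S \<Longrightarrow> b \<in> S \<Longrightarrow> a + b \<in> S"
  using diff_mem[OF _ uminus_mem, of a b] by simp

lemma power_mem: "a \<in> S \<Longrightarrow> a ^ n \<in> S"
  by (induction n) (simp_all add: one_mem mult_mem)

lemma sum_mem: "(\<And>i. i \<in> I \<Longrightarrow> f i \<in> S) \<Longrightarrow> sum f I \<in> S"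
  by (induction I rule: infinite_finite_induct) (simp_all add: zero_mem add_mem)

lemma nonunits_subset: "z \<in> nonunits S \<Longrightarrow> z \<in> S"
  by (simp add: nonunits_def)

lemma zero_nonunit: "0 \<in> nonunits S"
  by (simp add: nonunits_def zero_mem)

lemma nonunit_mult:
  assumes z: "z \<in> nonunits S" and s: "s \<in> S"
  shows "s * z \<in> nonunits S"
proof (cases "s * z = 0")
  case False
  have "inverse (s * z) \<notin> S"
  proof
    assume "inverse (s * z) \<in> S"
    then have "s * inverse (s * z) \<in> S" using s by (rule mult_mem[rotated])
    moreover have "s * inverse (s * z) = inverse z" using False by (simp add: field_simps)
    ultimately have "inverse z \<in> S" by metis
    then show False using z False by (simp add: nonunits_def)
  qed
  then show ?thesis using z s by (simp add: nonunits_def mult_mem)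
qed (auto simp: zero_nonunit)

lemma nonunit_uminus: "z \<in> nonunits S \<Longrightarrow> - z \<in> nonunits S"
  using nonunit_mult[of z "- 1"] by (simp add: uminus_mem one_mem)

text \<open>For nonzero \<open>z\<close> and \<open>w\<close> one of the quotients \<open>z / w\<close> and \<open>w / z\<close> lies in \<open>S\<close>, so the sum is a multiple
  of one of the two summands.\<close>

lemma nonunit_add:
  assumes z: "z \<in> nonunits S" and w: "w \<in> nonunits S"
  shows "z + w \<in> nonunits S"
proof -
  have *: "z + w \<in> nonunits S"
    if "z \<in> nonunits S" "w \<in> nonunits S" "w \<noteq> 0" "z * inverse w \<in> S" for z w
  proof -
    have "(1 + z * inverse w) * w \<in> nonunits S"
      using that by (intro nonunit_mult add_mem one_mem)
    moreover have "(1 + z * inverse w) * w = z + w"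
      using \<open>w \<noteq> 0\<close> by (simp add: field_simps)
    ultimately show ?thesis by simp
  qed
  show ?thesis
  proof (cases "z = 0 \<or> w = 0")
    case False
    have "z * inverse w \<in> K"
      using z w nonunits_subset subset by (intro K_mult K_inverse) auto
    then have "z * inverse w \<in> S \<or> w * inverse z \<in> S"
      using total[of "z * inverse w"] by (simp add: mult.commute)
    then show ?thesis using *[of z w] *[of w z] z w False by (auto simp: add.commute)
  qed (use z w in auto)
qed

lemma nonunit_diff: "z \<in> nonunits S \<Longrightarrow> w \<in> nonunits S \<Longrightarrow> z - w \<in> nonunits S"
  using nonunit_add[of z "- w"] nonunit_uminus[of w] by simp

lemma unit_inverse: "z \<in> S \<Longrightarrow> z \<notin> nonunits S \<Longrightarrow> inverse z \<in> S \<and> z \<noteq> 0"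
  by (auto simp: nonunits_def)

lemma const_nonunit_iff: "\<kappa> c \<in> nonunits S \<longleftrightarrow> c = 0"
proof
  assume *: "\<kappa> c \<in> nonunits S"
  show "c = 0"
  proof (rule ccontr)
    assume "c \<noteq> 0"
    then have "\<kappa> c * \<kappa> (inverse c) = 1"
      by (simp flip: ring_morphism_mult[OF \<kappa>] add: ring_morphism_one[OF \<kappa>])
    then have "\<kappa> c \<noteq> 0" "inverse (\<kappa> c) = \<kappa> (inverse c)"
      by (auto intro: inverse_unique)
    then show False using * const_mem[of "inverse c"] by (simp add: nonunits_def)
  qed
qed (simp add: zero_nonunit ring_morphism_zero[OF \<kappa>])

lemma residue_unique:
  assumes "z - \<kappa> c \<in> nonunits S" "z - \<kappa> c' \<in> nonunits S"
  shows "c = c'"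
proof -
  have "\<kappa> (c' - c) \<in> nonunits S"
    using nonunit_diff[OF assms] by (simp add: ring_morphism_diff[OF \<kappa>])
  then show ?thesis by (simp add: const_nonunit_iff)
qed

text \<open>The instance of integral closedness that is needed: otherwise \<open>inverse z\<close> would be in \<open>S\<close>, and \<open>z\<close> is a
  power of it times \<open>z\<^sup>n\<close>.\<close>

lemma power_mem_imp_mem:
  assumes z: "z \<in> K" and n: "n > 0" and p: "z ^ n \<in> S"
  shows "z \<in> S"
proof (cases "z \<in> S")
  case False
  then have inv: "inverse z \<in> S" using total z by blast
  have "z \<noteq> 0" using False zero_mem by blast
  then have "z = z ^ n * inverse z ^ (n - 1)"
    using n by (cases n) (simp_all add: field_simps)
  then show ?thesis using mult_mem[OF p power_mem[OF inv]] by metis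
qed

text \<open>Evaluation of a polynomial commutes with reduction to the residue field.\<close>

lemma eval_poly_residue:
  fixes h :: "'r::comm_ring_1 \<Rightarrow> 'b" and r :: "'r \<Rightarrow> 'a"
  assumes h: "ring_morphism h" and r: "ring_morphism r"
    and coeffs: "\<And>c. h c - \<kappa> (r c) \<in> nonunits S"
    and y: "y - \<kappa> b \<in> nonunits S"
  shows "eval_poly h y g - \<kappa> (eval_poly r b g) \<in> nonunits S"
proof (induction g)
  case 0
  show ?case
    by (simp add: eval_poly_0[OF h] eval_poly_0[OF r] ring_morphism_zero[OF \<kappa>] zero_nonunit)
next
  case (pCons c g)
  let ?G = "eval_poly h y g" and ?g = "\<kappa> (eval_poly r b g)"
  have "y \<in> S" using add_mem[OF nonunits_subset[OF y] const_mem[of b]] by simp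
  then have "(h c - \<kappa> (r c)) + (y * (?G - ?g) + ?g * (y - \<kappa> b)) \<in> nonunits S"
    using pCons y coeffs by (intro nonunit_add nonunit_mult const_mem) auto
  then show ?case
    by (simp add: eval_poly_pCons[OF h] eval_poly_pCons[OF r] ring_morphism_simps[OF \<kappa>] algebra_simps)
qed

lemma eval2_residue:
  assumes x: "x - \<kappa> a \<in> nonunits S" and y: "y - \<kappa> b \<in> nonunits S"
  shows "eval_poly (eval_poly \<kappa> x) y g - \<kappa> (poly (poly g [:b:]) a) \<in> nonunits S"
  unfolding eval_at_point[symmetric]
proof (rule eval_poly_residue[OF ring_morphism_eval_poly[OF \<kappa>] ring_morphism_poly _ y])
  fix p :: "'a poly"
  show "eval_poly \<kappa> x p - \<kappa> (poly p a) \<in> nonunits S"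
    using eval_poly_residue[OF \<kappa> _ _ x, of "\<lambda>c. c" p]
    by (simp add: eval_poly_id zero_nonunit) (simp add: ring_morphism_def)
qed

lemma eval2_mem:
  assumes "x - \<kappa> a \<in> nonunits S" "y - \<kappa> b \<in> nonunits S"
  shows "eval_poly (eval_poly \<kappa> x) y g \<in> S"
  using add_mem[OF nonunits_subset[OF eval2_residue[OF assms, of g]] const_mem[of "poly (poly g [:b:]) a"]]
  by simp

lemma eval2_nonunit_iff:
  assumes "x - \<kappa> a \<in> nonunits S" "y - \<kappa> b \<in> nonunits S"
  shows "eval_poly (eval_poly \<kappa> x) y g \<in> nonunits S \<longleftrightarrow> poly (poly g [:b:]) a = 0"
  using residue_unique[of "eval_poly (eval_poly \<kappa> x) y g" 0] eval2_residue[OF assms, of g]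
  by (auto simp: ring_morphism_zero[OF \<kappa>])

end

text \<open>A valuation ring of rank one is a maximal proper subring. If \<open>S'\<close> contains an element \<open>z\<close> outside \<open>S\<close>,
  then \<open>inverse z\<close> is a nonunit of \<open>S\<close>, so multiplying by a large power of it brings any \<open>w\<close> into \<open>S\<close>;
  multiplying back by powers of \<open>z\<close> puts \<open>w\<close> into \<open>S'\<close>.\<close>

lemma rational_valuation_subring_maximal:
  assumes S: "rational_valuation_subring \<kappa> K S" and S': "rational_valuation_subring \<kappa>' K S'"
    and "S \<subseteq> S'"
    and archimedean: "\<And>z w. z \<in> nonunits S \<Longrightarrow> w \<in> K \<Longrightarrow> \<exists>n. w * z ^ n \<in> S"
  shows "S = S'"
proof (rule ccontr)
  interpret S: rational_valuation_subring \<kappa> K S by (rule S)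
  interpret S': rational_valuation_subring \<kappa>' K S' by (rule S')
  assume "S \<noteq> S'"
  then obtain z where z: "z \<in> S'" "z \<notin> S" using \<open>S \<subseteq> S'\<close> by blast
  then have "inverse z \<in> S" using S.total S'.subset by blast
  then have nz: "inverse z \<in> nonunits S" using z by (simp add: nonunits_def)
  have "z \<noteq> 0" using z S.zero_mem by blast
  have "w \<in> S'" if w: "w \<in> K" for w
  proof -
    obtain n where "w * inverse z ^ n \<in> S" using archimedean[OF nz w] by blast
    then have "w * inverse z ^ n * z ^ n \<in> S'"
      using z \<open>S \<subseteq> S'\<close> S'.mult_mem[OF _ S'.power_mem] by blast
    then show ?thesis using \<open>z \<noteq> 0\<close> by (simp add: field_simps)
  qed
  then show False using S'.subset S'.proper by blast
qed

section \<open>Evaluation at Laurent series\<close>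

interpretation laurent: rational_valuation_subring fls_const UNIV "{z :: 'a::field fls. fls_subdegree z \<ge> 0}"
  rewrites laurent_nonunits: "nonunits {z :: 'a::field fls. fls_subdegree z \<ge> 0} = {z. z = 0 \<or> fls_subdegree z > 0}"
proof -
  show nonunits: "nonunits {z :: 'a fls. fls_subdegree z \<ge> 0} = {z. z = 0 \<or> fls_subdegree z > 0}"
    by (auto simp: nonunits_def)
  show "rational_valuation_subring fls_const UNIV {z :: 'a fls. fls_subdegree z \<ge> 0}"
  proof
    show "{z :: 'a fls. fls_subdegree z \<ge> 0} \<noteq> UNIV"
      using fls_X_inv_subdegree[where ?'a = 'a] by (metis UNIV_I mem_Collect_eq neg_0_le_iff_le not_one_le_zero)
    show "a - b \<in> {z. fls_subdegree z \<ge> 0}"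
      if "a \<in> {z. fls_subdegree z \<ge> 0}" "b \<in> {z. fls_subdegree z \<ge> 0}" for a b :: "'a fls"
    proof (cases "a - b = 0")
      case False
      then show ?thesis using fls_subdegree_minus[of a b] that by auto
    qed simp
    show "a * b \<in> {z. fls_subdegree z \<ge> 0}"
      if "a \<in> {z. fls_subdegree z \<ge> 0}" "b \<in> {z. fls_subdegree z \<ge> 0}" for a b :: "'a fls"
      using that by (cases "a = 0 \<or> b = 0") auto
    show "z \<in> {z. fls_subdegree z \<ge> 0} \<or> inverse z \<in> {z. fls_subdegree z \<ge> 0}" for z :: "'a fls"
      by auto
    show "\<exists>c. z - fls_const c \<in> nonunits {z :: 'a fls. fls_subdegree z \<ge> 0}"
      if "z \<in> {z. fls_subdegree z \<ge> 0}" for z :: "'a fls"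
      unfolding nonunits using that
      by (intro exI[of _ "fls_nth z 0"]) (auto intro!: fls_subdegree_greaterI)
  qed (auto simp: ring_morphism_fls_const)
qed

lemma fls_nth_sum: "fls_nth (sum f I) n = (\<Sum>i\<in>I. fls_nth (f i) n)"
  by (induction I rule: infinite_finite_induct) simp_all

text \<open>No cancellation can occur at the least order among the terms.\<close>

lemma fls_sum_distinct_subdegree:
  fixes f :: "'i \<Rightarrow> 'a::field fls"
  assumes "finite I" and inj: "inj_on (\<lambda>i. fls_subdegree (f i)) {i \<in> I. f i \<noteq> 0}"
    and i: "i \<in> I" "f i \<noteq> 0"
  shows "sum f I \<noteq> 0" and "fls_subdegree (sum f I) \<le> fls_subdegree (f i)"
proof -
  let ?J = "{i \<in> I. f i \<noteq> 0}"
  have J: "finite ?J" "?J \<noteq> {}" using assms by auto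
  obtain j where j: "j \<in> ?J" and min: "\<And>k. k \<in> ?J \<Longrightarrow> fls_subdegree (f j) \<le> fls_subdegree (f k)"
    using arg_min_if_finite[OF J, of "\<lambda>i. fls_subdegree (f i)"] by (metis (no_types, lifting) not_le)
  have "fls_nth (f k) (fls_subdegree (f j)) = 0" if "k \<in> I - {j}" for k
  proof (cases "f k = 0")
    case False
    then have "fls_subdegree (f j) < fls_subdegree (f k)"
      using that min[of k] inj_onD[OF inj, of j k] j by fastforce
    then show ?thesis by simp
  qed simp
  then have "fls_nth (sum f I) (fls_subdegree (f j)) = fls_nth (f j) (fls_subdegree (f j))"
    using j \<open>finite I\<close> by (simp add: fls_nth_sum sum.remove[of I j])
  then have nz: "fls_nth (sum f I) (fls_subdegree (f j)) \<noteq> 0" using j by simp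
  then show "sum f I \<noteq> 0" by auto
  show "fls_subdegree (sum f I) \<le> fls_subdegree (f i)"
    using fls_subdegree_leI[OF nz] min[of i] i by simp
qed

abbreviation laurent_eval :: "'a::field fls \<Rightarrow> 'a poly \<Rightarrow> 'a fls" where
  "laurent_eval \<equiv> eval_poly fls_const"

lemmas ring_morphism_laurent_eval = ring_morphism_eval_poly[OF ring_morphism_fls_const]

text \<open>Pulling out the leading power of a series with a pole leaves a polynomial in its inverse.\<close>

lemma laurent_eval_reflect_poly:
  fixes x :: "'a::field fls"
  assumes "x \<noteq> 0"
  shows "laurent_eval x p = x ^ degree p * laurent_eval (inverse x) (reflect_poly p)"
proof -
  have "map_poly fls_const (reflect_poly p) = reflect_poly (map_poly fls_const p)"
    by (rule poly_eqI) (simp add: coeff_map_poly coeff_reflect_poly degree_map_poly)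
  then have "laurent_eval (inverse x) (reflect_poly p) = inverse x ^ degree p * laurent_eval x p"
    using poly_reflect_poly_nz[of "inverse x" "map_poly fls_const p"] assms
    by (simp add: eval_poly_def degree_map_poly)
  then show ?thesis using assms by (simp add: field_simps)
qed

lemma laurent_eval_subdegree:
  assumes "fls_subdegree x < 0" "p \<noteq> 0"
  shows "laurent_eval x p \<noteq> 0"
    and "fls_subdegree (laurent_eval x p) = int (degree p) * fls_subdegree x"
proof -
  have x: "x \<noteq> 0" using assms by auto
  let ?f = "\<lambda>i. fls_const (coeff p i) * x ^ i"
  have eq: "laurent_eval x p = (\<Sum>i<Suc (degree p). ?f i)"
    by (rule eval_poly_altdef[OF ring_morphism_fls_const]) simp
  have sub: "fls_subdegree (?f i) = int i * fls_subdegree x" if "?f i \<noteq> 0" for i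
    using that x by (simp add: fls_subdegree_pow)
  have "inj_on (\<lambda>i. fls_subdegree (?f i)) {i \<in> {..<Suc (degree p)}. ?f i \<noteq> 0}"
    using assms by (intro inj_onI) (auto simp: fls_subdegree_pow)
  moreover have lead: "?f (degree p) \<noteq> 0" using x assms by simp
  ultimately have le: "fls_subdegree (laurent_eval x p) \<le> int (degree p) * fls_subdegree x"
    and nz: "laurent_eval x p \<noteq> 0"
    using fls_sum_distinct_subdegree[of "{..<Suc (degree p)}" ?f "degree p"] sub[OF lead] eq by auto
  show "laurent_eval x p \<noteq> 0" by (rule nz)
  have "int (degree p) * fls_subdegree x \<le> fls_subdegree (laurent_eval x p)"
  proof (rule fls_subdegree_geI[OF nz])
    fix k assume k: "k < int (degree p) * fls_subdegree x"
    have zero: "fls_nth (?f i) k = 0" if "i < Suc (degree p)" for i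
    proof (cases "?f i = 0")
      case False
      have "int (degree p) * fls_subdegree x \<le> int i * fls_subdegree x"
        using that assms by (intro mult_right_mono_neg) auto
      then have "k < fls_subdegree (?f i)" using k sub[OF False] by linarith
      then show ?thesis by (rule fls_eq0_below_subdegree)
    next
      case True
      then show ?thesis by (simp only: fls_zero_nth)
    qed
    show "fls_nth (laurent_eval x p) k = 0"
      unfolding eq fls_nth_sum by (intro sum.neutral ballI zero) simp
  qed
  then show "fls_subdegree (laurent_eval x p) = int (degree p) * fls_subdegree x" using le by simp
qed

text \<open>A nonconstant series without pole is transcendental over the constants: after a translation of the
  polynomial the terms of its expansion in \<open>x - a\<close> have distinct orders.\<close>

lemma laurent_eval_eq_0_imp:
  assumes "x - fls_const a \<noteq> 0" "fls_subdegree (x - fls_const a) > 0" "laurent_eval x p = 0"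
  shows "p = 0"
proof -
  define w where "w = x - fls_const a"
  define q where "q = pcompose p [:a, 1:]"
  have w: "w \<noteq> 0" "fls_subdegree w > 0" using assms by (simp_all add: w_def)
  have "laurent_eval w q = laurent_eval x p"
    unfolding q_def
  proof (induction p)
    case (pCons c p)
    then show ?case
      by (simp add: eval_poly_pCons[OF ring_morphism_fls_const] pcompose_pCons
          ring_morphism_simps[OF ring_morphism_laurent_eval] w_def
          eval_poly_0[OF ring_morphism_fls_const] eval_poly_smult[OF ring_morphism_fls_const] algebra_simps)
  qed (simp add: eval_poly_0[OF ring_morphism_fls_const])
  then have eq: "(\<Sum>i<Suc (degree q). fls_const (coeff q i) * w ^ i) = 0" (is "sum ?f _ = 0")
    using assms(3) eval_poly_altdef[OF ring_morphism_fls_const, of q "Suc (degree q)" w] by simp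
  have sub: "fls_subdegree (?f i) = int i * fls_subdegree w" if "?f i \<noteq> 0" for i
    using that w by (simp add: fls_subdegree_pow)
  have "q = 0"
  proof (rule ccontr)
    assume "q \<noteq> 0"
    have "inj_on (\<lambda>i. fls_subdegree (?f i)) {i \<in> {..<Suc (degree q)}. ?f i \<noteq> 0}"
      using w by (intro inj_onI) (auto simp: fls_subdegree_pow)
    moreover have "?f (degree q) \<noteq> 0" using w \<open>q \<noteq> 0\<close> by simp
    ultimately show False
      using fls_sum_distinct_subdegree(1)[of "{..<Suc (degree q)}" ?f "degree q"] eq by auto
  qed
  then show ?thesis by (auto simp: q_def dest: pcompose_eq_0)
qed

lemma degree_superelliptic:
  assumes "\<beta> > 0"
  shows "degree (map_poly to_fract (superelliptic \<beta> A)) = \<beta>"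
    and "map_poly to_fract (superelliptic \<beta> A) = monom 1 \<beta> - [:to_fract A:]"
proof -
  have *: "map_poly to_fract (superelliptic \<beta> A) = monom 1 \<beta> - [:to_fract A:]"
    by (rule poly_eqI)
      (simp add: superelliptic_def coeff_map_poly to_fract_diff coeff_pCons split: nat.split)
  show "map_poly to_fract (superelliptic \<beta> A) = monom 1 \<beta> - [:to_fract A:]" by (rule *)
  show "degree (map_poly to_fract (superelliptic \<beta> A)) = \<beta>"
    unfolding * diff_conv_add_uminus
    by (subst degree_add_eq_left) (use assms in \<open>simp_all add: degree_monom_eq\<close>)
qed

section \<open>Branches of the curve as Laurent series\<close>

lemma ring_morphism_fps_const: "ring_morphism (fps_const :: 'a::comm_ring_1 \<Rightarrow> 'a fps)"
  by (simp add: ring_morphism_def)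

lemma fps_to_fls_eval_poly:
  "fps_to_fls (eval_poly fps_const s p) = laurent_eval (fps_to_fls s) (p :: 'a::field poly)"
  by (induction p)
    (simp_all add: eval_poly_0[OF ring_morphism_fps_const] eval_poly_0[OF ring_morphism_fls_const]
      eval_poly_pCons[OF ring_morphism_fps_const] eval_poly_pCons[OF ring_morphism_fls_const]
      fls_times_fps_to_fls)

lemma fps_nth_eval_poly:
  "fps_nth (eval_poly fps_const s p) 0 = poly p (fps_nth s 0 :: 'a::field)"
  by (induction p)
    (simp_all add: eval_poly_0[OF ring_morphism_fps_const] eval_poly_pCons[OF ring_morphism_fps_const])

lemma fps_to_fls_minus_const:
  "fps_nth s 0 = c \<Longrightarrow> fps_to_fls s - fls_const c = 0 \<or> fls_subdegree (fps_to_fls s - fls_const c) > 0"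
  using subdegree_pos_iff[of "s - fps_const c"]
  by (auto simp: fls_subdegree_fls_to_fps simp flip: fps_const_to_fls fps_to_fls_minus)

lemma separable_poly_simple_root:
  assumes "separable_poly A" "poly A a = 0"
  shows "poly (pderiv A) a \<noteq> 0"
proof
  assume "poly (pderiv A) a = 0"
  then have "[:- a, 1:] dvd A" "[:- a, 1:] dvd pderiv A"
    using assms by (simp_all add: poly_eq_0_iff_dvd)
  then have "is_unit [:- a, 1:]"
    using assms(1) unfolding separable_poly_def by (rule coprime_common_divisor[rotated])
  then show False by (simp add: is_unit_iff_degree)
qed

text \<open>The affine curve is smooth. Where \<open>b \<noteq> 0\<close> the derivative \<open>\<beta> b\<^sup>\<beta>\<^sup>-\<^sup>1\<close> with respect to \<open>y\<close> is nonzero and \<open>x - a\<close> is a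
  parameter; where \<open>b = 0\<close> the derivative of \<open>A\<close> at \<open>a\<close> is nonzero by separability and \<open>y\<close> is a
  parameter. Hensel's lemma solves for the other coordinate.\<close>

lemma branch_at_affine_point:
  fixes A :: "'a::field poly"
  assumes "of_nat \<beta> \<noteq> (0 :: 'a)" "separable_poly A" and P: "b ^ \<beta> = poly A a"
  shows "\<exists>x y. y ^ \<beta> = laurent_eval x A \<and> x - fls_const a \<noteq> 0 \<and>
    fls_subdegree (x - fls_const a) > 0 \<and> (y - fls_const b = 0 \<or> fls_subdegree (y - fls_const b) > 0)"
proof (cases "b = 0")
  case False
  define s where "s = fps_const a + fps_X"
  obtain w where w: "w ^ \<beta> = eval_poly fps_const s A" "fps_nth w 0 = b"
    using fps_root[of "eval_poly fps_const s A" b \<beta>] assms False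
    by (auto simp: fps_nth_eval_poly s_def)
  have "fps_to_fls w ^ \<beta> = laurent_eval (fps_to_fls s) A"
    using w by (metis fps_to_fls_power fps_to_fls_eval_poly)
  moreover have "fps_to_fls s - fls_const a = fls_X" by (simp add: s_def)
  ultimately show ?thesis
    using fps_to_fls_minus_const[OF w(2)]
    by (intro exI[of _ "fps_to_fls s"] exI[of _ "fps_to_fls w"]) simp
next
  case True
  have "\<beta> > 0" using assms(1) by (cases \<beta>) auto
  then have root: "poly A a = 0" using P True by (simp add: power_0_left)
  define p where "p = map_poly fps_const A - [:fps_X ^ \<beta>:]"
  have p: "poly p s = eval_poly fps_const s A - fps_X ^ \<beta>" for s
    by (simp add: p_def eval_poly_def)
  have "pderiv p = map_poly fps_const (pderiv A)"
    by (rule poly_eqI)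
      (simp add: p_def pderiv_diff pderiv_pCons coeff_pderiv coeff_map_poly
        flip: fps_of_nat fps_const_mult del: of_nat_Suc)
  then have "fps_nth (poly (pderiv p) (fps_const a)) 0 = poly (pderiv A) a"
    using fps_nth_eval_poly[of "fps_const a" "pderiv A"] by (simp add: eval_poly_def)
  then obtain s where s: "poly p s = 0" "fps_nth s 0 = a"
    using fps_hensel[of p a] separable_poly_simple_root[OF assms(2) root] root \<open>\<beta> > 0\<close>
    by (auto simp: p fps_nth_eval_poly fps_power_zeroth)
  have eq: "laurent_eval (fps_to_fls s) A = fls_X ^ \<beta>"
    using s(1) by (simp add: p fps_to_fls_power flip: fps_to_fls_eval_poly)
  have "fps_to_fls s - fls_const a \<noteq> 0"
  proof
    assume "fps_to_fls s - fls_const a = 0"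
    then have "s = fps_const a"
      by (metis eq_iff_diff_eq_0 fps_const_to_fls fps_to_fls_eq_iff)
    moreover have "eval_poly fps_const (fps_const a) A = fps_const (poly A a)"
      by (induction A)
       (simp_all add: eval_poly_0[OF ring_morphism_fps_const] eval_poly_pCons[OF ring_morphism_fps_const])
    ultimately show False using s(1) root by (simp add: p)
  qed
  then show ?thesis
    using fps_to_fls_minus_const[OF s(2)] eq True
    by (intro exI[of _ "fps_to_fls s"] exI[of _ fls_X]) simp
qed

text \<open>Take \<open>x = c X\<^sup>-\<^sup>\<beta>\<close>, where \<open>X\<close> is the variable of the Laurent series. Then \<open>A(x)\<close> is \<open>x\<^sup>\<alpha>\<close> times a power series
  with constant coefficient the leading coefficient \<open>L\<close> of \<open>A\<close>, so a \<open>\<beta>\<close>-th root exists as soon as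
  \<open>c\<^sup>\<alpha> L\<close> is a \<open>\<beta>\<close>-th power. With \<open>c = L\<^sup>l\<close> this is \<open>L\<^sup>\<alpha>\<^sup>l\<^sup>+\<^sup>1\<close>, and coprimality of \<open>\<alpha>\<close> and \<open>\<beta>\<close> provides an \<open>l\<close> for
  which the exponent is a multiple of \<open>\<beta>\<close>.\<close>

lemma branch_at_infinity:
  fixes A :: "'a::field poly"
  assumes \<beta>: "of_nat \<beta> \<noteq> (0 :: 'a)" and "A \<noteq> 0" and coprime: "coprime (degree A) \<beta>"
  shows "\<exists>x y. y ^ \<beta> = laurent_eval x A \<and> fls_subdegree x = - int \<beta> \<and>
    fls_subdegree y = - int (degree A) \<and> y \<noteq> 0"
proof -
  have "\<beta> > 0" using \<beta> by (cases \<beta>) auto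
  obtain d m l where "d dvd \<beta>" "d dvd degree A" "\<beta> * m = degree A * l + d"
    using bezout_add_strong_nat[of \<beta> "degree A"] \<open>\<beta> > 0\<close> by auto
  then have ml: "\<beta> * m = degree A * l + 1"
    using coprime by (metis coprime_common_divisor_nat)
  define L where "L = lead_coeff A"
  have "L \<noteq> 0" using \<open>A \<noteq> 0\<close> by (simp add: L_def)
  define c where "c = L ^ l"
  \<comment> \<open>The inverse of \<open>x\<close>, which is a power series.\<close>
  define z where "z = fps_const (inverse c) * fps_X ^ \<beta>"
  define x where "x = inverse (fps_to_fls z)"
  have "c \<noteq> 0" using \<open>L \<noteq> 0\<close> by (simp add: c_def)
  define v where "v = eval_poly fps_const z (reflect_poly A)"
  have "fps_nth (fps_const (c ^ degree A) * v) 0 = (L ^ m) ^ \<beta>"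
  proof -
    have "fps_nth v 0 = L"
      using \<open>\<beta> > 0\<close> by (simp add: v_def fps_nth_eval_poly z_def L_def fps_power_zeroth power_0_left poly_0_coeff_0)
    moreover have "(L ^ m) ^ \<beta> = c ^ degree A * L"
      unfolding c_def by (simp add: ml mult.commute flip: power_mult power_Suc2)
    ultimately show ?thesis by simp
  qed
  then obtain w where w: "w ^ \<beta> = fps_const (c ^ degree A) * v" "fps_nth w 0 = L ^ m"
    using fps_root[of "fps_const (c ^ degree A) * v" "L ^ m" \<beta>] \<beta> \<open>L \<noteq> 0\<close> by auto
  define y where "y = fps_to_fls w * inverse (fls_X ^ degree A)"
  have z: "fps_to_fls z = fls_const (inverse c) * fls_X ^ \<beta>"
    by (simp add: z_def fls_times_fps_to_fls fps_to_fls_power)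
  have "fps_to_fls z \<noteq> 0" using z \<open>c \<noteq> 0\<close> by simp
  then have "x \<noteq> 0" by (simp add: x_def)
  have v: "laurent_eval x A = x ^ degree A * fps_to_fls v"
    using laurent_eval_reflect_poly[OF \<open>x \<noteq> 0\<close>, of A]
    by (simp add: v_def fps_to_fls_eval_poly x_def)
  have x: "x = fls_const c * inverse (fls_X ^ \<beta>)"
    unfolding x_def z using \<open>c \<noteq> 0\<close> by (simp add: fls_inverse_const)
  have "y ^ \<beta> = fls_const (c ^ degree A) * fps_to_fls v * inverse (fls_X ^ degree A) ^ \<beta>"
    unfolding y_def power_mult_distrib fps_to_fls_power[symmetric] w(1)
    by (simp add: fls_times_fps_to_fls)
  also have "\<dots> = x ^ degree A * fps_to_fls v"
    unfolding x by (simp add: power_mult_distrib fls_const_power power_inverse power_mult[symmetric] mult.commute)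
  finally have "y ^ \<beta> = laurent_eval x A" using v by simp
  moreover have "fls_subdegree x = - int \<beta>"
    unfolding x using \<open>c \<noteq> 0\<close> by simp
  moreover have "w \<noteq> 0" using w(2) \<open>L \<noteq> 0\<close> by auto
  moreover have "subdegree w = 0" using w(2) \<open>L \<noteq> 0\<close> by (simp add: subdegree_eq_0)
  ultimately show ?thesis
    by (intro exI[of _ x] exI[of _ y])
      (simp add: y_def fls_subdegree_fls_to_fps)
qed

section \<open>Local uniformizers\<close>

text \<open>A function \<open>t\<close> that generates the maximal ideal of the local ring at \<open>(a, b)\<close>, stated with polynomials:
  every \<open>g\<close> that vanishes at the point is a multiple of \<open>t\<close> on the curve after multiplication by some \<open>e\<close>
  that does not vanish there. Such a \<open>g\<close> is a combination of \<open>x - a\<close> and \<open>y - b\<close>. If \<open>b \<noteq> 0\<close>, then \<open>y - b\<close>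
  times \<open>e = (y\<^sup>\<beta> - b\<^sup>\<beta>) / (y - b)\<close> equals \<open>A(x) - A(a)\<close> on the curve, a multiple of \<open>x - a\<close>. If
  \<open>b = 0\<close>, then \<open>x - a\<close> times \<open>e = A(x) / (x - a)\<close> equals \<open>y\<^sup>\<beta>\<close> on the curve, a multiple of \<open>y\<close>.\<close>

lemma local_uniformizer:
  fixes A :: "'a::field poly"
  assumes \<beta>: "of_nat \<beta> \<noteq> (0 :: 'a)" "separable_poly A" and P: "b ^ \<beta> = poly A a"
  shows "\<exists>t. poly (poly t [:b:]) a = 0 \<and>
    (\<forall>g. poly (poly g [:b:]) a = 0 \<longrightarrow>
      (\<exists>e g'. poly (poly e [:b:]) a \<noteq> 0 \<and> superelliptic \<beta> A dvd e * g - t * g'))"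
proof -
  define F where "F = superelliptic \<beta> A"
  have "\<beta> > 0" using \<beta>(1) by (cases \<beta>) auto
  have split: "\<exists>u v. g = [:[:- a, 1:]:] * u + [:[:- b:], 1:] * v"
    if g: "poly (poly g [:b:]) a = 0" for g
  proof -
    have "[:- [:b:], 1:] dvd g - [:poly g [:b:]:]"
      using poly_eq_0_iff_dvd[of "g - [:poly g [:b:]:]" "[:b:]"] by simp
    then obtain v where v: "g - [:poly g [:b:]:] = [:- [:b:], 1:] * v" by (rule dvdE)
    obtain u where "poly g [:b:] = [:- a, 1:] * u"
      using g unfolding poly_eq_0_iff_dvd by (rule dvdE)
    then have "[:poly g [:b:]:] = [:[:- a, 1:]:] * [:u:]" by simp
    moreover have "g = [:poly g [:b:]:] + [:- [:b:], 1:] * v"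
      using v by (metis add.commute diff_add_cancel)
    ultimately have "g = [:[:- a, 1:]:] * [:u:] + [:[:- b:], 1:] * v"
      by (metis minus_pCons minus_zero)
    then show ?thesis by blast
  qed
  have F: "monom 1 \<beta> = F + [:A:]" by (simp add: F_def superelliptic_def)
  show ?thesis
  proof (cases "b = 0")
    case False
    have "[:- [:b:], 1:] dvd monom 1 \<beta> - [:[:b ^ \<beta>:]:]"
      using poly_eq_0_iff_dvd[of "monom 1 \<beta> - [:[:b ^ \<beta>:]:]" "[:b:]"]
      by (simp add: poly_monom poly_const_pow)
    then obtain e where e: "monom 1 \<beta> - [:[:b ^ \<beta>:]:] = [:- [:b:], 1:] * e" by (rule dvdE)
    then have "pderiv (monom 1 \<beta> - [:[:b ^ \<beta>:]:]) = pderiv ([:- [:b:], 1:] * e)" by simp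
    then have "monom (of_nat \<beta>) (\<beta> - 1) = [:- [:b:], 1:] * pderiv e + e"
      unfolding pderiv_mult pderiv_diff by (simp add: pderiv_monom pderiv_pCons)
    from arg_cong[OF this, of "\<lambda>p. poly p [:b:]"] have "poly e [:b:] = smult (of_nat \<beta>) ([:b:] ^ (\<beta> - 1))"
      by (simp add: poly_monom of_nat_poly)
    then have "poly (poly e [:b:]) a = of_nat \<beta> * b ^ (\<beta> - 1)"
      by (simp add: poly_power)
    then have e0: "poly (poly e [:b:]) a \<noteq> 0" using False \<beta> by simp
    have "[:- a, 1:] dvd A - [:poly A a:]"
      using poly_eq_0_iff_dvd[of "A - [:poly A a:]" a] by simp
    then obtain h where h: "A - [:poly A a:] = [:- a, 1:] * h" by (rule dvdE)
    show ?thesis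
    proof (rule exI[of _ "[:[:- a, 1:]:]"], intro conjI allI impI)
      fix g assume "poly (poly g [:b:]) a = 0"
      then obtain u v where g: "g = [:[:- a, 1:]:] * u + [:[:- b:], 1:] * v"
        using split by blast
      have "e * [:[:- b:], 1:] = F + [:A:] - [:[:b ^ \<beta>:]:]"
        using e F by (simp add: mult.commute)
      also have "\<dots> = F + [:A - [:poly A a:]:]"
        unfolding P by simp
      also have "\<dots> = F + [:[:- a, 1:]:] * [:h:]"
        unfolding h by simp
      finally have eq: "e * [:[:- b:], 1:] = F + [:[:- a, 1:]:] * [:h:]" .
      have "e * g - [:[:- a, 1:]:] * (u * e + [:h:] * v) = (e * [:[:- b:], 1:]) * v - [:[:- a, 1:]:] * ([:h:] * v)"
        unfolding g by (simp only: algebra_simps)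
      also have "\<dots> = F * v"
        unfolding eq by (simp only: algebra_simps)
      finally show "\<exists>e g'. poly (poly e [:b:]) a \<noteq> 0 \<and> superelliptic \<beta> A dvd e * g - [:[:- a, 1:]:] * g'"
        using e0 F_def by (metis dvd_triv_left)
    qed simp
  next
    case True
    then have root: "poly A a = 0" using P \<open>\<beta> > 0\<close> by (simp add: power_0_left)
    then obtain h where h: "A = [:- a, 1:] * h" unfolding poly_eq_0_iff_dvd by (rule dvdE)
    then have "pderiv A = [:- a, 1:] * pderiv h + h"
      by (subst h, subst pderiv_mult) (simp add: pderiv_pCons)
    then have h0: "poly h a \<noteq> 0" using separable_poly_simple_root[OF \<beta>(2) root] by simp
    show ?thesis
    proof (rule exI[of _ "[:0, 1:]"], intro conjI allI impI)
      fix g assume "poly (poly g [:b:]) a = 0"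
      then obtain u v where g: "g = [:[:- a, 1:]:] * u + [:0, 1:] * v"
        using split[of g] True by auto
      have eq: "[:h:] * [:[:- a, 1:]:] = monom 1 \<beta> - F" using h F by (simp add: mult.commute)
      have mon: "monom 1 \<beta> = [:0, 1:] * monom (1 :: 'a poly) (\<beta> - 1)"
        using \<open>\<beta> > 0\<close> by (cases \<beta>) (simp_all add: monom_Suc)
      have "[:h:] * g - [:0, 1:] * (monom 1 (\<beta> - 1) * u + [:h:] * v)
          = ([:h:] * [:[:- a, 1:]:]) * u - [:0, 1:] * monom 1 (\<beta> - 1) * u"
        unfolding g by (simp only: algebra_simps)
      also have "\<dots> = F * (- u)" unfolding eq mon[symmetric] by (simp add: algebra_simps)
      finally show "\<exists>e g'. poly (poly e [:b:]) a \<noteq> 0 \<and> superelliptic \<beta> A dvd e * g - [:0, 1:] * g'"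
        using h0 F_def by (intro exI[of _ "[:h:]"] exI[of _ "monom 1 (\<beta> - 1) * u + [:h:] * v"]) simp
    qed (simp add: True)
  qed
qed

section \<open>The function field inside the Laurent series\<close>

abbreviation curve_eval :: "'a::field fls \<Rightarrow> 'a fls \<Rightarrow> 'a poly poly \<Rightarrow> 'a fls" where
  "curve_eval X Y \<equiv> eval_poly (laurent_eval X) Y"

abbreviation field_eval :: "'a::field fls \<Rightarrow> 'a fls \<Rightarrow> 'a poly fract poly \<Rightarrow> 'a fls" where
  "field_eval X Y \<equiv> eval_poly (eval_fract (laurent_eval X)) Y"

lemmas ring_morphism_curve_eval = ring_morphism_eval_poly[OF ring_morphism_laurent_eval]

lemma curve_eval_superelliptic: "curve_eval X Y (superelliptic \<beta> A) = Y ^ \<beta> - laurent_eval X A"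
  by (simp add: superelliptic_def ring_morphism_diff[OF ring_morphism_curve_eval]
      eval_poly_monom[OF ring_morphism_laurent_eval] eval_poly_const[OF ring_morphism_laurent_eval]
      ring_morphism_one[OF ring_morphism_laurent_eval])

lemma superelliptic_at_point:
  "poly (poly (superelliptic \<beta> A) [:b:]) a = b ^ \<beta> - poly A (a::'a::field)"
  by (simp add: superelliptic_def poly_monom)

lemma clear_denominators:
  fixes u :: "'r::idom fract poly"
  shows "\<exists>h g. h \<noteq> 0 \<and> smult (to_fract h) u = map_poly to_fract g"
proof (induction u)
  case 0
  show ?case by (intro exI[of _ 1] exI[of _ 0]) simp
next
  case (pCons z u)
  then obtain h g where hg: "h \<noteq> 0" "smult (to_fract h) u = map_poly to_fract g" by blast
  obtain p q where z: "z = Fract p q" "q \<noteq> 0" by (cases z)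
  have "smult (to_fract (q * h)) (pCons z u) = map_poly to_fract (pCons (p * h) (smult q g))"
  proof -
    have "to_fract (q * h) * z = to_fract (p * h)"
      using z by (simp add: to_fract_def eq_fract)
    moreover have "smult (to_fract (q * h)) u = map_poly to_fract (smult q g)"
      using hg by (simp add: map_poly_smult smult_smult[symmetric] del: smult_smult)
    ultimately show ?thesis by (simp add: map_poly_pCons)
  qed
  then show ?case using hg z by (metis mult_eq_0_iff)
qed

text \<open>The multiples \<open>m i\<close> with \<open>i < \<beta>\<close> are distinct modulo \<open>\<beta>\<close>. This separates the pole orders of the terms
  \<open>r(x) y\<^sup>i\<close>.\<close>

lemma coprime_cong_unique:
  fixes m \<beta> i j :: nat
  assumes "coprime m \<beta>" "i < \<beta>" "j < \<beta>" and eq: "int m * (int i - int j) = int \<beta> * k"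
  shows "i = j"
proof -
  have "int \<beta> dvd int m * (int i - int j)" using eq by simp
  then have "int \<beta> dvd int i - int j"
    using assms(1) by (subst (asm) coprime_dvd_mult_right_iff) (auto simp: coprime_commute)
  moreover have "\<bar>int i - int j\<bar> < int \<beta>" using assms by auto
  ultimately show ?thesis using dvd_imp_le_int[of "int i - int j" "int \<beta>"] by fastforce
qed

text \<open>The pair \<open>x, y\<close> is a branch at infinity. It is fixed once and for all to embed the function field.\<close>

locale superelliptic_laurent =
  fixes A :: "'a::field poly" and \<beta> :: nat and x y :: "'a fls"
  assumes \<beta>: "of_nat \<beta> \<noteq> (0 :: 'a)" and separable: "separable_poly A"
    and coprime: "coprime (degree A) \<beta>"
    and curve: "y ^ \<beta> = laurent_eval x A"
    and x_subdegree: "fls_subdegree x = - int \<beta>"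
    and y_subdegree: "fls_subdegree y = - int (degree A)" and y_nonzero: "y \<noteq> 0"
begin

text \<open>The set \<open>V\<close> of remainders modulo \<open>f\<close> is the carrier of the function field, and \<open>K\<close> is its image under
  the embedding \<open>\<iota>\<close>.\<close>

definition "F = superelliptic \<beta> A"
definition "f = map_poly to_fract F"
definition "V = {u :: 'a poly fract poly. degree u < \<beta>}"
definition "\<iota> = field_eval x y"
definition "K = \<iota> ` V"

lemma \<beta>_pos: "\<beta> > 0" using \<beta> by (cases \<beta>) auto

lemma x_neg: "fls_subdegree x < 0" using x_subdegree \<beta>_pos by simp

lemma degree_f: "degree f = \<beta>" and f_nonzero: "f \<noteq> 0"
  using degree_superelliptic(1)[OF \<beta>_pos, of A] \<beta>_pos by (auto simp: f_def F_def)

lemma mod_in_V: "u mod f \<in> V"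
  using degree_mod_less[OF f_nonzero, of u] degree_f \<beta>_pos by (auto simp: V_def)

lemma V_mod: "u \<in> V \<Longrightarrow> u mod f = u"
  by (simp add: V_def mod_poly_less degree_f)

lemma V_add: "u \<in> V \<Longrightarrow> v \<in> V \<Longrightarrow> u + v \<in> V"
  and V_diff: "u \<in> V \<Longrightarrow> v \<in> V \<Longrightarrow> u - v \<in> V"
  and V_uminus: "u \<in> V \<Longrightarrow> - u \<in> V"
  and V_const: "[:c:] \<in> V" and V_0: "0 \<in> V" and V_1: "1 \<in> V"
  using \<beta>_pos by (auto simp: V_def intro: degree_add_less degree_diff_less)

text \<open>The remainder that represents the class of a polynomial in \<open>x\<close> and \<open>y\<close>.\<close>

definition reduced :: "'a poly poly \<Rightarrow> 'a poly fract poly" where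
  "reduced g = map_poly to_fract g mod f"

lemma reduced_in_V: "reduced g \<in> V"
  unfolding reduced_def by (rule mod_in_V)

text \<open>Any transcendental \<open>X\<close> together with a \<open>\<beta>\<close>-th root \<open>Y\<close> of \<open>A(X)\<close> defines a morphism from \<open>k(x)[y]\<close> to the
  Laurent series that vanishes on \<open>f\<close>, hence one from the function field.\<close>

context
  fixes X Y :: "'a fls"
  assumes inj: "\<forall>p. laurent_eval X p = 0 \<longrightarrow> p = 0" and XY: "Y ^ \<beta> = laurent_eval X A"
begin

lemmas ring_morphism_field_eval =
  ring_morphism_eval_poly[OF ring_morphism_eval_fract[OF ring_morphism_laurent_eval inj], of Y]

lemma field_eval_map_poly: "field_eval X Y (map_poly to_fract g) = curve_eval X Y g"
  using eval_poly_map_poly[OF ring_morphism_eval_fract[OF ring_morphism_laurent_eval inj] ring_morphism_to_fract]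
  by (simp add: eval_fract_to_fract[OF ring_morphism_laurent_eval inj])

lemma curve_eval_dvd: "F dvd g \<Longrightarrow> curve_eval X Y g = 0"
  by (elim dvdE)
    (simp add: ring_morphism_mult[OF ring_morphism_curve_eval] F_def curve_eval_superelliptic XY)

lemma field_eval_mod: "field_eval X Y (u mod f) = field_eval X Y u"
proof -
  have "field_eval X Y f = 0"
    unfolding f_def field_eval_map_poly by (rule curve_eval_dvd) simp
  moreover have "field_eval X Y u = field_eval X Y (u div f * f + u mod f)"
    by (simp only: div_mult_mod_eq)
  ultimately show ?thesis
    by (simp only: ring_morphism_add[OF ring_morphism_field_eval] ring_morphism_mult[OF ring_morphism_field_eval])
      simp
qed

lemma field_eval_reduced: "field_eval X Y (reduced g) = curve_eval X Y g"
  by (simp add: reduced_def field_eval_mod field_eval_map_poly)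

lemma field_eval_const: "field_eval X Y [:to_fract p:] = laurent_eval X p"
  by (simp add: eval_poly_const[OF ring_morphism_eval_fract[OF ring_morphism_laurent_eval inj]]
      eval_fract_to_fract[OF ring_morphism_laurent_eval inj])

end

lemma inj_x: "\<forall>p. laurent_eval x p = 0 \<longrightarrow> p = 0"
  using laurent_eval_subdegree(1)[OF x_neg] by blast

lemmas ring_morphism_eval_fract_x = ring_morphism_eval_fract[OF ring_morphism_laurent_eval inj_x]

lemma ring_morphism_\<iota>: "ring_morphism \<iota>"
  unfolding \<iota>_def by (rule ring_morphism_field_eval[OF inj_x curve])

lemmas \<iota>_simps = ring_morphism_simps[OF ring_morphism_\<iota>]

lemma \<iota>_mod: "\<iota> (u mod f) = \<iota> u"
  unfolding \<iota>_def by (rule field_eval_mod[OF inj_x curve])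

lemma \<iota>_reduced: "\<iota> (reduced g) = curve_eval x y g"
  unfolding \<iota>_def by (rule field_eval_reduced[OF inj_x curve])

lemma \<iota>_const: "\<iota> [:to_fract [:c:]:] = fls_const c"
  unfolding \<iota>_def field_eval_const[OF inj_x curve] by (rule eval_poly_const[OF ring_morphism_fls_const])

lemma eval_fract_subdegree:
  assumes "q \<noteq> 0" "p \<noteq> 0"
  shows "eval_fract (laurent_eval x) (Fract p q) \<noteq> 0"
    and "fls_subdegree (eval_fract (laurent_eval x) (Fract p q)) = int \<beta> * (int (degree q) - int (degree p))"
proof -
  have "laurent_eval x p \<noteq> 0" "laurent_eval x q \<noteq> 0" using assms inj_x by blast+
  then show "eval_fract (laurent_eval x) (Fract p q) \<noteq> 0"
    "fls_subdegree (eval_fract (laurent_eval x) (Fract p q)) = int \<beta> * (int (degree q) - int (degree p))"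
    using assms
    by (simp_all add: eval_fract_Fract[OF ring_morphism_laurent_eval inj_x]
        fls_divide_subdegree laurent_eval_subdegree(2)[OF x_neg] x_subdegree algebra_simps)
qed

lemma subdegree_term:
  assumes "z \<noteq> 0"
  shows "eval_fract (laurent_eval x) z * y ^ j \<noteq> 0"
    and "\<exists>k. fls_subdegree (eval_fract (laurent_eval x) z * y ^ j) = int \<beta> * k - int (degree A) * int j"
proof -
  obtain p q where z: "z = Fract p q" "q \<noteq> 0" by (cases z)
  then have "p \<noteq> 0" using assms by (auto simp: fract_collapse)
  note * = eval_fract_subdegree[OF \<open>q \<noteq> 0\<close> \<open>p \<noteq> 0\<close>]
  show nz: "eval_fract (laurent_eval x) z * y ^ j \<noteq> 0" using * z y_nonzero by simp
  show "\<exists>k. fls_subdegree (eval_fract (laurent_eval x) z * y ^ j) = int \<beta> * k - int (degree A) * int j"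
    using * z y_nonzero
    by (intro exI[of _ "int (degree q) - int (degree p)"])
      (simp add: fls_subdegree_pow y_subdegree)
qed

text \<open>The orders of the terms \<open>r\<^sub>j(x) y\<^sup>j\<close> are distinct modulo \<open>\<beta>\<close>, so no term is cancelled. In particular the
  pole order of every term is bounded by that of the sum, and the sum is nonzero.\<close>

lemma subdegree_\<iota>_le:
  assumes u: "u \<in> V" and j: "coeff u j \<noteq> 0"
  shows "\<iota> u \<noteq> 0"
    and "fls_subdegree (\<iota> u) \<le> fls_subdegree (eval_fract (laurent_eval x) (coeff u j) * y ^ j)"
proof -
  let ?f = "\<lambda>i. eval_fract (laurent_eval x) (coeff u i) * y ^ i"
  have eq: "\<iota> u = sum ?f {..<\<beta>}"
    unfolding \<iota>_def using u V_def by (intro eval_poly_altdef[OF ring_morphism_eval_fract_x]) blast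
  have nz: "coeff u i \<noteq> 0" if "?f i \<noteq> 0" for i
    using that by (auto simp: ring_morphism_zero[OF ring_morphism_eval_fract_x])
  have inj: "inj_on (\<lambda>i. fls_subdegree (?f i)) {i \<in> {..<\<beta>}. ?f i \<noteq> 0}"
  proof (rule inj_onI)
    fix i i'
    assume i: "i \<in> {i \<in> {..<\<beta>}. ?f i \<noteq> 0}" and i': "i' \<in> {i \<in> {..<\<beta>}. ?f i \<noteq> 0}"
      and same: "fls_subdegree (?f i) = fls_subdegree (?f i')"
    from i i' nz have "coeff u i \<noteq> 0" "coeff u i' \<noteq> 0" by blast+
    then obtain k k' where "fls_subdegree (?f i) = int \<beta> * k - int (degree A) * int i"
      "fls_subdegree (?f i') = int \<beta> * k' - int (degree A) * int i'"
      using subdegree_term(2) by metis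
    then have "int (degree A) * (int i - int i') = int \<beta> * (k - k')"
      using same by (simp add: algebra_simps)
    then show "i = i'" using coprime_cong_unique[OF coprime] i i' by blast
  qed
  have "j < \<beta>" using u le_degree[OF j] by (simp add: V_def)
  moreover have "?f j \<noteq> 0" by (rule subdegree_term(1)[OF j])
  ultimately show "\<iota> u \<noteq> 0" "fls_subdegree (\<iota> u) \<le> fls_subdegree (?f j)"
    using fls_sum_distinct_subdegree[OF _ inj, of j] eq by simp_all
qed

lemma \<iota>_eq_0: "u \<in> V \<Longrightarrow> \<iota> u = 0 \<Longrightarrow> u = 0"
  using subdegree_\<iota>_le(1) by (metis leading_coeff_0_iff)

lemma inj_\<iota>: "inj_on \<iota> V"
  using \<iota>_eq_0[OF V_diff] by (intro inj_onI) (force simp: \<iota>_simps)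

text \<open>Among the nonzero remainders that represent multiples of \<open>u\<close> choose one, \<open>d\<close>, of least degree. Division
  of \<open>f\<close> by \<open>d\<close> leaves another multiple of \<open>u\<close>, which is zero by minimality. If \<open>d\<close> were not constant,
  \<open>f\<close> would be a product of two nonzero remainders, whose images have a nonzero product. So some
  multiple of \<open>u\<close> is a nonzero constant of \<open>k(x)\<close>.\<close>

lemma V_inverse:
  assumes u: "u \<in> V" "u \<noteq> 0"
  shows "\<exists>v\<in>V. \<iota> v = inverse (\<iota> u)"
proof -
  define P where "P d \<longleftrightarrow> d \<in> V \<and> d \<noteq> 0 \<and> (\<exists>v. \<iota> d = \<iota> (u * v))" for d
  have "P u" using u by (auto simp: P_def intro!: exI[of _ 1])
  then obtain d where d: "P d" and min: "\<And>e. P e \<Longrightarrow> degree d \<le> degree e"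
    using ex_has_least_nat[of P u degree] by blast
  then have dV: "d \<in> V" "d \<noteq> 0" by (auto simp: P_def)
  obtain v where v: "\<iota> d = \<iota> (u * v)" using d P_def by blast
  have deg: "degree d = 0"
  proof (rule ccontr)
    assume "degree d \<noteq> 0"
    define q r where "q = f div d" and "r = f mod d"
    have f: "f = q * d + r" by (simp add: q_def r_def)
    have "\<iota> f = 0" using \<iota>_mod[of f] by (simp add: \<iota>_simps)
    then have sum: "\<iota> q * \<iota> d + \<iota> r = 0" by (simp add: f \<iota>_simps)
    have "r = 0"
    proof (rule ccontr)
      assume "r \<noteq> 0"
      then have less: "degree r < degree d" unfolding r_def by (intro degree_mod_less' dV)
      have "\<iota> r = \<iota> (u * (- (v * q)))" using sum v by (simp add: \<iota>_simps algebra_simps eq_neg_iff_add_eq_0)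
      then have "P r" using less dV \<open>r \<noteq> 0\<close> unfolding P_def V_def by (blast intro: less_trans)
      then show False using min less by fastforce
    qed
    then have "q \<noteq> 0" "\<beta> = degree q + degree d"
      using f f_nonzero degree_f dV by (auto simp: degree_mult_eq)
    then have "\<iota> q \<noteq> 0"
      using \<iota>_eq_0[of q] \<open>degree d \<noteq> 0\<close> unfolding V_def by (metis less_add_same_cancel1 mem_Collect_eq neq0_conv)
    moreover have "\<iota> d \<noteq> 0" using \<iota>_eq_0 dV by blast
    ultimately show False using sum \<open>r = 0\<close> by (simp add: \<iota>_simps)
  qed
  then obtain c where c: "d = [:c:]" "c \<noteq> 0" using dV by (metis degree_eq_zeroE pCons_eq_0_iff)
  have "\<iota> d * \<iota> [:inverse c:] = 1"
    using c ring_morphism_mult[OF ring_morphism_\<iota>, of d "[:inverse c:]"]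
    by (simp add: \<iota>_simps one_pCons[symmetric])
  then have "\<iota> u * \<iota> ((v * [:inverse c:]) mod f) = 1"
    unfolding v \<iota>_mod \<iota>_simps by (simp only: mult.assoc)
  then have "\<iota> ((v * [:inverse c:]) mod f) = inverse (\<iota> u)"
    by (metis inverse_unique)
  then show ?thesis using mod_in_V by blast
qed

lemma K_mult: "a \<in> K \<Longrightarrow> b \<in> K \<Longrightarrow> a * b \<in> K"
proof -
  assume "a \<in> K" "b \<in> K"
  then obtain u v where "a = \<iota> u" "b = \<iota> v" by (auto simp: K_def)
  then have "a * b = \<iota> ((u * v) mod f)" by (simp add: \<iota>_mod \<iota>_simps)
  then show ?thesis using mod_in_V by (auto simp: K_def)
qed

lemma K_inverse: "a \<in> K \<Longrightarrow> inverse a \<in> K"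
proof -
  assume "a \<in> K"
  then obtain u where u: "u \<in> V" "a = \<iota> u" by (auto simp: K_def)
  show ?thesis
  proof (cases "u = 0")
    case True
    then have "inverse a = \<iota> 0" using u by (simp add: \<iota>_simps)
    then show ?thesis using V_0 by (auto simp: K_def)
  next
    case False
    then show ?thesis using V_inverse[OF u(1)] u by (auto simp: K_def image_iff) metis
  qed
qed

lemma curve_eval_mem_K: "curve_eval x y g \<in> K"
  using \<iota>_reduced reduced_in_V by (metis K_def image_eqI)

lemma laurent_eval_mem_K: "laurent_eval x p \<in> K"
  using curve_eval_mem_K[of "[:p:]"] by (simp add: eval_poly_const[OF ring_morphism_laurent_eval])

lemma x_mem_K: "x \<in> K" and y_mem_K: "y \<in> K"
  using laurent_eval_mem_K[of "[:0, 1:]"] curve_eval_mem_K[of "[:0, 1:]"]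
  by (simp_all add: eval_poly_pCons[OF ring_morphism_fls_const] eval_poly_pCons[OF ring_morphism_laurent_eval]
      eval_poly_0[OF ring_morphism_fls_const] eval_poly_0[OF ring_morphism_laurent_eval]
      ring_morphism_simps[OF ring_morphism_laurent_eval])

section \<open>Valuation rings of the function field\<close>

abbreviation "FF \<equiv> function_field F"

lemma FF_simps:
  "carrier FF = V" "monoid.mult FF u v = (u * v) mod f" "add FF u v = u + v"
  "one FF = 1" "zero FF = 0"
  by (simp_all add: function_field_def Let_def V_def degree_f flip: f_def)

lemma ring_FF: "ring FF"
proof (rule ringI)
  show "abelian_group FF"
  proof (rule abelian_groupI)
    fix u assume "u \<in> carrier FF"
    then show "\<exists>v\<in>carrier FF. v \<oplus>\<^bsub>FF\<^esub> u = \<zero>\<^bsub>FF\<^esub>"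
      by (intro bexI[of _ "- u"]) (simp_all add: FF_simps V_uminus)
  qed (simp_all add: FF_simps V_add V_0 add.assoc add.commute)
  show "Group.monoid FF"
  proof (rule monoidI)
    fix u v w
    have "(u * v mod f) * w mod f = u * v * w mod f" "u * (v * w mod f) mod f = u * (v * w) mod f"
      by (simp_all add: mod_mult_left_eq mod_mult_right_eq)
    then show "u \<otimes>\<^bsub>FF\<^esub> v \<otimes>\<^bsub>FF\<^esub> w = u \<otimes>\<^bsub>FF\<^esub> (v \<otimes>\<^bsub>FF\<^esub> w)"
      by (simp add: FF_simps mult.assoc)
  qed (auto simp: FF_simps mod_in_V V_1 V_mod)
qed (simp_all add: FF_simps distrib_left distrib_right poly_mod_add_left)

interpretation FF: ring FF by (rule ring_FF)

lemma FF_minus: "u \<in> V \<Longrightarrow> v \<in> V \<Longrightarrow> u \<ominus>\<^bsub>FF\<^esub> v = u - v"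
  and FF_uminus: "v \<in> V \<Longrightarrow> \<ominus>\<^bsub>FF\<^esub> v = - v"
proof -
  show *: "\<ominus>\<^bsub>FF\<^esub> v = - v" if "v \<in> V" for v
    using that FF.minus_equality[of "- v" v] by (simp add: FF_simps V_uminus)
  show "u \<ominus>\<^bsub>FF\<^esub> v = u - v" if "u \<in> V" "v \<in> V"
    using that by (simp add: a_minus_def * FF_simps)
qed

lemma \<iota>_FF_mult: "\<iota> (u \<otimes>\<^bsub>FF\<^esub> v) = \<iota> u * \<iota> v"
  by (simp add: FF_simps \<iota>_mod \<iota>_simps)

lemma FF_mult_eq_1_iff:
  assumes "u \<in> V" "v \<in> V"
  shows "u \<otimes>\<^bsub>FF\<^esub> v = \<one>\<^bsub>FF\<^esub> \<longleftrightarrow> \<iota> u * \<iota> v = 1"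
proof -
  have "u \<otimes>\<^bsub>FF\<^esub> v = \<one>\<^bsub>FF\<^esub> \<longleftrightarrow> \<iota> (u \<otimes>\<^bsub>FF\<^esub> v) = \<iota> 1"
    using inj_\<iota> mod_in_V V_1 by (simp add: FF_simps inj_on_eq_iff)
  then show ?thesis by (simp only: \<iota>_FF_mult) (simp add: \<iota>_simps)
qed

lemma \<iota>_FF_inv:
  assumes u: "u \<in> V" "u \<noteq> 0"
  shows "inv\<^bsub>FF\<^esub> u \<in> V" and "\<iota> (inv\<^bsub>FF\<^esub> u) = inverse (\<iota> u)"
proof -
  obtain v where v: "v \<in> V" "\<iota> v = inverse (\<iota> u)" using V_inverse[OF u] by blast
  have "\<iota> u \<noteq> 0" using \<iota>_eq_0 u by blast
  then have "u \<otimes>\<^bsub>FF\<^esub> v = \<one>\<^bsub>FF\<^esub>" "v \<otimes>\<^bsub>FF\<^esub> u = \<one>\<^bsub>FF\<^esub>"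
    using u v by (simp_all add: FF_mult_eq_1_iff)
  then have "v = inv\<^bsub>FF\<^esub> u"
    using FF.inv_unique' u v by (simp add: FF_simps)
  then show "inv\<^bsub>FF\<^esub> u \<in> V" "\<iota> (inv\<^bsub>FF\<^esub> u) = inverse (\<iota> u)" using v by simp_all
qed

lemma \<iota>_image_iff: "R \<subseteq> V \<Longrightarrow> u \<in> V \<Longrightarrow> \<iota> u \<in> \<iota> ` R \<longleftrightarrow> u \<in> R"
  by (rule inj_on_image_mem_iff[OF inj_\<iota>])

lemma nonunits_image_iff:
  assumes R: "R \<subseteq> V" and u: "u \<in> V"
  shows "\<iota> u \<in> nonunits (\<iota> ` R) \<longleftrightarrow> u \<in> R - Units (FF\<lparr>carrier := R\<rparr>)"
proof -
  have inverse: "\<iota> u * \<iota> v = 1 \<longleftrightarrow> \<iota> u \<noteq> 0 \<and> \<iota> v = inverse (\<iota> u)" for v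
    using inverse_unique[of "\<iota> u" "\<iota> v"] by auto
  have "(\<iota> u = 0 \<or> inverse (\<iota> u) \<notin> \<iota> ` R) \<longleftrightarrow> \<not> (\<exists>v\<in>R. \<iota> u * \<iota> v = 1)"
    unfolding inverse image_iff by metis
  moreover have "u \<otimes>\<^bsub>FF\<^esub> v = \<one>\<^bsub>FF\<^esub> \<longleftrightarrow> \<iota> u * \<iota> v = 1" "v \<otimes>\<^bsub>FF\<^esub> u = \<one>\<^bsub>FF\<^esub> \<longleftrightarrow> \<iota> u * \<iota> v = 1"
    if "v \<in> R" for v
    using that R u FF_mult_eq_1_iff[of u v] FF_mult_eq_1_iff[of v u] by (auto simp: mult.commute)
  ultimately show ?thesis
    by (auto simp: nonunits_def Units_def \<iota>_image_iff[OF R u])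
qed

abbreviation "place S \<equiv> rational_valuation_subring fls_const K S"

text \<open>The embedding is an isomorphism onto \<open>K\<close>, so it transports valuation rings and their residue fields.
  The constants form a proper subset of the ring, since otherwise every element of the field would be
  constant or inverse to a constant.\<close>

lemma rational_place_iff:
  assumes R: "R \<subseteq> V"
  shows "rational_place FF constant_field R \<longleftrightarrow> place (\<iota> ` R)"
proof
  interpret FF: ring FF by (rule ring_FF)
  let ?S = "\<iota> ` R"
  assume "rational_place FF constant_field R"
  then have sub: "subring R FF" and const: "constant_field \<subseteq> R" and proper: "R \<noteq> V"
    and total: "\<And>z. z \<in> V \<Longrightarrow> z \<noteq> 0 \<Longrightarrow> z \<in> R \<or> inv\<^bsub>FF\<^esub> z \<in> R"
    and residue: "\<And>z. z \<in> R \<Longrightarrow> \<exists>c \<in> constant_field. z \<ominus>\<^bsub>FF\<^esub> c \<in> R - Units (FF\<lparr>carrier := R\<rparr>)"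
    by (auto simp: rational_place_def valuation_ring_def FF_simps)
  show "place ?S"
  proof
    show "ring_morphism (fls_const :: 'a \<Rightarrow> 'a fls)" by (rule ring_morphism_fls_const)
    show "a * b \<in> K" if "a \<in> K" "b \<in> K" for a b using that by (rule K_mult)
    show "inverse a \<in> K" if "a \<in> K" for a using that by (rule K_inverse)
    show "?S \<subseteq> K" using R by (auto simp: K_def)
    show "?S \<noteq> K" using proper R inj_on_image_eq_iff[OF inj_\<iota> R order.refl] by (simp add: K_def)
    show "fls_const c \<in> ?S" for c
    proof -
      have "[:to_fract [:c:]:] \<in> R" using const by (auto simp: constant_field_def)
      then show ?thesis using \<iota>_const by (metis image_eqI)
    qed
    show "a - b \<in> ?S" if ab: "a \<in> ?S" "b \<in> ?S" for a b
    proof -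
      obtain u v where uv: "u \<in> R" "v \<in> R" "a = \<iota> u" "b = \<iota> v" using ab by blast
      then have "u \<oplus>\<^bsub>FF\<^esub> (\<ominus>\<^bsub>FF\<^esub> v) \<in> R" by (intro subringE(5,7)[OF sub])
      then have "u - v \<in> R" using uv R FF_uminus[of v] by (simp add: FF_simps subset_iff)
      then show ?thesis using uv by (force simp: \<iota>_simps)
    qed
    show "a * b \<in> ?S" if ab: "a \<in> ?S" "b \<in> ?S" for a b
    proof -
      obtain u v where uv: "u \<in> R" "v \<in> R" "a = \<iota> u" "b = \<iota> v" using ab by blast
      then have "u \<otimes>\<^bsub>FF\<^esub> v \<in> R" by (intro subringE(6)[OF sub])
      then show ?thesis using uv by (metis \<iota>_FF_mult image_eqI)
    qed
    show "z \<in> ?S \<or> inverse z \<in> ?S" if "z \<in> K" for z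
    proof -
      obtain u where u: "u \<in> V" "z = \<iota> u" using \<open>z \<in> K\<close> by (auto simp: K_def)
      show ?thesis
      proof (cases "u = 0")
        case True
        then show ?thesis using subringE(2)[OF sub] u by (metis FF_simps(5) image_eqI)
      next
        case False
        then show ?thesis using total[OF u(1)] u(2) \<iota>_FF_inv[OF u(1)] by (metis image_eqI)
      qed
    qed
    show "\<exists>c. z - fls_const c \<in> nonunits ?S" if "z \<in> ?S" for z
    proof -
      obtain u where u: "u \<in> R" "z = \<iota> u" using \<open>z \<in> ?S\<close> by blast
      then obtain c where c: "u \<ominus>\<^bsub>FF\<^esub> [:to_fract [:c:]:] \<in> R - Units (FF\<lparr>carrier := R\<rparr>)"
        using residue by (auto simp: constant_field_def)
      then have "u - [:to_fract [:c:]:] \<in> R - Units (FF\<lparr>carrier := R\<rparr>)"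
        using FF_minus[of u "[:to_fract [:c:]:]"] u R V_const by auto
      then have "\<iota> (u - [:to_fract [:c:]:]) \<in> nonunits ?S"
        using nonunits_image_iff[OF R V_diff[OF _ V_const]] u R by blast
      then have "z - fls_const c \<in> nonunits ?S" using u \<iota>_const by (simp add: \<iota>_simps)
      then show ?thesis by blast
    qed
  qed
next
  interpret FF: ring FF by (rule ring_FF)
  let ?S = "\<iota> ` R"
  note image = \<iota>_image_iff[OF R]
  assume "place ?S"
  then interpret S: rational_valuation_subring fls_const K ?S .
  have mem: "u \<in> R" if "\<iota> u \<in> ?S" "u \<in> V" for u using that image by blast
  have const: "[:to_fract [:c:]:] \<in> R" for c
    using S.const_mem[of c] by (intro mem V_const) (simp add: \<iota>_const)
  have "R \<noteq> V" using S.proper by (auto simp: K_def)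
  have total: "z \<in> R \<or> inv\<^bsub>FF\<^esub> z \<in> R" if z: "z \<in> V" "z \<noteq> 0" for z
  proof -
    have "\<iota> z \<in> ?S \<or> \<iota> (inv\<^bsub>FF\<^esub> z) \<in> ?S"
      using S.total[of "\<iota> z"] z \<iota>_FF_inv(2)[OF z] by (auto simp: K_def)
    then show ?thesis using mem z \<iota>_FF_inv(1)[OF z] by blast
  qed
  have "constant_field \<noteq> R"
  proof
    assume eq: "constant_field = R"
    have "z \<in> R" if "z \<in> V" for z
    proof (rule ccontr)
      assume "z \<notin> R"
      then have "z \<noteq> 0" using const[of 0] by auto
      then have "inv\<^bsub>FF\<^esub> z \<in> constant_field" using total \<open>z \<in> V\<close> \<open>z \<notin> R\<close> eq by blast
      then obtain c where "inv\<^bsub>FF\<^esub> z = [:to_fract [:c:]:]" by (auto simp: constant_field_def)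
      then have "inverse (\<iota> z) = fls_const c"
        using \<iota>_FF_inv(2)[OF \<open>z \<in> V\<close> \<open>z \<noteq> 0\<close>] \<iota>_const by simp
      then have "\<iota> z = fls_const (inverse c)"
        by (metis fls_inverse_const inverse_inverse_eq)
      then show False using mem \<open>z \<in> V\<close> \<open>z \<notin> R\<close> S.const_mem by metis
    qed
    then show False using R \<open>R \<noteq> V\<close> by blast
  qed
  have "subring R FF"
  proof (rule FF.subringI)
    show "\<one>\<^bsub>FF\<^esub> \<in> R" using const[of 1] by (simp add: FF_simps flip: one_pCons)
    show "\<ominus>\<^bsub>FF\<^esub> u \<in> R" if u: "u \<in> R" for u
    proof -
      have "u \<in> V" using u R by blast
      moreover from this have "- u \<in> R"
        using S.uminus_mem[of "\<iota> u"] u by (intro mem V_uminus) (simp_all add: \<iota>_simps)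
      ultimately show ?thesis by (simp add: FF_uminus)
    qed
    show "u \<otimes>\<^bsub>FF\<^esub> v \<in> R" if "u \<in> R" "v \<in> R" for u v
      using that S.mult_mem[of "\<iota> u" "\<iota> v"] mod_in_V
      by (intro mem) (simp_all only: \<iota>_FF_mult, auto simp: FF_simps)
    show "u \<oplus>\<^bsub>FF\<^esub> v \<in> R" if uv: "u \<in> R" "v \<in> R" for u v
    proof -
      have "u + v \<in> R"
        using S.add_mem[of "\<iota> u" "\<iota> v"] uv R by (intro mem V_add) (auto simp: \<iota>_simps)
      then show ?thesis by (simp add: FF_simps)
    qed
  qed (use R in \<open>simp add: FF_simps\<close>)
  moreover have "\<exists>c \<in> constant_field. z \<ominus>\<^bsub>FF\<^esub> c \<in> R - Units (FF\<lparr>carrier := R\<rparr>)" if "z \<in> R" for z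
  proof -
    obtain c where c: "\<iota> z - fls_const c \<in> nonunits ?S" using S.residue \<open>z \<in> R\<close> by blast
    have zV: "z \<in> V" using \<open>z \<in> R\<close> R by blast
    have "\<iota> (z - [:to_fract [:c:]:]) \<in> nonunits ?S" using c \<iota>_const by (simp add: \<iota>_simps)
    then have "z - [:to_fract [:c:]:] \<in> R - Units (FF\<lparr>carrier := R\<rparr>)"
      using nonunits_image_iff[OF R V_diff[OF zV V_const]] by blast
    then show ?thesis using FF_minus[OF zV V_const] by (auto simp: constant_field_def)
  qed
  ultimately show "rational_place FF constant_field R"
    using R \<open>R \<noteq> V\<close> \<open>constant_field \<noteq> R\<close> total const
    by (auto simp: rational_place_def valuation_ring_def FF_simps constant_field_def)
qed

lemma bij_betw_rational_points_places: "bij_betw (image \<iota>) (rational_points F) {S. place S}"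
proof (rule bij_betwI')
  have V: "R \<subseteq> V" if "R \<in> rational_points F" for R
    using that by (auto simp: rational_points_def rational_place_def valuation_ring_def FF_simps)
  show "(\<iota> ` R = \<iota> ` R') = (R = R')" if "R \<in> rational_points F" "R' \<in> rational_points F" for R R'
    using inj_on_image_eq_iff[OF inj_\<iota> V V] that by blast
  show "\<iota> ` R \<in> {S. place S}" if "R \<in> rational_points F" for R
    using that V[OF that] by (simp add: rational_place_iff rational_points_def)
  show "\<exists>R \<in> rational_points F. S = \<iota> ` R" if "S \<in> {S. place S}" for S
  proof -
    interpret S: rational_valuation_subring fls_const K S using that by simp
    have "S = \<iota> ` {u \<in> V. \<iota> u \<in> S}" using S.subset by (auto simp: K_def)
    then show ?thesis
      using that rational_place_iff[of "{u \<in> V. \<iota> u \<in> S}"]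
      by (intro bexI[of _ "{u \<in> V. \<iota> u \<in> S}"]) (auto simp: rational_points_def)
  qed
qed

section \<open>Places from embeddings\<close>

text \<open>A morphism to another field of Laurent series preserves inverses. They are expressed through \<open>\<iota>\<close>,
  where the function field has an actual inverse operation.\<close>

lemma field_eval_inverse:
  assumes inj: "\<forall>p. laurent_eval X p = 0 \<longrightarrow> p = 0" and XY: "Y ^ \<beta> = laurent_eval X A"
    and "u \<in> V" "v \<in> V" "\<iota> v = inverse (\<iota> u)" "u \<noteq> 0"
  shows "field_eval X Y u \<noteq> 0" and "field_eval X Y v = inverse (field_eval X Y u)"
proof -
  have "\<iota> u \<noteq> 0" using \<iota>_eq_0 assms by blast
  then have "\<iota> ((u * v) mod f) = \<iota> 1"
    using assms by (simp add: \<iota>_mod \<iota>_simps)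
  then have "(u * v) mod f = 1"
    using inj_onD[OF inj_\<iota>] mod_in_V V_1 by metis
  then have "field_eval X Y u * field_eval X Y v = 1"
    using field_eval_mod[OF inj XY, of "u * v"] by (simp add: ring_morphism_simps[OF ring_morphism_field_eval[OF inj XY]])
  then show "field_eval X Y u \<noteq> 0" "field_eval X Y v = inverse (field_eval X Y u)"
    by (auto simp: inverse_unique)
qed

text \<open>The place defined by a second pair \<open>X, Y\<close> is the set of functions that have no pole when expanded in
  \<open>X, Y\<close>; it is stored as a subset of \<open>K\<close>, that is, through their expansions in \<open>x, y\<close>. A function
  with a pole is required so that the place is not the whole field.\<close>

context
  fixes X Y :: "'a fls"
  assumes inj: "\<forall>p. laurent_eval X p = 0 \<longrightarrow> p = 0" and XY: "Y ^ \<beta> = laurent_eval X A"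
    and pole: "\<exists>u\<in>V. fls_subdegree (field_eval X Y u) < 0"
begin

definition "embedding_place = \<iota> ` {u \<in> V. fls_subdegree (field_eval X Y u) \<ge> 0}"

lemmas \<phi>_morphism = ring_morphism_field_eval[OF inj XY]

lemma mem_embedding_place:
  "u \<in> V \<Longrightarrow> \<iota> u \<in> embedding_place \<longleftrightarrow> fls_subdegree (field_eval X Y u) \<ge> 0"
  unfolding embedding_place_def by (subst \<iota>_image_iff) auto

lemma nonunits_embedding_place:
  assumes u: "u \<in> V"
  shows "\<iota> u \<in> nonunits embedding_place \<longleftrightarrow>
    field_eval X Y u = 0 \<or> fls_subdegree (field_eval X Y u) > 0"
proof (cases "u = 0")
  case True
  then show ?thesis
    using mem_embedding_place[OF V_0]
    by (simp add: nonunits_def \<iota>_simps ring_morphism_simps[OF \<phi>_morphism])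
next
  case False
  obtain v where v: "v \<in> V" "\<iota> v = inverse (\<iota> u)" using V_inverse[OF u False] by blast
  then have "fls_subdegree (field_eval X Y v) = - fls_subdegree (field_eval X Y u)"
    using field_eval_inverse(2)[OF inj XY u v False] by simp
  moreover have "\<iota> u \<noteq> 0" "field_eval X Y u \<noteq> 0"
    using \<iota>_eq_0 u False field_eval_inverse(1)[OF inj XY u v False] by blast+
  ultimately show ?thesis
    using mem_embedding_place[OF u] mem_embedding_place[OF v(1)] v(2) by (auto simp: nonunits_def)
qed

lemma place_embedding_place: "place embedding_place"
proof
  have obt: "\<exists>u\<in>V. z = \<iota> u \<and> fls_subdegree (field_eval X Y u) \<ge> 0" if "z \<in> embedding_place" for z
    using that by (auto simp: embedding_place_def)
  show "ring_morphism (fls_const :: 'a \<Rightarrow> 'a fls)" by (rule ring_morphism_fls_const)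
  show "a * b \<in> K" if "a \<in> K" "b \<in> K" for a b using that by (rule K_mult)
  show "inverse a \<in> K" if "a \<in> K" for a using that by (rule K_inverse)
  show "embedding_place \<subseteq> K" by (auto simp: embedding_place_def K_def)
  show "embedding_place \<noteq> K"
    using pole mem_embedding_place by (force simp: K_def)
  show const: "fls_const c \<in> embedding_place" for c
    using mem_embedding_place[OF V_const[of "to_fract [:c:]"]]
    by (simp add: \<iota>_const field_eval_const[OF inj XY] eval_poly_const[OF ring_morphism_fls_const])
  show "a - b \<in> embedding_place" if "a \<in> embedding_place" "b \<in> embedding_place" for a b
  proof -
    from obt[OF that(1)] obt[OF that(2)] obtain u v where uv: "u \<in> V" "v \<in> V" "a = \<iota> u" "b = \<iota> v"
      "fls_subdegree (field_eval X Y u) \<ge> 0" "fls_subdegree (field_eval X Y v) \<ge> 0" by blast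
    then have "fls_subdegree (field_eval X Y (u - v)) \<ge> 0"
      using laurent.diff_mem by (simp add: ring_morphism_simps[OF \<phi>_morphism])
    then show ?thesis using mem_embedding_place[OF V_diff[of u v]] uv by (simp add: \<iota>_simps)
  qed
  show "a * b \<in> embedding_place" if "a \<in> embedding_place" "b \<in> embedding_place" for a b
  proof -
    from obt[OF that(1)] obt[OF that(2)] obtain u v where uv: "u \<in> V" "v \<in> V" "a = \<iota> u" "b = \<iota> v"
      "fls_subdegree (field_eval X Y u) \<ge> 0" "fls_subdegree (field_eval X Y v) \<ge> 0" by blast
    then have "fls_subdegree (field_eval X Y (u * v)) \<ge> 0"
      using laurent.mult_mem by (simp add: ring_morphism_simps[OF \<phi>_morphism])
    then show ?thesis
      using mem_embedding_place[OF mod_in_V[of "u * v"]] uv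
      by (simp add: \<iota>_simps \<iota>_mod field_eval_mod[OF inj XY])
  qed
  show "z \<in> embedding_place \<or> inverse z \<in> embedding_place" if "z \<in> K" for z
  proof -
    obtain u where u: "u \<in> V" "z = \<iota> u" using \<open>z \<in> K\<close> by (auto simp: K_def)
    show ?thesis
    proof (cases "u = 0")
      case True
      then show ?thesis using const[of 0] u by (simp add: \<iota>_simps)
    next
      case False
      obtain v where v: "v \<in> V" "\<iota> v = inverse (\<iota> u)" using V_inverse[OF u(1) False] by blast
      then have "fls_subdegree (field_eval X Y v) = - fls_subdegree (field_eval X Y u)"
        using field_eval_inverse(2)[OF inj XY u(1) v False] by simp
      then show ?thesis
        using mem_embedding_place[OF u(1)] mem_embedding_place[OF v(1)] v(2) u(2) by auto
    qed
  qed
  show "\<exists>c. z - fls_const c \<in> nonunits embedding_place" if z: "z \<in> embedding_place" for z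
  proof -
    obtain u where u: "u \<in> V" "z = \<iota> u" "fls_subdegree (field_eval X Y u) \<ge> 0" using obt[OF z] by blast
    then obtain c where c: "field_eval X Y u - fls_const c = 0 \<or> fls_subdegree (field_eval X Y u - fls_const c) > 0"
      using laurent.residue by blast
    have "z - fls_const c = \<iota> (u - [:to_fract [:c:]:])" using u by (simp add: \<iota>_simps \<iota>_const)
    moreover have "field_eval X Y (u - [:to_fract [:c:]:]) = field_eval X Y u - fls_const c"
      by (simp add: ring_morphism_simps[OF \<phi>_morphism] field_eval_const[OF inj XY]
          eval_poly_const[OF ring_morphism_fls_const])
    ultimately show ?thesis
      using c nonunits_embedding_place[OF V_diff[OF u(1) V_const]] by metis
  qed
qed

text \<open>The value group consists of integers, so powers of a nonunit outweigh any pole.\<close>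

lemma embedding_place_maximal:
  assumes "place S" "embedding_place \<subseteq> S"
  shows "S = embedding_place"
proof (rule rational_valuation_subring_maximal[OF place_embedding_place assms(1,2), symmetric])
  fix z w assume z: "z \<in> nonunits embedding_place" and w: "w \<in> K"
  obtain u where u: "u \<in> V" "z = \<iota> u" using z by (auto simp: nonunits_def embedding_place_def)
  obtain v where v: "v \<in> V" "w = \<iota> v" using w by (auto simp: K_def)
  define n where "n = nat (- fls_subdegree (field_eval X Y v))"
  have eq: "w * z ^ n = \<iota> ((v * u ^ n) mod f)" using u v by (simp add: \<iota>_mod \<iota>_simps)
  have \<phi>: "field_eval X Y ((v * u ^ n) mod f) = field_eval X Y v * field_eval X Y u ^ n"
    by (simp add: field_eval_mod[OF inj XY] ring_morphism_simps[OF \<phi>_morphism])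
  have "fls_subdegree (field_eval X Y v * field_eval X Y u ^ n) \<ge> 0"
  proof (cases "field_eval X Y v * field_eval X Y u ^ n = 0 \<or> n = 0")
    case True
    moreover have "fls_subdegree (field_eval X Y v) \<ge> 0" if "n = 0"
      using that by (simp add: n_def)
    ultimately show ?thesis by (cases "n = 0") (auto simp: power_0_left)
  next
    case False
    then have nz: "field_eval X Y v \<noteq> 0" "field_eval X Y u \<noteq> 0" by auto
    then have pos: "fls_subdegree (field_eval X Y u) \<ge> 1"
      using nonunits_embedding_place[OF u(1)] z u(2) by simp
    have "- fls_subdegree (field_eval X Y v) \<le> int n * 1" by (simp add: n_def)
    also have "\<dots> \<le> int n * fls_subdegree (field_eval X Y u)"
      using pos by (intro mult_left_mono) auto
    finally show ?thesis using nz by (simp add: fls_subdegree_pow)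
  qed
  then show "\<exists>n. w * z ^ n \<in> embedding_place"
    using mem_embedding_place[OF mod_in_V[of "v * u ^ n"]] eq \<phi> by metis
qed

end

end

section \<open>The rational places of the curve\<close>

text \<open>Dividing repeatedly by the uniformizer terminates because the order of the function along the branch
  drops each time: \<open>t\<close> has positive order there and \<open>e\<close> has order zero.\<close>

lemma uniformizer_factorization:
  fixes A :: "'a::field poly"
  assumes XY: "Y ^ \<beta> = laurent_eval X A"
    and X: "X - fls_const a = 0 \<or> fls_subdegree (X - fls_const a) > 0"
    and Y: "Y - fls_const b = 0 \<or> fls_subdegree (Y - fls_const b) > 0"
    and t: "poly (poly t [:b:]) a = 0"
    and div: "\<And>g. poly (poly g [:b:]) a = 0 \<Longrightarrow>
      \<exists>e g'. poly (poly e [:b:]) a \<noteq> 0 \<and> superelliptic \<beta> A dvd e * g - t * g'"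
    and g: "curve_eval X Y g \<noteq> 0"
  shows "\<exists>m e g'. poly (poly e [:b:]) a \<noteq> 0 \<and> poly (poly g' [:b:]) a \<noteq> 0 \<and>
    superelliptic \<beta> A dvd e * g - t ^ m * g'"
  using g
proof (induction "nat (fls_subdegree (curve_eval X Y g))" arbitrary: g rule: less_induct)
  case less
  have mem: "fls_subdegree (curve_eval X Y h) \<ge> 0" for h
    using laurent.eval2_mem[of X a Y b h] X Y by simp
  have nonunit: "curve_eval X Y h = 0 \<or> fls_subdegree (curve_eval X Y h) > 0 \<longleftrightarrow> poly (poly h [:b:]) a = 0" for h
    using laurent.eval2_nonunit_iff[of X a Y b h] X Y by simp
  show ?case
  proof (cases "poly (poly g [:b:]) a = 0")
    case False
    then show ?thesis by (intro exI[of _ 0] exI[of _ 1] exI[of _ g]) simp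
  next
    case True
    then obtain e g' where e: "poly (poly e [:b:]) a \<noteq> 0" and
      dvd: "superelliptic \<beta> A dvd e * g - t * g'" using div by blast
    have "curve_eval X Y (e * g - t * g') = 0"
      using dvd XY
      by (elim dvdE) (simp add: ring_morphism_mult[OF ring_morphism_curve_eval] curve_eval_superelliptic)
    then have eq: "curve_eval X Y e * curve_eval X Y g = curve_eval X Y t * curve_eval X Y g'"
      by (simp add: ring_morphism_simps[OF ring_morphism_curve_eval])
    have e_unit: "curve_eval X Y e \<noteq> 0" "fls_subdegree (curve_eval X Y e) = 0"
      using nonunit[of e] mem[of e] e by auto
    have nz: "curve_eval X Y t \<noteq> 0" "curve_eval X Y g' \<noteq> 0"
      using eq e_unit(1) less.prems by auto
    have "fls_subdegree (curve_eval X Y t) > 0" using nonunit[of t] nz t by blast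
    moreover have "fls_subdegree (curve_eval X Y g) =
        fls_subdegree (curve_eval X Y t) + fls_subdegree (curve_eval X Y g')"
      using arg_cong[OF eq, of fls_subdegree] e_unit nz less.prems by simp
    ultimately have "nat (fls_subdegree (curve_eval X Y g')) < nat (fls_subdegree (curve_eval X Y g))"
      using mem[of g'] by simp
    from less.hyps[OF this nz(2)] obtain m e' g'' where IH: "poly (poly e' [:b:]) a \<noteq> 0"
      "poly (poly g'' [:b:]) a \<noteq> 0" "superelliptic \<beta> A dvd e' * g' - t ^ m * g''" by blast
    have "e' * e * g - t ^ Suc m * g'' = e' * (e * g - t * g') + t * (e' * g' - t ^ m * g'')"
      by (simp add: algebra_simps)
    then have "superelliptic \<beta> A dvd e' * e * g - t ^ Suc m * g''"
      using dvd IH(3) by (metis dvd_add dvd_mult)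
    then show ?thesis using IH e by (intro exI[of _ "Suc m"] exI[of _ "e' * e"] exI[of _ g'']) simp
  qed
qed

context superelliptic_laurent
begin

text \<open>Existence comes from the branch at \<open>(a, b)\<close>. For uniqueness let \<open>S'\<close> be any place with this centre. A
  function without pole along the branch is \<open>t\<^sup>m\<^sup>-\<^sup>l\<close> with \<open>m \<ge> l\<close>, times a quotient of polynomials that do
  not vanish at \<open>(a, b)\<close>. The latter are units of \<open>S'\<close>, so the function lies in \<open>S'\<close>, and maximality of
  the place of the branch gives equality.\<close>

lemma affine_place:
  assumes P: "b ^ \<beta> = poly A a"
  shows "\<exists>S. place S \<and> x - fls_const a \<in> nonunits S \<and> y - fls_const b \<in> nonunits S \<and>
    (\<forall>S'. place S' \<and> x - fls_const a \<in> nonunits S' \<and> y - fls_const b \<in> nonunits S' \<longrightarrow> S' = S)"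
proof -
  obtain X Y where XY: "Y ^ \<beta> = laurent_eval X A" and X: "X - fls_const a \<noteq> 0"
    "fls_subdegree (X - fls_const a) > 0"
    and Y: "Y - fls_const b = 0 \<or> fls_subdegree (Y - fls_const b) > 0"
    using branch_at_affine_point[OF \<beta> separable P] by blast
  have inj: "\<forall>p. laurent_eval X p = 0 \<longrightarrow> p = 0"
    using laurent_eval_eq_0_imp[OF X] by blast
  note \<phi>_morph = ring_morphism_field_eval[OF inj XY]
  \<comment> \<open>The functions \<open>x - a\<close> and \<open>y - b\<close> as polynomials.\<close>
  define gx :: "'a poly poly" where "gx = [:[:- a, 1:]:]"
  define gy :: "'a poly poly" where "gy = [:[:- b:], 1:]"
  have gx: "curve_eval X' Y' gx = X' - fls_const a" and gy: "curve_eval X' Y' gy = Y' - fls_const b" for X' Y'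
    by (simp_all add: gx_def gy_def eval_poly_const[OF ring_morphism_laurent_eval]
        eval_poly_pCons[OF ring_morphism_laurent_eval] eval_poly_0[OF ring_morphism_laurent_eval]
        eval_poly_pCons[OF ring_morphism_fls_const] eval_poly_0[OF ring_morphism_fls_const]
        ring_morphism_one[OF ring_morphism_laurent_eval])
  have pole: "\<exists>u\<in>V. fls_subdegree (field_eval X Y u) < 0"
  proof -
    have \<phi>gx: "field_eval X Y (reduced gx) = X - fls_const a"
      by (simp add: field_eval_reduced[OF inj XY] gx)
    have nz: "reduced gx \<noteq> 0" using \<phi>gx X(1) ring_morphism_zero[OF \<phi>_morph] by metis
    obtain v where v: "v \<in> V" "\<iota> v = inverse (\<iota> (reduced gx))"
      using V_inverse[OF reduced_in_V nz] by blast
    have "field_eval X Y v = inverse (X - fls_const a)"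
      using field_eval_inverse(2)[OF inj XY reduced_in_V v nz] \<phi>gx by simp
    then show ?thesis using v(1) X by (intro bexI[of _ v]) simp_all
  qed
  let ?S = "embedding_place X Y"
  have place: "place ?S" by (rule place_embedding_place[OF inj XY pole])
  have mem: "curve_eval x y g \<in> nonunits ?S \<longleftrightarrow>
      curve_eval X Y g = 0 \<or> fls_subdegree (curve_eval X Y g) > 0" for g
    using nonunits_embedding_place[OF inj XY pole reduced_in_V[of g]]
    by (simp add: \<iota>_reduced field_eval_reduced[OF inj XY])
  have "x - fls_const a \<in> nonunits ?S" "y - fls_const b \<in> nonunits ?S"
    using mem[of gx] mem[of gy] X Y by (simp_all add: gx gy)
  moreover have "S' = ?S"
    if S': "place S'" and xS: "x - fls_const a \<in> nonunits S'" and yS: "y - fls_const b \<in> nonunits S'" for S'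
  proof (rule embedding_place_maximal[OF inj XY pole S'])
    interpret S': rational_valuation_subring fls_const K S' by (rule S')
    have in_S': "curve_eval x y g \<in> S'" for g by (rule S'.eval2_mem[OF xS yS])
    have unit: "curve_eval x y e \<noteq> 0 \<and> inverse (curve_eval x y e) \<in> S'"
      if "poly (poly e [:b:]) a \<noteq> 0" for e
      using S'.unit_inverse[OF in_S'] S'.eval2_nonunit_iff[OF xS yS] that by blast
    obtain t where t: "poly (poly t [:b:]) a = 0" and
      div: "\<And>g. poly (poly g [:b:]) a = 0 \<Longrightarrow>
        \<exists>e g'. poly (poly e [:b:]) a \<noteq> 0 \<and> superelliptic \<beta> A dvd e * g - t * g'"
      using local_uniformizer[OF \<beta> separable P] by blast
    have nonunitX: "curve_eval X Y h = 0 \<or> fls_subdegree (curve_eval X Y h) > 0 \<longleftrightarrow> poly (poly h [:b:]) a = 0" for h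
      using laurent.eval2_nonunit_iff[of X a Y b h] X Y by simp
    have unitX: "curve_eval X Y e \<noteq> 0 \<and> fls_subdegree (curve_eval X Y e) = 0"
      if "poly (poly e [:b:]) a \<noteq> 0" for e
    proof -
      have "fls_subdegree (curve_eval X Y e) \<ge> 0"
        using laurent.eval2_mem[of X a Y b e] X Y by simp
      then show ?thesis using nonunitX[of e] that by auto
    qed
    note factor = uniformizer_factorization[OF XY disjI2[OF X(2)] Y t div]
    have t_nz: "curve_eval X Y t \<noteq> 0 \<and> curve_eval x y t \<noteq> 0"
    proof -
      obtain e g' where e: "poly (poly e [:b:]) a \<noteq> 0" "F dvd e * gx - t * g'"
        using div[of gx] by (auto simp: gx_def F_def)
      have "curve_eval X Y e * curve_eval X Y gx = curve_eval X Y t * curve_eval X Y g'"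
        "curve_eval x y e * curve_eval x y gx = curve_eval x y t * curve_eval x y g'"
        using curve_eval_dvd[OF inj XY e(2)] curve_eval_dvd[OF inj_x curve e(2)]
        by (simp_all add: ring_morphism_simps[OF ring_morphism_curve_eval])
      moreover have "x - fls_const a \<noteq> 0" using inj_x[rule_format, of "[:- a, 1:]"] gx[of x y]
        by (auto simp: gx_def eval_poly_const[OF ring_morphism_laurent_eval])
      ultimately show ?thesis using unit[OF e(1)] unitX[OF e(1)] X(1) by (auto simp: gx)
    qed
    show "?S \<subseteq> S'"
    proof
      fix z assume "z \<in> ?S"
      then obtain u where u: "u \<in> V" "z = \<iota> u" "fls_subdegree (field_eval X Y u) \<ge> 0"
        by (auto simp: embedding_place_def[OF inj XY pole])
      show "z \<in> S'"
      proof (cases "u = 0")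
        case True
        then show ?thesis using u S'.zero_mem by (simp add: \<iota>_simps)
      next
        case False
        obtain h g where h: "h \<noteq> 0" and hg: "smult (to_fract h) u = map_poly to_fract g"
          using clear_denominators by blast
        have clear: "field_eval X' Y' u * curve_eval X' Y' [:h:] = curve_eval X' Y' g"
          if inj': "\<forall>p. laurent_eval X' p = 0 \<longrightarrow> p = 0" and XY': "Y' ^ \<beta> = laurent_eval X' A" for X' Y'
        proof -
          have "field_eval X' Y' ([:to_fract h:] * u) = curve_eval X' Y' g"
            using hg field_eval_map_poly[OF inj' XY', of g] by simp
          then show ?thesis
            by (simp only: ring_morphism_mult[OF ring_morphism_field_eval[OF inj' XY']]
                field_eval_const[OF inj' XY'] eval_poly_const[OF ring_morphism_laurent_eval] mult.commute)
        qed
        have hX: "curve_eval X Y [:h:] \<noteq> 0" "curve_eval x y [:h:] \<noteq> 0"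
          using inj inj_x h by (auto simp: eval_poly_const[OF ring_morphism_laurent_eval])
        obtain v where v: "v \<in> V" "\<iota> v = inverse (\<iota> u)" using V_inverse[OF u(1) False] by blast
        have "field_eval X Y u \<noteq> 0"
          using field_eval_inverse(1)[OF inj XY u(1) v False] by blast
        then have gX: "curve_eval X Y g \<noteq> 0" using clear[OF inj XY] hX by auto
        obtain m e g' where g: "poly (poly e [:b:]) a \<noteq> 0" "poly (poly g' [:b:]) a \<noteq> 0"
          "F dvd e * g - t ^ m * g'"
          using factor[OF _ gX] by (auto simp: F_def)
        obtain l e' h' where h: "poly (poly e' [:b:]) a \<noteq> 0" "poly (poly h' [:b:]) a \<noteq> 0"
          "F dvd e' * [:h:] - t ^ l * h'"
          using factor[OF _ hX(1)] by (auto simp: F_def)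
        have eqX: "curve_eval X Y e * curve_eval X Y g = curve_eval X Y t ^ m * curve_eval X Y g'"
          "curve_eval X Y e' * curve_eval X Y [:h:] = curve_eval X Y t ^ l * curve_eval X Y h'"
          using curve_eval_dvd[OF inj XY g(3)] curve_eval_dvd[OF inj XY h(3)]
          by (simp_all only: ring_morphism_simps[OF ring_morphism_curve_eval] eq_iff_diff_eq_0[symmetric])
        have eqx: "curve_eval x y e * curve_eval x y g = curve_eval x y t ^ m * curve_eval x y g'"
          "curve_eval x y e' * curve_eval x y [:h:] = curve_eval x y t ^ l * curve_eval x y h'"
          using curve_eval_dvd[OF inj_x curve g(3)] curve_eval_dvd[OF inj_x curve h(3)]
          by (simp_all only: ring_morphism_simps[OF ring_morphism_curve_eval] eq_iff_diff_eq_0[symmetric])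
        \<comment> \<open>Comparing orders along the branch gives \<open>l \<le> m\<close>.\<close>
        let ?\<tau> = "fls_subdegree (curve_eval X Y t)"
        have "?\<tau> > 0" using nonunitX[of t] t t_nz by blast
        have "fls_subdegree (curve_eval X Y g) = int m * ?\<tau>"
          "fls_subdegree (curve_eval X Y [:h:]) = int l * ?\<tau>"
          using arg_cong[OF eqX(1), of fls_subdegree] arg_cong[OF eqX(2), of fls_subdegree]
            unitX[OF g(1)] unitX[OF g(2)] unitX[OF h(1)] unitX[OF h(2)] t_nz gX hX
          by (simp_all add: fls_subdegree_pow)
        moreover have "fls_subdegree (curve_eval X Y g)
            = fls_subdegree (field_eval X Y u) + fls_subdegree (curve_eval X Y [:h:])"
          using clear[OF inj XY, symmetric] \<open>field_eval X Y u \<noteq> 0\<close> hX by simp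
        ultimately have "int l * ?\<tau> \<le> int m * ?\<tau>" using u(3) by simp
        then have "l \<le> m" using \<open>?\<tau> > 0\<close> by simp
        then have split: "curve_eval x y t ^ m = curve_eval x y t ^ l * curve_eval x y t ^ (m - l)"
          by (simp flip: power_add)
        let ?e = "curve_eval x y e" and ?e' = "curve_eval x y e'" and ?h' = "curve_eval x y h'"
          and ?g' = "curve_eval x y g'" and ?t = "curve_eval x y t"
        have "?t ^ l * (z * ?e * ?h') = ?e * ?e' * (z * curve_eval x y [:h:])"
          using eqx(2) by (simp add: algebra_simps)
        also have "z * curve_eval x y [:h:] = curve_eval x y g"
          using clear[OF inj_x curve] u(2) by (simp add: \<iota>_def)
        also have "?e * ?e' * curve_eval x y g = ?t ^ l * (?t ^ (m - l) * ?g' * ?e')"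
          using eqx(1) split by (simp add: algebra_simps)
        finally have "z * ?e * ?h' = ?t ^ (m - l) * ?g' * ?e'" using t_nz by simp
        then have "z = ?t ^ (m - l) * ?g' * ?e' * inverse ?e * inverse ?h'"
          using unit[OF g(1)] unit[OF h(2)] by (simp add: field_simps)
        also have "\<dots> \<in> S'"
          using unit[OF g(1)] unit[OF h(2)] by (intro S'.mult_mem S'.power_mem in_S') auto
        finally show "z \<in> S'" .
      qed
    qed
  qed
  ultimately show ?thesis using place by blast
qed

text \<open>Let \<open>S\<close> be a place at which \<open>x\<close> has a pole. Every nonzero polynomial in \<open>x\<close> is a power of \<open>x\<close> times a unit of
  \<open>S\<close>, so \<open>S\<close> contains each rational function of \<open>x\<close> whose numerator does not exceed the denominator in
  degree. If a sum of terms \<open>r\<^sub>j(x) y\<^sup>j\<close> has no pole at infinity, neither has any of the terms, since their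
  orders are distinct; the \<open>\<beta>\<close>-th power of a term is a rational function of \<open>x\<close> and so lies in \<open>S\<close>, and
  then the term lies in \<open>S\<close>. So \<open>S\<close> contains the place of the branch at infinity, which is maximal.\<close>

lemma infinite_place:
  "\<exists>S. place S \<and> x \<notin> S \<and> (\<forall>S'. place S' \<and> x \<notin> S' \<longrightarrow> S' = S)"
proof -
  have x_eval: "laurent_eval x [:0, 1:] = x"
    by (simp add: eval_poly_pCons[OF ring_morphism_fls_const] eval_poly_0[OF ring_morphism_fls_const])
  have "field_eval x y [:to_fract [:0, 1:]:] = x"
    by (simp add: field_eval_const[OF inj_x curve] x_eval)
  then have pole: "\<exists>u\<in>V. fls_subdegree (field_eval x y u) < 0" and x_\<iota>: "x = \<iota> [:to_fract [:0, 1:]:]"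
    using V_const x_neg by (auto simp: \<iota>_def intro!: bexI[of _ "[:to_fract [:0, 1:]:]"])
  let ?S = "embedding_place x y"
  have "place ?S" by (rule place_embedding_place[OF inj_x curve pole])
  moreover have "x \<notin> ?S"
    using mem_embedding_place[OF inj_x curve pole V_const, of "to_fract [:0, 1:]"] x_\<iota> x_neg
    by (simp add: \<iota>_def[symmetric])
  moreover have "S = ?S" if S: "place S" and "x \<notin> S" for S
  proof (rule embedding_place_maximal[OF inj_x curve pole S])
    interpret S: rational_valuation_subring fls_const K S by (rule S)
    have inv: "inverse x \<in> nonunits S"
      using S.total[OF x_mem_K] \<open>x \<notin> S\<close> by (auto simp: nonunits_def)
    have "x \<noteq> 0" using x_neg by auto
    have unit: "laurent_eval (inverse x) (reflect_poly p) \<in> S \<and> laurent_eval (inverse x) (reflect_poly p) \<noteq> 0 \<and>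
        inverse (laurent_eval (inverse x) (reflect_poly p)) \<in> S" if "p \<noteq> 0" for p
    proof -
      let ?w = "laurent_eval (inverse x) (reflect_poly p)"
      have r: "?w - fls_const (lead_coeff p) \<in> nonunits S"
        using S.eval_poly_residue[OF ring_morphism_fls_const _ _ , of "\<lambda>c. c" "inverse x" 0 "reflect_poly p"] inv
        by (simp add: eval_poly_id poly_0_coeff_0 S.zero_nonunit ring_morphism_def)
      then have "?w \<in> S" using S.add_mem[OF S.nonunits_subset[OF r] S.const_mem[of "lead_coeff p"]] by simp
      moreover have "?w \<notin> nonunits S"
        using S.residue_unique[of ?w 0 "lead_coeff p"] r that by auto
      ultimately show ?thesis using S.unit_inverse by blast
    qed
    have fract: "eval_fract (laurent_eval x) z \<in> S"
      if z: "z \<noteq> 0" "fls_subdegree (eval_fract (laurent_eval x) z) \<ge> 0" for z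
    proof -
      obtain p q where pq: "z = Fract p q" "q \<noteq> 0" by (cases z)
      then have "p \<noteq> 0" using z by (auto simp: fract_collapse)
      have le: "degree p \<le> degree q"
        using z eval_fract_subdegree(2)[OF \<open>q \<noteq> 0\<close> \<open>p \<noteq> 0\<close>] \<beta>_pos pq by (simp add: zero_le_mult_iff)
      let ?p = "laurent_eval (inverse x) (reflect_poly p)" and ?q = "laurent_eval (inverse x) (reflect_poly q)"
      have "eval_fract (laurent_eval x) z = (x ^ degree p * ?p) / (x ^ degree q * ?q)"
        using pq eval_fract_Fract[OF ring_morphism_laurent_eval inj_x]
          laurent_eval_reflect_poly[OF \<open>x \<noteq> 0\<close>] by metis
      also have "\<dots> = inverse x ^ (degree q - degree p) * ?p * inverse ?q"
      proof -
        have "x ^ degree q = x ^ degree p * x ^ (degree q - degree p)" using le by (simp flip: power_add)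
        then show ?thesis using \<open>x \<noteq> 0\<close> unit[OF \<open>q \<noteq> 0\<close>] by (simp add: field_simps)
      qed
      also have "\<dots> \<in> S"
        using unit[OF \<open>q \<noteq> 0\<close>] unit[OF \<open>p \<noteq> 0\<close>] S.nonunits_subset[OF inv]
        by (intro S.mult_mem S.power_mem) auto
      finally show ?thesis .
    qed
    have "\<iota> u \<in> S" if u: "u \<in> V" "fls_subdegree (field_eval x y u) \<ge> 0" for u
    proof -
      let ?f = "\<lambda>j. eval_fract (laurent_eval x) (coeff u j) * y ^ j"
      have "?f j \<in> S" if "j < \<beta>" for j
      proof (cases "coeff u j = 0")
        case True
        then show ?thesis by (simp add: ring_morphism_zero[OF ring_morphism_eval_fract_x] S.zero_mem)
      next
        case False
        have nonneg: "fls_subdegree (?f j) \<ge> 0"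
          using subdegree_\<iota>_le(2)[OF u(1) False] u(2) by (simp add: \<iota>_def)
        have "?f j = \<iota> (monom (coeff u j) j)"
          by (simp add: \<iota>_def eval_poly_monom[OF ring_morphism_eval_fract_x])
        moreover have "monom (coeff u j) j \<in> V"
          using \<open>j < \<beta>\<close> degree_monom_le[of "coeff u j" j] by (simp add: V_def)
        ultimately have inK: "?f j \<in> K" by (simp add: K_def)
        define z where "z = coeff u j ^ \<beta> * to_fract (A ^ j)"
        have "A \<noteq> 0" using separable by (auto simp: separable_poly_def)
        then have "z \<noteq> 0" using False by (simp add: z_def)
        have power: "?f j ^ \<beta> = eval_fract (laurent_eval x) z"
          by (simp add: z_def power_mult_distrib ring_morphism_mult[OF ring_morphism_eval_fract_x]
              ring_morphism_power[OF ring_morphism_eval_fract_x]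
              eval_fract_to_fract[OF ring_morphism_laurent_eval inj_x]
              ring_morphism_power[OF ring_morphism_laurent_eval] curve[symmetric]
              power_mult[symmetric] mult.commute[of j])
        then have "fls_subdegree (eval_fract (laurent_eval x) z) = int \<beta> * fls_subdegree (?f j)"
          by (metis fls_subdegree_pow)
        then have "eval_fract (laurent_eval x) z \<in> S"
          using nonneg by (intro fract \<open>z \<noteq> 0\<close>) simp
        then show ?thesis using S.power_mem_imp_mem[OF inK \<beta>_pos] power by metis
      qed
      moreover have "\<iota> u = sum ?f {..<\<beta>}"
        unfolding \<iota>_def using u V_def by (intro eval_poly_altdef[OF ring_morphism_eval_fract_x]) blast
      ultimately show ?thesis using S.sum_mem[of "{..<\<beta>}" ?f] by simp
    qed
    then show "?S \<subseteq> S" by (auto simp: embedding_place_def[OF inj_x curve pole])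
  qed
  ultimately show ?thesis by blast
qed

lemma place_cases:
  assumes S: "place S" and "x \<in> S"
  shows "\<exists>a b. b ^ \<beta> = poly A a \<and> x - fls_const a \<in> nonunits S \<and> y - fls_const b \<in> nonunits S"
proof -
  interpret S: rational_valuation_subring fls_const K S by (rule S)
  obtain a where a: "x - fls_const a \<in> nonunits S" using S.residue \<open>x \<in> S\<close> by blast
  have "laurent_eval x A - fls_const (poly A a) \<in> nonunits S"
    using S.eval_poly_residue[OF ring_morphism_fls_const _ _ a, of "\<lambda>c. c" A]
    by (simp add: eval_poly_id S.zero_nonunit ring_morphism_def)
  from S.add_mem[OF S.nonunits_subset[OF this] S.const_mem[of "poly A a"]]
  have "y ^ \<beta> \<in> S" by (simp add: curve)
  then have "y \<in> S" using S.power_mem_imp_mem[OF y_mem_K \<beta>_pos] by blast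
  then obtain b where b: "y - fls_const b \<in> nonunits S" using S.residue by blast
  have "curve_eval x y F = 0" by (rule curve_eval_dvd[OF inj_x curve]) simp
  then have "poly (poly F [:b:]) a = 0"
    using S.eval2_nonunit_iff[OF a b, of F] S.zero_nonunit by simp
  then show ?thesis using a b by (auto simp: F_def superelliptic_at_point)
qed

text \<open>One place for each affine point, and the place at infinity.\<close>

lemma card_rational_points:
  assumes fin: "finite {(a, b). b ^ \<beta> = poly A a}"
  shows "card (rational_points (superelliptic \<beta> A)) = card {(a, b). b ^ \<beta> = poly A a} + 1"
proof -
  let ?C = "{(a, b). b ^ \<beta> = poly A a}"
  define centred where "centred P S \<longleftrightarrow> place S \<and> x - fls_const (fst P) \<in> nonunits S \<and> y - fls_const (snd P) \<in> nonunits S" for P S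
  have "\<exists>S. centred P S \<and> (\<forall>S'. centred P S' \<longrightarrow> S' = S)" if "P \<in> ?C" for P
    using affine_place[of "snd P" "fst P"] that by (auto simp: centred_def)
  then obtain pl where pl: "\<And>P. P \<in> ?C \<Longrightarrow> centred P (pl P)" "\<And>P S. P \<in> ?C \<Longrightarrow> centred P S \<Longrightarrow> S = pl P"
    by metis
  obtain S0 where S0: "place S0" "x \<notin> S0" "\<And>S. place S \<Longrightarrow> x \<notin> S \<Longrightarrow> S = S0"
    using infinite_place by blast
  have x_mem: "x \<in> S" if "centred P S" for P S
  proof -
    interpret S: rational_valuation_subring fls_const K S using that by (simp add: centred_def)
    have "x - fls_const (fst P) \<in> S" using that S.nonunits_subset by (auto simp: centred_def)
    from S.add_mem[OF this S.const_mem[of "fst P"]] show ?thesis by simp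
  qed
  have eq: "{S. place S} = insert S0 (pl ` ?C)"
  proof (intro equalityI subsetI)
    fix S assume "S \<in> {S. place S}"
    then have S: "place S" by simp
    show "S \<in> insert S0 (pl ` ?C)"
    proof (cases "x \<in> S")
      case True
      then obtain a b where "(a, b) \<in> ?C" "centred (a, b) S"
        using place_cases[OF S] S by (auto simp: centred_def)
      then show ?thesis using pl(2) by blast
    qed (use S0(3)[OF S] in simp)
  next
    fix S assume "S \<in> insert S0 (pl ` ?C)"
    then show "S \<in> {S. place S}" using S0(1) pl(1) by (auto simp: centred_def)
  qed
  have inj: "inj_on pl ?C"
  proof (rule inj_onI)
    fix P Q assume P: "P \<in> ?C" and Q: "Q \<in> ?C" and "pl P = pl Q"
    then have centre: "centred P (pl P)" "centred Q (pl P)" using pl(1)[OF P] pl(1)[OF Q] by simp_all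
    interpret S: rational_valuation_subring fls_const K "pl P" using centre(1) by (simp add: centred_def)
    show "P = Q"
      using centre S.residue_unique by (intro prod_eqI) (auto simp: centred_def)
  qed
  have "S0 \<notin> pl ` ?C" using S0(2) x_mem pl(1) by blast
  have "card (rational_points (superelliptic \<beta> A)) = card {S. place S}"
    using bij_betw_same_card[OF bij_betw_rational_points_places] by (simp add: F_def)
  also have "\<dots> = Suc (card (pl ` ?C))"
    unfolding eq using \<open>S0 \<notin> pl ` ?C\<close> fin by (intro card_insert_disjoint finite_imageI) auto
  finally show ?thesis using card_image[OF inj] by simp
qed

end

section \<open>Finite fields\<close>

lemma power_card_minus_one_eq_1:
  fixes x :: "'a::{field,finite}"
  assumes "x \<noteq> 0"
  shows "x ^ (CARD('a) - 1) = 1"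
proof -
  have "(\<Prod>y\<in>UNIV - {0}. x * y) = (\<Prod>y\<in>UNIV - {0 :: 'a}. y)"
    by (rule prod.reindex_bij_witness[of _ "\<lambda>y. y / x" "\<lambda>y. x * y"]) (use assms in auto)
  then have "x ^ (CARD('a) - 1) * (\<Prod>y\<in>UNIV - {0 :: 'a}. y) = (\<Prod>y\<in>UNIV - {0 :: 'a}. y)"
    by (simp add: prod.distrib card_Diff_singleton)
  moreover have "(\<Prod>y\<in>UNIV - {0 :: 'a}. y) \<noteq> 0" by simp
  ultimately show ?thesis by simp
qed

lemma one_less_card_field: "CARD('a::{field,finite}) > 1"
proof -
  have "card {0, 1 :: 'a} \<le> CARD('a)" by (intro card_mono) auto
  then show ?thesis by simp
qed

text \<open>Translation by \<open>1\<close> permutes the field and changes the sum of all elements by \<open>q\<close>. Hence \<open>q\<close> is zero in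
  the field and \<open>q - 1\<close>, a multiple of \<open>\<beta>\<close>, is not.\<close>

lemma of_nat_dvd_card_minus_one_nonzero:
  assumes "\<beta> dvd CARD('a::{field,finite}) - 1"
  shows "of_nat \<beta> \<noteq> (0 :: 'a)"
proof
  assume "of_nat \<beta> = (0 :: 'a)"
  moreover obtain k where "CARD('a) - 1 = \<beta> * k" using assms by (rule dvdE)
  ultimately have "of_nat (CARD('a) - 1) = (0 :: 'a)" by simp
  moreover have "(\<Sum>x\<in>UNIV. x + 1) = (\<Sum>x\<in>UNIV. x :: 'a)"
    by (rule sum.reindex_bij_witness[of _ "\<lambda>x. x - 1" "\<lambda>x. x + 1"]) auto
  then have "of_nat (CARD('a)) = (0 :: 'a)" by (simp add: sum.distrib)
  ultimately show False using one_less_card_field[where 'a = 'a] by (simp add: of_nat_diff)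
qed

text \<open>With \<open>q - 1 = \<beta> k\<close> and \<open>c = b\<^sup>\<beta>\<close>, every nonzero element is a root of
  \<open>z\<^sup>q\<^sup>-\<^sup>1 - 1 = (z\<^sup>\<beta> - c) p(z)\<close>, where \<open>p\<close> has degree \<open>\<beta> (k - 1)\<close>. So at least \<open>\<beta>\<close> of them are roots of the
  first factor.\<close>

lemma card_power_eq:
  fixes b :: "'a::{field,finite}"
  assumes \<beta>: "\<beta> > 0" "\<beta> dvd CARD('a) - 1" and b: "b \<noteq> 0"
  shows "card {z. z ^ \<beta> = b ^ \<beta>} \<ge> \<beta>"
proof -
  obtain k where k: "CARD('a) - 1 = \<beta> * k" using \<beta>(2) by (rule dvdE)
  then have "k > 0" using one_less_card_field[where 'a = 'a] by (cases k) auto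
  define c where "c = b ^ \<beta>"
  have c: "c \<noteq> 0" "c ^ k = 1"
    using power_card_minus_one_eq_1[OF b, unfolded k] b by (simp_all add: c_def flip: power_mult)
  define p where "p = (\<Sum>i<k. monom (c ^ (k - Suc i)) (\<beta> * i))"
  have poly_p: "poly p z = (\<Sum>i<k. c ^ (k - Suc i) * (z ^ \<beta>) ^ i)" for z
    by (simp add: p_def poly_sum poly_monom power_mult)
  have split: "z ^ (CARD('a) - 1) - 1 = (z ^ \<beta> - c) * poly p z" for z
    unfolding k power_mult poly_p using power_diff_sumr2[of "z ^ \<beta>" k c] c by simp
  have "degree p \<le> \<beta> * (k - 1)"
    unfolding p_def
  proof (rule degree_sum_le)
    fix i assume "i \<in> {..<k}"
    then have "\<beta> * i \<le> \<beta> * (k - 1)" by (intro mult_left_mono) auto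
    then show "degree (monom (c ^ (k - Suc i)) (\<beta> * i)) \<le> \<beta> * (k - 1)"
      using degree_monom_le order_trans by blast
  qed simp
  moreover have "p \<noteq> 0"
  proof
    assume "p = 0"
    then have "(0 :: 'a) ^ (CARD('a) - 1) = 1" using split[of 0] by simp
    then show False using one_less_card_field[where 'a = 'a] by (simp add: power_0_left)
  qed
  ultimately have "card {z. poly p z = 0} \<le> \<beta> * (k - 1)"
    using card_poly_roots_bound by (metis order_trans)
  moreover have "card (UNIV - {0 :: 'a}) \<le> card ({z. z ^ \<beta> = c} \<union> {z. poly p z = 0})"
  proof (rule card_mono)
    show "UNIV - {0 :: 'a} \<subseteq> {z. z ^ \<beta> = c} \<union> {z. poly p z = 0}"
    proof
      fix z :: 'a assume "z \<in> UNIV - {0}"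
      then have "(z ^ \<beta> - c) * poly p z = 0"
        using split[of z] power_card_minus_one_eq_1[of z] by simp
      then show "z \<in> {z. z ^ \<beta> = c} \<union> {z. poly p z = 0}" by auto
    qed
  qed simp
  moreover have "card ({z. z ^ \<beta> = c} \<union> {z. poly p z = 0}) \<le> card {z. z ^ \<beta> = c} + card {z. poly p z = 0}"
    by (rule card_Un_le)
  ultimately have "\<beta> * k \<le> card {z. z ^ \<beta> = c} + \<beta> * (k - 1)"
    using k by (simp add: card_Diff_singleton)
  then show ?thesis using \<open>k > 0\<close> by (cases k) (auto simp: c_def)
qed

lemma prime_CHAR_finite_field: "prime CHAR('a::{field,finite})"
  using finite_imp_CHAR_pos[where 'a = 'a] by (intro prime_CHAR_semidom) simp

lemma poly_additive:
  fixes A :: "'a::{field,finite} poly"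
  assumes "additive_poly A"
  shows "poly A (u + v) = poly A u + poly A v"
proof -
  have "coeff A i * (u + v) ^ i = coeff A i * u ^ i + coeff A i * v ^ i" for i
  proof (cases "coeff A i = 0")
    case False
    then obtain j where "i = CHAR('a) ^ j" using assms by (auto simp: additive_poly_def)
    then show ?thesis
      using freshmans_dream'[OF prime_CHAR_finite_field, of i j u v] by (simp add: algebra_simps)
  qed simp
  then show ?thesis by (simp add: poly_altdef sum.distrib)
qed

lemma separable_nonzero: "separable_poly A \<Longrightarrow> A \<noteq> 0"
  by (auto simp: separable_poly_def)

text \<open>The degree is a power of the characteristic, and \<open>\<beta>\<close> is prime to the characteristic.\<close>

lemma coprime_degree_additive:
  fixes A :: "'a::{field,finite} poly"
  assumes "additive_poly A" "A \<noteq> 0" "of_nat \<beta> \<noteq> (0 :: 'a)"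
  shows "coprime (degree A) \<beta>"
proof -
  obtain j where "degree A = CHAR('a) ^ j"
    using assms(1,2) unfolding additive_poly_def by (metis leading_coeff_0_iff)
  moreover have "\<not> CHAR('a) dvd \<beta>" using assms(3) by (simp add: of_nat_eq_0_iff_char_dvd)
  ultimately show ?thesis
    using prime_imp_coprime[OF prime_CHAR_finite_field[where 'a = 'a], of \<beta>] by simp
qed

lemma card_roots_separable_splits:
  fixes A :: "'a::field poly"
  assumes sep: "separable_poly A" and "splits_poly A"
  shows "card {a. poly A a = 0} = degree A"
proof -
  obtain as where as: "A = smult (lead_coeff A) (\<Prod>a\<leftarrow>as. [:- a, 1:])"
    using assms(2) by (auto simp: splits_poly_def)
  define c where "c = lead_coeff A"
  have c: "c \<noteq> 0" using separable_nonzero[OF sep] by (simp add: c_def)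
  have A: "A = smult c (\<Prod>a\<leftarrow>as. [:- a, 1:])" using as by (simp add: c_def)
  have "degree (\<Prod>a\<leftarrow>as. [:- a, 1:]) = length as"
  proof (induction as)
    case (Cons a as)
    have "(\<Prod>a\<leftarrow>as. [:- a, 1:]) \<noteq> 0" by (auto simp: prod_list_zero_iff)
    then show ?case using Cons degree_mult_eq[of "[:- a, 1:]" "\<Prod>a\<leftarrow>as. [:- a, 1:]"] by simp
  qed simp
  then have "degree A = length as" using c A by simp
  moreover have roots: "{a. poly A a = 0} = set as"
  proof -
    have "poly (\<Prod>a\<leftarrow>as. [:- a, 1:]) z = 0 \<longleftrightarrow> z \<in> set as" for z
      by (induction as) auto
    then show ?thesis using c by (subst A) auto
  qed
  moreover have "distinct as"
  proof (rule ccontr)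
    assume "\<not> distinct as"
    then obtain xs ys zs a where "as = xs @ [a] @ ys @ [a] @ zs"
      using not_distinct_decomp by blast
    then have "A = [:- a, 1:] * ([:- a, 1:] * smult c (\<Prod>b\<leftarrow>xs @ ys @ zs. [:- b, 1:]))"
      using A by (simp add: mult_ac del: mult_pCons_left mult_pCons_right)
    then obtain h where h: "A = [:- a, 1:] * ([:- a, 1:] * h)" by blast
    then have "pderiv A = pderiv ([:- a, 1:] * ([:- a, 1:] * h))" by simp
    then have "poly (pderiv A) a = 0" unfolding pderiv_mult by simp
    moreover have "poly A a = 0" by (subst h) simp
    ultimately show False using separable_poly_simple_root[OF sep] by blast
  qed
  ultimately show ?thesis using distinct_card by metis
qed

section \<open>Polynomials in two variables with prescribed support\<close>

text \<open>A pair \<open>(i, j)\<close> stands for the monomial \<open>x\<^sup>i y\<^sup>j\<close>.\<close>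

definition supported :: "(nat \<times> nat) set \<Rightarrow> 'a::field poly poly set" where
  "supported I = {g. \<forall>i j. coeff (coeff g j) i \<noteq> 0 \<longrightarrow> (i, j) \<in> I}"

definition bivariate :: "(nat \<times> nat) set \<Rightarrow> (nat \<times> nat \<Rightarrow> 'a::field) \<Rightarrow> 'a poly poly" where
  "bivariate I c = (\<Sum>(i, j)\<in>I. monom (monom (c (i, j)) i) j)"

lemma coeff_bivariate:
  assumes "finite I"
  shows "coeff (coeff (bivariate I c) j) i = (if (i, j) \<in> I then c (i, j) else 0)"
proof -
  have "coeff (coeff (bivariate I c) j) i = (\<Sum>p\<in>I. if p = (i, j) then c p else 0)"
    unfolding bivariate_def coeff_sum by (intro sum.cong refl) (auto split: if_splits)
  then show ?thesis using assms by simp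
qed

lemma bivariate_supported: "finite I \<Longrightarrow> bivariate I c \<in> supported I"
  by (simp add: supported_def coeff_bivariate)

lemma supported_eq_bivariate:
  assumes "finite I" "g \<in> supported I"
  shows "g = bivariate I (\<lambda>(i, j). coeff (coeff g j) i)"
proof (intro poly_eqI)
  fix i j
  show "coeff (coeff g j) i = coeff (coeff (bivariate I (\<lambda>(i, j). coeff (coeff g j) i)) j) i"
    using assms by (auto simp: coeff_bivariate supported_def)
qed

lemma supported_0: "0 \<in> supported I"
  and supported_add: "g \<in> supported I \<Longrightarrow> h \<in> supported I \<Longrightarrow> g + h \<in> supported I"
  and supported_diff: "g \<in> supported I \<Longrightarrow> h \<in> supported I \<Longrightarrow> g - h \<in> supported I"
  and supported_smult: "g \<in> supported I \<Longrightarrow> smult [:c:] g \<in> supported I"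
  and supported_mono: "I \<subseteq> J \<Longrightarrow> supported I \<subseteq> supported J"
  by (force simp: supported_def)+

lemma supported_sum: "(\<And>k. k \<in> K \<Longrightarrow> g k \<in> supported I) \<Longrightarrow> sum g K \<in> supported I"
  by (induction K rule: infinite_finite_induct) (simp_all add: supported_0 supported_add)

lemma card_supported:
  assumes "finite I"
  shows "card (supported I :: 'a::{field,finite} poly poly set) = CARD('a) ^ card I"
    and "finite (supported I :: 'a poly poly set)"
proof -
  have bij: "bij_betw (bivariate I) (I \<rightarrow>\<^sub>E UNIV) (supported I :: 'a poly poly set)"
  proof (rule bij_betwI')
    fix c d :: "nat \<times> nat \<Rightarrow> 'a"
    assume c: "c \<in> I \<rightarrow>\<^sub>E UNIV" and d: "d \<in> I \<rightarrow>\<^sub>E UNIV"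
    have "c p = d p" if "bivariate I c = bivariate I d" "p \<in> I" for p
      using coeff_bivariate[OF assms, of c "snd p" "fst p"] coeff_bivariate[OF assms, of d "snd p" "fst p"] that
      by simp
    then show "(bivariate I c = bivariate I d) = (c = d)"
      using c d PiE_ext by metis
  next
    fix g :: "'a poly poly" assume "g \<in> supported I"
    moreover have "bivariate I c = bivariate I (restrict c I)" for c :: "nat \<times> nat \<Rightarrow> 'a"
      unfolding bivariate_def by (intro sum.cong) auto
    ultimately show "\<exists>c\<in>I \<rightarrow>\<^sub>E UNIV. g = bivariate I c"
      using supported_eq_bivariate[OF assms] by (metis UNIV_I restrict_PiE_iff)
  qed (rule bivariate_supported[OF assms])
  then show "card (supported I :: 'a poly poly set) = CARD('a) ^ card I"
    using bij_betw_same_card[OF bij] card_funcsetE[OF assms, of "UNIV :: 'a set"] by simp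
  show "finite (supported I :: 'a poly poly set)"
    using bij_betw_finite[OF bij] finite_PiE[OF assms, of "\<lambda>_. UNIV :: 'a set"] by simp
qed

section \<open>Zeros of functions on the curve\<close>

text \<open>Division by \<open>y\<^sup>\<beta> - A(x)\<close> needs no denominators, as this polynomial is monic in \<open>y\<close>.\<close>

lemma superelliptic_reduction:
  assumes "\<beta> > 0"
  shows "\<exists>r. degree r < \<beta> \<and> superelliptic \<beta> (A :: 'a::field poly) dvd g - r"
proof (induction g)
  case 0
  show ?case using assms by (intro exI[of _ 0]) simp
next
  case (pCons p g)
  then obtain r where r: "degree r < \<beta>" "superelliptic \<beta> A dvd g - r" by blast
  let ?F = "superelliptic \<beta> A"
  define h where "h = pCons p r"
  define s where "s = h - smult (coeff h \<beta>) ?F"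
  have "coeff s k = 0" if "k \<ge> \<beta>" for k
  proof (cases "k = \<beta>")
    case True
    then show ?thesis using assms by (simp add: s_def superelliptic_def coeff_pCons split: nat.split)
  next
    case False
    then have "coeff h k = 0" using that r(1) by (cases k) (auto simp: h_def coeff_eq_0)
    moreover have "coeff ?F k = 0"
      using False that assms by (simp add: superelliptic_def coeff_pCons split: nat.split)
    ultimately show ?thesis by (simp add: s_def)
  qed
  then have "degree s < \<beta>"
    using assms by (metis leading_coeff_0_iff degree_0 not_le)
  moreover have "pCons p g - s = [:0, 1:] * (g - r) + [:coeff h \<beta>:] * ?F"
    by (simp add: s_def h_def)
  then have "?F dvd pCons p g - s" using r(2) by (metis dvd_add dvd_mult dvd_triv_right)
  ultimately show ?case by blast
qed

lemma fls_subdegree_sum_ge: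
  fixes f :: "'i \<Rightarrow> 'a::field fls"
  assumes "\<And>i. i \<in> I \<Longrightarrow> f i = 0 \<or> fls_subdegree (f i) \<ge> k" "sum f I \<noteq> 0"
  shows "fls_subdegree (sum f I) \<ge> k"
proof (rule fls_subdegree_geI[OF assms(2)])
  fix l assume "l < k"
  then have "fls_nth (f i) l = 0" if "i \<in> I" for i
    using assms(1)[OF that] by auto
  then show "fls_nth (sum f I) l = 0" by (simp add: fls_nth_sum)
qed

context superelliptic_laurent
begin

text \<open>The monomials of degree below \<open>\<beta>\<close> in \<open>y\<close> whose pole at infinity has order at most \<open>m\<close>.\<close>

definition weights :: "nat \<Rightarrow> (nat \<times> nat) set" where
  "weights m = {(i, j). j < \<beta> \<and> \<beta> * i + degree A * j \<le> m}"

lemma finite_weights: "finite (weights m)"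
proof (rule finite_subset)
  show "weights m \<subseteq> {..m} \<times> {..<\<beta>}"
  proof (rule subrelI)
    fix i j assume "(i, j) \<in> weights m"
    then have ij: "j < \<beta>" "\<beta> * i + degree A * j \<le> m" by (auto simp: weights_def)
    moreover have "i \<le> \<beta> * i" using \<beta>_pos by simp
    then have "i \<le> m" using ij(2) by linarith
    ultimately show "(i, j) \<in> {..m} \<times> {..<\<beta>}" by auto
  qed
qed simp

lemma weights_mono: "m \<le> m' \<Longrightarrow> weights m \<subseteq> weights m'"
  by (auto simp: weights_def)

lemma curve_eval_subdegree_term:
  assumes "p \<noteq> 0"
  shows "laurent_eval x p * y ^ j \<noteq> 0"
    and "fls_subdegree (laurent_eval x p * y ^ j) = - int (\<beta> * degree p + degree A * j)"
  using laurent_eval_subdegree[OF x_neg assms] y_nonzero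
  by (simp_all add: fls_subdegree_pow x_subdegree y_subdegree algebra_simps)

lemma curve_eval_subdegree_le:
  assumes "degree g < \<beta>" "coeff g j \<noteq> 0"
  shows "curve_eval x y g \<noteq> 0"
    and "fls_subdegree (curve_eval x y g) \<le> - int (\<beta> * degree (coeff g j) + degree A * j)"
proof -
  let ?u = "map_poly to_fract g"
  have u: "?u \<in> V" "coeff ?u j \<noteq> 0"
    using assms degree_map_poly[of to_fract g] by (simp_all add: V_def coeff_map_poly)
  have eq: "\<iota> ?u = curve_eval x y g"
    unfolding \<iota>_def by (rule field_eval_map_poly[OF inj_x curve])
  show "curve_eval x y g \<noteq> 0" using subdegree_\<iota>_le(1)[OF u] eq by simp
  show "fls_subdegree (curve_eval x y g) \<le> - int (\<beta> * degree (coeff g j) + degree A * j)"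
    using subdegree_\<iota>_le(2)[OF u] curve_eval_subdegree_term(2)[OF assms(2), of j] eq
    by (simp add: coeff_map_poly eval_fract_to_fract[OF ring_morphism_laurent_eval inj_x])
qed

lemma curve_eval_eq_0: "degree g < \<beta> \<Longrightarrow> curve_eval x y g = 0 \<Longrightarrow> g = 0"
  using curve_eval_subdegree_le(1) by (metis leading_coeff_0_iff)

text \<open>The order of the pole of a sum of terms \<open>p\<^sub>j(x) y\<^sup>j\<close> is the maximum of the orders of the terms, so a bound
  on it is a condition on the support.\<close>

lemma supported_weights_iff:
  assumes "g \<noteq> 0"
  shows "g \<in> supported (weights m) \<longleftrightarrow> degree g < \<beta> \<and> - fls_subdegree (curve_eval x y g) \<le> int m"
proof
  assume g: "g \<in> supported (weights m)"
  have coeff: "j < \<beta> \<and> \<beta> * degree (coeff g j) + degree A * j \<le> m" if "coeff g j \<noteq> 0" for j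
    using g that by (auto simp: supported_def weights_def leading_coeff_0_iff dest: spec[of _ "degree (coeff g j)"])
  have deg: "degree g < \<beta>" using coeff[of "degree g"] assms by simp
  have eq: "curve_eval x y g = (\<Sum>j<\<beta>. laurent_eval x (coeff g j) * y ^ j)"
    by (rule eval_poly_altdef[OF ring_morphism_laurent_eval deg])
  have "fls_subdegree (curve_eval x y g) \<ge> - int m"
    unfolding eq
  proof (rule fls_subdegree_sum_ge)
    show "laurent_eval x (coeff g j) * y ^ j = 0 \<or> - int m \<le> fls_subdegree (laurent_eval x (coeff g j) * y ^ j)" for j
    proof (cases "coeff g j = 0")
      case False
      have "int (\<beta> * degree (coeff g j) + degree A * j) \<le> int m"
        using coeff[OF False] by (simp only: of_nat_le_iff)
      then show ?thesis using curve_eval_subdegree_term(2)[OF False, of j] by linarith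
    qed (simp add: eval_poly_0[OF ring_morphism_fls_const])
    show "(\<Sum>j<\<beta>. laurent_eval x (coeff g j) * y ^ j) \<noteq> 0"
      using curve_eval_eq_0[OF deg] assms eq by auto
  qed
  then show "degree g < \<beta> \<and> - fls_subdegree (curve_eval x y g) \<le> int m" using deg by simp
next
  assume g: "degree g < \<beta> \<and> - fls_subdegree (curve_eval x y g) \<le> int m"
  show "g \<in> supported (weights m)"
    unfolding supported_def weights_def
  proof (intro CollectI allI impI case_prodI conjI)
    fix i j assume nz: "coeff (coeff g j) i \<noteq> 0"
    then have j: "coeff g j \<noteq> 0" by auto
    then show "j < \<beta>" using g le_degree by fastforce
    have "int (\<beta> * degree (coeff g j) + degree A * j) \<le> int m"
      using curve_eval_subdegree_le(2)[OF _ j] g by linarith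
    moreover have "\<beta> * i \<le> \<beta> * degree (coeff g j)" using le_degree[OF nz] by simp
    ultimately show "\<beta> * i + degree A * j \<le> m" by linarith
  qed
qed

text \<open>Monomials have distinct pole orders, and the new ones have an order among \<open>m + 1, \<dots>, m + s\<close>.\<close>

lemma card_weights_le: "card (weights (m + s)) \<le> card (weights m) + s"
proof -
  let ?w = "\<lambda>(i, j). \<beta> * i + degree A * j"
  let ?D = "weights (m + s) - weights m"
  have inj: "inj_on ?w (weights (m + s))"
  proof (rule inj_onI, clarify)
    fix i j i' j'
    assume "(i, j) \<in> weights (m + s)" "(i', j') \<in> weights (m + s)"
      and eq: "\<beta> * i + degree A * j = \<beta> * i' + degree A * j'"
    then have j: "j < \<beta>" "j' < \<beta>" by (auto simp: weights_def)
    have "int (degree A) * (int j - int j') = int \<beta> * (int i' - int i)"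
      using arg_cong[OF eq, of int] by (simp add: algebra_simps)
    then have "j = j'" by (rule coprime_cong_unique[OF coprime j])
    then show "i = i' \<and> j = j'" using eq \<beta>_pos by simp
  qed
  have "card ?D = card (?w ` ?D)" using inj by (metis card_image inj_on_diff)
  also have "\<dots> \<le> card {m + 1..m + s}"
    by (intro card_mono) (auto simp: weights_def)
  finally have "card ?D \<le> s" by simp
  then show ?thesis
    using card_Diff_subset[OF finite_weights weights_mono[of m "m + s"]] by simp
qed

end

lemma point_indicator:
  fixes a b :: "'a::{field,finite}"
  shows "\<exists>e. \<forall>a' b'. poly (poly e [:b':]) a' = (if a' = a \<and> b' = b then 1 else 0)"
proof -
  define d where "d = CARD('a) - 1"
  define e :: "'a poly poly" where "e = [:1 - [:- a, 1:] ^ d:] * (1 - [:[:- b:], 1:] ^ d)"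
  have "poly (poly e [:b':]) a' = (1 - (a' - a) ^ d) * (1 - (b' - b) ^ d)" for a' b'
    by (simp add: e_def poly_power)
  moreover have "z ^ d = (if z = 0 then 0 else 1)" for z :: 'a
    using power_card_minus_one_eq_1[of z] one_less_card_field[where 'a = 'a]
    by (simp add: d_def power_0_left)
  ultimately show ?thesis by (intro exI[of _ e]) auto
qed

text \<open>Let \<open>s\<close> be the order of the pole of \<open>f\<close>, and let \<open>W m\<close> be the space of functions with a pole of order at
  most \<open>m\<close>. Choose \<open>m\<close> so large that \<open>W (m + s)\<close> contains, for each \<open>P \<in> Z\<close>, a function \<open>e P\<close> that is
  \<open>1\<close> at \<open>P\<close> and \<open>0\<close> at the other points of \<open>Z\<close>. The map \<open>(g, c) \<mapsto> f g + \<Sum> c(P) e(P)\<close> from \<open>W m \<times> k\<^sup>Z\<close> to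
  \<open>W (m + s)\<close> is injective: its value at \<open>P\<close> is \<open>c(P)\<close> as \<open>f\<close> vanishes there, and then \<open>f g\<close> determines
  \<open>g\<close>. Hence \<open>dim W m + |Z| \<le> dim W (m + s) \<le> dim W m + s\<close>.\<close>

lemma card_zeros_le:
  fixes A :: "'a::{field,finite} poly"
  assumes "superelliptic_laurent A \<beta> x y"
    and f: "degree f < \<beta>" "f \<noteq> 0"
    and Z: "\<And>a b. (a, b) \<in> Z \<Longrightarrow> b ^ \<beta> = poly A a \<and> poly (poly f [:b:]) a = 0"
  shows "int (card Z) \<le> - fls_subdegree (curve_eval x y f)"
proof -
  interpret superelliptic_laurent A \<beta> x y by (rule assms(1))
  let ?ev = "curve_eval x y"
  define s where "s = nat (- fls_subdegree (?ev f))"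
  have f_nz: "?ev f \<noteq> 0" using curve_eval_eq_0 f by blast
  have s: "- fls_subdegree (?ev f) = int s"
  proof -
    have "fls_subdegree (?ev f) \<le> - int (\<beta> * degree (lead_coeff f) + degree A * degree f)"
      using curve_eval_subdegree_le(2)[OF f(1)] f(2) by simp
    also have "\<dots> \<le> 0" by (simp only: neg_le_0_iff_le of_nat_0_le_iff)
    finally show ?thesis by (simp add: s_def)
  qed
  have "finite Z" by (rule finite)
  obtain red where red: "\<And>g. degree (red g) < \<beta>" "\<And>g. F dvd g - red g"
    using superelliptic_reduction[OF \<beta>_pos, of A] unfolding F_def by metis
  have ev_red: "?ev (red g) = ?ev g" for g
    using curve_eval_dvd[OF inj_x curve red(2)[of g]]
    by (simp add: ring_morphism_diff[OF ring_morphism_curve_eval])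
  have pt_red: "poly (poly (red g) [:b:]) a = poly (poly g [:b:]) a" if "(a, b) \<in> Z" for g a b
  proof -
    obtain h where "g - red g = F * h" using red(2) by (rule dvdE)
    then have "poly (poly (g - red g) [:b:]) a = poly (poly F [:b:]) a * poly (poly h [:b:]) a" by simp
    then show ?thesis using Z[OF that] by (simp add: F_def superelliptic_at_point)
  qed
  define e where "e P = (SOME e. \<forall>a' b'. poly (poly e [:b':]) a' = (if a' = fst P \<and> b' = snd P then 1 else (0::'a)))" for P
  have e: "poly (poly (e P) [:snd Q:]) (fst Q) = (if Q = P then 1 else 0)" for P Q
    using someI_ex[OF point_indicator[of "fst P" "snd P"]] unfolding e_def by (auto simp: prod_eq_iff)
  define m where "m = (\<Sum>P\<in>Z. nat (- fls_subdegree (?ev (red (e P)))))"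
  have e_mem: "red (e P) \<in> supported (weights (m + s))" if "P \<in> Z" for P
  proof (cases "red (e P) = 0")
    case False
    have "nat (- fls_subdegree (?ev (red (e P)))) \<le> m"
      unfolding m_def using that \<open>finite Z\<close> by (intro member_le_sum) auto
    then show ?thesis using supported_weights_iff[OF False] red(1) by simp
  qed (simp add: supported_0)
  define \<Phi> where "\<Phi> = (\<lambda>(g, c). red (f * g) + (\<Sum>P\<in>Z. smult [:c P:] (red (e P))))"
  have value_at: "poly (poly (\<Phi> (g, c)) [:snd Q:]) (fst Q) = c Q" if "Q \<in> Z" for g c Q
  proof -
    have *: "poly (poly (red h) [:snd Q:]) (fst Q) = poly (poly h [:snd Q:]) (fst Q)" for h
      using pt_red[of "fst Q" "snd Q" h] that by simp
    have "poly (poly f [:snd Q:]) (fst Q) = 0" using Z[of "fst Q" "snd Q"] that by simp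
    then have "poly (poly (\<Phi> (g, c)) [:snd Q:]) (fst Q) = (\<Sum>P\<in>Z. c P * (if Q = P then 1 else 0))"
      unfolding \<Phi>_def by (simp add: poly_sum * e)
    also have "\<dots> = c Q" using that \<open>finite Z\<close> by (simp add: if_distrib cong: if_cong)
    finally show ?thesis .
  qed
  have into: "\<Phi> ` (supported (weights m) \<times> (Z \<rightarrow>\<^sub>E UNIV)) \<subseteq> supported (weights (m + s))"
  proof clarify
    fix g :: "'a poly poly" and c :: "'a \<times> 'a \<Rightarrow> 'a" assume g: "g \<in> supported (weights m)"
    have "red (f * g) \<in> supported (weights (m + s))"
    proof (cases "red (f * g) = 0")
      case False
      then have "?ev (red (f * g)) \<noteq> 0" using curve_eval_eq_0 red(1) by blast
      then have prod: "?ev f * ?ev g \<noteq> 0" by (simp add: ev_red ring_morphism_mult[OF ring_morphism_curve_eval])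
      then have "g \<noteq> 0" by (auto simp: eval_poly_0[OF ring_morphism_laurent_eval])
      then have "- fls_subdegree (?ev g) \<le> int m" using supported_weights_iff g by blast
      then have "- fls_subdegree (?ev (red (f * g))) \<le> int (m + s)"
        using prod s by (simp add: ev_red ring_morphism_mult[OF ring_morphism_curve_eval])
      then show ?thesis using supported_weights_iff[OF False] red(1) by blast
    qed (simp add: supported_0)
    then show "\<Phi> (g, c) \<in> supported (weights (m + s))"
      unfolding \<Phi>_def by (auto intro!: supported_add supported_sum supported_smult e_mem)
  qed
  have "inj_on \<Phi> (supported (weights m) \<times> (Z \<rightarrow>\<^sub>E UNIV))"
  proof (rule inj_onI, clarify)
    fix g g' :: "'a poly poly" and c c' :: "'a \<times> 'a \<Rightarrow> 'a"
    assume g: "g \<in> supported (weights m)" "g' \<in> supported (weights m)"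
      and c: "c \<in> Z \<rightarrow>\<^sub>E UNIV" "c' \<in> Z \<rightarrow>\<^sub>E UNIV" and eq: "\<Phi> (g, c) = \<Phi> (g', c')"
    have "c = c'"
      using value_at[of _ g c] value_at[of _ g' c'] eq by (intro PiE_ext[OF c]) metis
    then have "red (f * g) = red (f * g')" using eq by (simp add: \<Phi>_def)
    then have "?ev f * ?ev g = ?ev f * ?ev g'"
      by (metis ev_red ring_morphism_mult[OF ring_morphism_curve_eval])
    then have "?ev (g - g') = 0" using f_nz by (simp add: ring_morphism_diff[OF ring_morphism_curve_eval])
    moreover have "g - g' = 0 \<or> degree (g - g') < \<beta>"
      using supported_weights_iff[of "g - g'"] supported_diff[OF g] by blast
    ultimately have "g - g' = 0" using curve_eval_eq_0 by blast
    then show "g = g' \<and> c = c'" using \<open>c = c'\<close> by simp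
  qed
  then have "card ((supported (weights m) :: 'a poly poly set) \<times> (Z \<rightarrow>\<^sub>E (UNIV :: 'a set))) \<le> card (supported (weights (m + s)) :: 'a poly poly set)"
    using into by (rule card_inj_on_le) (rule card_supported(2)[OF finite_weights])
  then have "CARD('a) ^ (card (weights m) + card Z) \<le> CARD('a) ^ card (weights (m + s))"
    by (simp add: card_cartesian_product card_supported(1)[OF finite_weights] card_funcsetE power_add)
  then have "card (weights m) + card Z \<le> card (weights (m + s))"
    using one_less_card_field[where 'a = 'a] by simp
  then show ?thesis using card_weights_le[of m s] s by simp
qed

section \<open>Evaluation codes and their recovery sets\<close>

lemma recovery_setI:
  assumes "I \<noteq> {}" "I \<subseteq> {..<n} - {i}"
    and "\<And>c c'. c \<in> C \<Longrightarrow> c' \<in> C \<Longrightarrow> (\<And>k. k \<in> I \<Longrightarrow> c k = c' k) \<Longrightarrow> c i = c' i"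
  shows "recovery_set n C i I"
  unfolding recovery_set_def
proof (intro conjI allI impI assms(1,2))
  fix \<gamma> \<gamma>' :: 'a assume "\<gamma> \<noteq> \<gamma>'"
  show "code_proj I i \<gamma> C \<inter> code_proj I i \<gamma>' C = {}"
  proof (rule ccontr)
    assume "code_proj I i \<gamma> C \<inter> code_proj I i \<gamma>' C \<noteq> {}"
    then obtain c c' where c: "c \<in> C" "c i = \<gamma>" "c' \<in> C" "c' i = \<gamma>'" and eq: "restrict c I = restrict c' I"
      unfolding code_proj_def by fastforce
    have "c k = c' k" if "k \<in> I" for k using fun_cong[OF eq, of k] that by simp
    then show False using assms(3)[of c c'] c \<open>\<gamma> \<noteq> \<gamma>'\<close> by blast
  qed
qed

lemma min_dist_attained:
  assumes "c0 \<in> C" "c1 \<in> C" "c0 \<noteq> c1"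
  shows "\<exists>c\<in>C. \<exists>c'\<in>C. c \<noteq> c' \<and> min_dist n C = hamming_dist n c c'"
proof -
  have "{hamming_dist n c c' |c c'. c \<in> C \<and> c' \<in> C \<and> c \<noteq> c'} \<noteq> {}" using assms by blast
  from Inf_nat_def1[OF this] show ?thesis unfolding min_dist_def by blast
qed

lemma poly_eq_0_if_many_roots:
  fixes p :: "'a::{field,finite} poly"
  assumes "degree p < card R" "\<And>a. a \<in> R \<Longrightarrow> poly p a = 0"
  shows "p = 0"
proof (rule ccontr)
  assume "p \<noteq> 0"
  have "card R \<le> card {a. poly p a = 0}" using assms(2) by (intro card_mono) auto
  then show False using card_poly_roots_bound[OF \<open>p \<noteq> 0\<close>] assms(1) by simp
qed

lemma supported_rectangle:
  fixes g :: "'a::{field,finite} poly poly"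
  assumes g: "g \<in> supported ({..t2} \<times> {..t1})"
  shows "degree g \<le> t1" and "degree (coeff g j) \<le> t2"
    and "degree (poly g [:b:]) \<le> t2"
    and "degree (map_poly (\<lambda>p. poly p a) g) \<le> t1"
proof -
  have *: "j \<le> t1 \<and> degree (coeff g j) \<le> t2" if "coeff g j \<noteq> 0" for j
  proof -
    have "coeff (coeff g j) (degree (coeff g j)) \<noteq> 0" using that by simp
    then show ?thesis using g unfolding supported_def by blast
  qed
  show d1: "degree g \<le> t1" using *[of "degree g"] by (cases "g = 0") auto
  show d2: "degree (coeff g j) \<le> t2" for j using *[of j] by (cases "coeff g j = 0") auto
  have "poly g [:b:] = (\<Sum>j\<le>degree g. coeff g j * [:b:] ^ j)" by (rule poly_altdef)
  also have "degree \<dots> \<le> t2"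
  proof (rule degree_sum_le)
    fix j
    have "degree (coeff g j * [:b:] ^ j) \<le> degree (coeff g j) + degree ([:b:] ^ j)" by (rule degree_mult_le)
    also have "degree ([:b:] ^ j) = 0" using degree_power_le[of "[:b:]" j] by simp
    finally show "degree (coeff g j * [:b:] ^ j) \<le> t2" using d2[of j] by simp
  qed simp
  finally show "degree (poly g [:b:]) \<le> t2" .
  show "degree (map_poly (\<lambda>p. poly p a) g) \<le> t1" using d1 map_poly_degree_leq order_trans by blast
qed

lemma vanish_on_vertical_fibre:
  fixes g :: "'a::{field,finite} poly poly"
  assumes "g \<in> supported ({..t2} \<times> {..t1})" "t1 < card T" "\<And>b. b \<in> T \<Longrightarrow> poly (poly g [:b:]) a = 0"
  shows "map_poly (\<lambda>p. poly p a) g = 0"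
  using supported_rectangle(4)[OF assms(1), of a] assms(2,3)
  by (intro poly_eq_0_if_many_roots[of _ T]) (auto simp: poly_map_poly_poly)

lemma vanish_on_horizontal_fibre:
  fixes g :: "'a::{field,finite} poly poly"
  assumes "g \<in> supported ({..t2} \<times> {..t1})" "t2 < card T" "\<And>a. a \<in> T \<Longrightarrow> poly (poly g [:b:]) a = 0"
  shows "poly g [:b:] = 0"
  using supported_rectangle(3)[OF assms(1), of b] assms(2,3)
  by (intro poly_eq_0_if_many_roots[of _ T]) auto

lemma vanish_on_grid:
  fixes g :: "'a::{field,finite} poly poly"
  assumes g: "g \<in> supported ({..t2} \<times> {..t1})" and "t2 < card R" "t1 < card T"
    and zero: "\<And>a b. a \<in> R \<Longrightarrow> b \<in> T \<Longrightarrow> poly (poly g [:b:]) a = 0"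
  shows "g = 0"
proof (rule poly_eqI)
  fix j
  have "coeff g j = 0"
  proof (rule poly_eq_0_if_many_roots[of _ R])
    show "degree (coeff g j) < card R" using supported_rectangle(2)[OF g, of j] assms(2) by simp
    fix a assume "a \<in> R"
    then have "map_poly (\<lambda>p. poly p a) g = 0"
      using zero by (intro vanish_on_vertical_fibre[OF g \<open>t1 < card T\<close>]) auto
    then have "coeff (map_poly (\<lambda>p. poly p a) g) j = 0" by simp
    then show "poly (coeff g j) a = 0" by (simp add: coeff_map_poly)
  qed
  then show "coeff g j = coeff 0 j" by simp
qed

definition evaluation_word :: "nat \<Rightarrow> (nat \<Rightarrow> 'a \<times> 'a) \<Rightarrow> 'a::field poly poly \<Rightarrow> nat \<Rightarrow> 'a" where
  "evaluation_word n pt g = (\<lambda>i. if i < n then poly (poly g [:snd (pt i):]) (fst (pt i)) else 0)"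

lemma evaluation_word_0: "evaluation_word n pt 0 = 0"
  and evaluation_word_add: "evaluation_word n pt (g + h) = evaluation_word n pt g + evaluation_word n pt h"
  and evaluation_word_diff: "evaluation_word n pt (g - h) = evaluation_word n pt g - evaluation_word n pt h"
  and evaluation_word_smult: "evaluation_word n pt (smult [:c:] g) = word_scale c (evaluation_word n pt g)"
  by (auto simp: evaluation_word_def word_scale_def fun_eq_iff)

lemma evaluation_word_sum: "evaluation_word n pt (sum g I) = (\<Sum>i\<in>I. evaluation_word n pt (g i))"
  by (induction I rule: infinite_finite_induct) (simp_all add: evaluation_word_0 evaluation_word_add)

text \<open>If evaluation is injective on the space of functions with support \<open>I\<close>, the words of the monomials form
  a basis of the code.\<close>

lemma evaluation_code:
  fixes pt :: "nat \<Rightarrow> 'a::field \<times> 'a"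
  assumes I: "finite I"
    and inj: "\<And>g. g \<in> supported I \<Longrightarrow> evaluation_word n pt g = 0 \<Longrightarrow> g = 0"
  shows "linear_code n (evaluation_word n pt ` supported I)"
    and "code_dim (evaluation_word n pt ` supported I) = card I"
proof -
  interpret W: vector_space "word_scale :: 'a \<Rightarrow> (nat \<Rightarrow> 'a) \<Rightarrow> _" by (rule vector_space_word_scale)
  let ?w = "evaluation_word n pt" and ?C = "evaluation_word n pt ` supported I"
  define e where "e = (\<lambda>(i, j). ?w (monom (monom 1 i) j))"
  have subspace: "W.subspace ?C"
  proof (rule W.subspaceI)
    show "0 \<in> ?C" using supported_0 evaluation_word_0 by (metis image_eqI)
    show "c + d \<in> ?C" if "c \<in> ?C" "d \<in> ?C" for c d
      using that by (auto simp flip: evaluation_word_add intro!: imageI supported_add)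
    show "word_scale a c \<in> ?C" if "c \<in> ?C" for a c
      using that by (auto simp flip: evaluation_word_smult intro!: imageI supported_smult)
  qed
  then show "linear_code n ?C" by (auto simp: linear_code_def words_def evaluation_word_def)
  have word: "?w (bivariate I c) = (\<Sum>p\<in>I. word_scale (c p) (e p))" for c
    unfolding bivariate_def evaluation_word_sum
    by (intro sum.cong) (auto simp: e_def smult_monom simp flip: evaluation_word_smult)
  have mon: "monom (monom 1 i) j \<in> supported I" if "(i, j) \<in> I" for i j
    using that by (auto simp: supported_def coeff_monom)
  have e_inj: "inj_on e I"
  proof (rule inj_onI, clarify)
    fix i j i' j' assume ij: "(i, j) \<in> I" "(i', j') \<in> I" and "e (i, j) = e (i', j')"
    then have "?w (monom (monom 1 i) j - monom (monom 1 i') j') = 0"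
      by (simp add: e_def evaluation_word_diff)
    then have "monom (monom 1 i) j - monom (monom 1 i') j' = (0 :: 'a poly poly)"
      using inj supported_diff mon ij by blast
    then have eq: "monom (monom 1 i) j = (monom (monom 1 i') j' :: 'a poly poly)" by simp
    have "coeff (coeff (monom (monom 1 i') j' :: 'a poly poly) j) i = 1"
      unfolding eq[symmetric] by simp
    then show "i = i' \<and> j = j'" by (auto simp: coeff_monom split: if_splits)
  qed
  have "W.independent (e ` I)"
  proof (rule W.independent_if_scalars_zero)
    fix c b assume sum: "(\<Sum>b\<in>e ` I. word_scale (c b) b) = 0" and "b \<in> e ` I"
    then obtain p where p: "p \<in> I" "b = e p" by blast
    have "?w (bivariate I (\<lambda>p. c (e p))) = 0"
      using sum unfolding word by (simp add: sum.reindex[OF e_inj])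
    then have "bivariate I (\<lambda>p. c (e p)) = 0" using inj bivariate_supported[OF I] by blast
    then have "coeff (coeff (bivariate I (\<lambda>p. c (e p))) (snd p)) (fst p) = 0" by simp
    then show "c b = 0" using p I by (simp add: coeff_bivariate)
  qed (use I in simp)
  moreover have "e ` I \<subseteq> ?C" using mon by (auto simp: e_def)
  moreover have "?C \<subseteq> W.span (e ` I)"
  proof clarify
    fix g :: "'a poly poly" assume "g \<in> supported I"
    then have "?w g = (\<Sum>p\<in>I. word_scale ((\<lambda>(i, j). coeff (coeff g j) i) p) (e p))"
      using supported_eq_bivariate[OF I] word by metis
    also have "\<dots> \<in> W.span (e ` I)" by (intro W.span_sum W.span_scale W.span_base imageI)
    finally show "?w g \<in> W.span (e ` I)" .
  qed
  ultimately have "W.dim ?C = card (e ` I)" using W.basis_card_eq_dim by metis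
  then show "code_dim ?C = card I" by (simp add: code_dim_def card_image[OF e_inj])
qed

theorem corollary3p1p3:
  fixes A :: "'a::{field,finite} poly"
    and q \<alpha> \<beta> n t1 t2 :: nat
  assumes "q = CARD('a)"
    and "\<beta> \<ge> 2" and "\<beta> dvd q - 1"
    and "additive_poly A" and "separable_poly A" and "splits_poly A" and "degree A = \<alpha>"
    and "int n = int (card (rational_points (superelliptic \<beta> A))) - int \<alpha> - 1"
    and "n > 0"
    and "int t1 \<le> int \<beta> - 2" and "int t2 \<le> int \<alpha> - 2"
  shows "\<exists>(C :: (nat \<Rightarrow> 'a) set) d.
           lrc n ((t1 + 1) * (t2 + 1)) d [t2 + 1, t1 + 1] C \<and>
           int d \<ge> int n - int \<alpha> * int t1 - int \<beta> * int t2"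
proof -
  have \<beta>_bounds: "\<beta> dvd CARD('a) - 1" "\<beta> > 0" using assms by auto
  have \<beta>_nz: "of_nat \<beta> \<noteq> (0 :: 'a)" by (rule of_nat_dvd_card_minus_one_nonzero[OF \<beta>_bounds(1)])
  have "A \<noteq> 0" by (rule separable_nonzero[OF assms(5)])
  have coprime: "coprime (degree A) \<beta>"
    by (rule coprime_degree_additive[OF assms(4) \<open>A \<noteq> 0\<close> \<beta>_nz])
  obtain x y where xy: "superelliptic_laurent A \<beta> x y"
    using branch_at_infinity[OF \<beta>_nz \<open>A \<noteq> 0\<close> coprime] \<beta>_nz assms(5) coprime
    unfolding superelliptic_laurent_def by metis
  interpret superelliptic_laurent A \<beta> x y by (rule xy)

  \<comment> \<open>The evaluation points.\<close>
  define N where "N = {(a, b). b ^ \<beta> = poly A a \<and> b \<noteq> 0}"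
  have roots: "card {a. poly A a = 0} = \<alpha>"
    using card_roots_separable_splits assms by blast
  have "card N = n"
  proof -
    have "{(a, b). b ^ \<beta> = poly A a} = N \<union> {a. poly A a = 0} \<times> {0}"
      using \<beta>_bounds(2) by (auto simp: N_def power_0_left)
    moreover have "card (N \<union> {a. poly A a = 0} \<times> {0}) = card N + card ({a. poly A a = 0} \<times> {0 :: 'a})"
      by (rule card_Un_disjoint) (auto simp: N_def)
    ultimately have "card (rational_points (superelliptic \<beta> A)) = card N + \<alpha> + 1"
      using card_rational_points by (simp add: card_cartesian_product roots)
    then show ?thesis using assms(8) by simp
  qed
  then obtain pt where pt: "bij_betw pt {..<n} N"
    using ex_bij_betw_nat_finite[of N] by (auto simp: atLeast0LessThan)
  have pt_mem: "pt i \<in> N" if "i < n" for i using bij_betwE[OF pt] that by simp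
  have pt_obtain: "\<exists>i<n. pt i = P" if "P \<in> N" for P
    using bij_betw_imp_surj_on[OF pt] that by (metis imageE lessThan_iff)

  \<comment> \<open>Through every evaluation point pass a vertical line with \<open>\<beta>\<close> and a horizontal line with \<open>\<alpha>\<close> of them.\<close>
  have vertical: "\<beta> \<le> card {b'. (a, b') \<in> N}" if "(a, b) \<in> N" for a b
  proof -
    have "{b'. b' ^ \<beta> = b ^ \<beta>} \<subseteq> {b'. (a, b') \<in> N}"
      using that \<beta>_bounds(2) by (auto simp: N_def power_0_left)
    then have "card {b'. b' ^ \<beta> = b ^ \<beta>} \<le> card {b'. (a, b') \<in> N}" by (intro card_mono) auto
    then show ?thesis using card_power_eq[OF \<beta>_bounds(2,1), of b] that by (simp add: N_def)
  qed
  have translate: "(a + k, b) \<in> N" if "(a, b) \<in> N" "poly A k = 0" for a b k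
    using that poly_additive[OF assms(4)] by (simp add: N_def)
  have horizontal: "\<alpha> \<le> card {a'. (a', b) \<in> N}" if "(a, b) \<in> N" for a b
  proof -
    have "(\<lambda>k. a + k) ` {k. poly A k = 0} \<subseteq> {a'. (a', b) \<in> N}" using translate[OF that] by auto
    then have "card ((\<lambda>k. a + k) ` {k. poly A k = 0}) \<le> card {a'. (a', b) \<in> N}" by (intro card_mono) auto
    then show ?thesis by (simp add: card_image roots)
  qed

  let ?J = "{..t2} \<times> {..t1}"
  let ?w = "evaluation_word n pt"
  define C where "C = ?w ` supported ?J"
  have t: "t1 + 1 < \<beta>" "t2 + 1 < \<alpha>" using assms by linarith+
  have w_inj: "g = 0" if g: "g \<in> supported ?J" and "?w g = 0" for g
  proof -
    obtain a0 b0 where P: "(a0, b0) \<in> N" using pt_mem[OF \<open>n > 0\<close>] by (cases "pt 0") auto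
    have zero: "poly (poly g [:b:]) a = 0" if Q: "(a, b) \<in> N" for a b
    proof -
      obtain i where "i < n" "pt i = (a, b)" using pt_obtain[OF Q] by blast
      then show ?thesis using fun_cong[OF \<open>?w g = 0\<close>, of i] by (simp add: evaluation_word_def)
    qed
    show "g = 0"
    proof (rule vanish_on_grid[OF g])
      show "t2 < card {a. (a, b0) \<in> N}" using horizontal[OF P] t by simp
      show "t1 < card {b. (a0, b) \<in> N}" using vertical[OF P] t by simp
      fix a b assume "a \<in> {a. (a, b0) \<in> N}" "b \<in> {b. (a0, b) \<in> N}"
      then have "(a, b) \<in> N" using P by (simp add: N_def)
      then show "poly (poly g [:b:]) a = 0" by (rule zero)
    qed
  qed
  have J: "finite ?J" by simp
  have code: "linear_code n C" "code_dim C = (t1 + 1) * (t2 + 1)"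
    using evaluation_code[OF J w_inj] by (simp_all add: C_def card_cartesian_product)

  have recover: "recovery_set n C i I"
    if i: "i < n" and I: "I \<noteq> {}" "I \<subseteq> {..<n} - {i}"
      and vanish: "\<And>g. g \<in> supported ?J \<Longrightarrow> (\<And>k. k \<in> I \<Longrightarrow> poly (poly g [:snd (pt k):]) (fst (pt k)) = 0) \<Longrightarrow>
        poly (poly g [:snd (pt i):]) (fst (pt i)) = 0" for i I
  proof (rule recovery_setI[OF I])
    fix c c' assume "c \<in> C" "c' \<in> C" and eq: "\<And>k. k \<in> I \<Longrightarrow> c k = c' k"
    then obtain g g' where g: "g \<in> supported ?J" "g' \<in> supported ?J" "c = ?w g" "c' = ?w g'"
      by (auto simp: C_def)
    have "poly (poly (g - g') [:snd (pt i):]) (fst (pt i)) = 0"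
    proof (rule vanish)
      show "g - g' \<in> supported ?J" by (rule supported_diff[OF g(1,2)])
      fix k assume "k \<in> I"
      then show "poly (poly (g - g') [:snd (pt k):]) (fst (pt k)) = 0"
        using eq[of k] I(2) g by (auto simp: evaluation_word_def)
    qed
    then show "c i = c' i" using g i by (simp add: evaluation_word_def)
  qed
  have inj_pt: "inj_on pt {..<n}" using pt by (rule bij_betw_imp_inj_on)
  have fibre_image: "pt ` {k. k < n \<and> Q (pt k)} = {P \<in> N. Q P}" for Q
  proof (intro equalityI subsetI)
    fix P assume "P \<in> {P \<in> N. Q P}"
    then show "P \<in> pt ` {k. k < n \<and> Q (pt k)}" using pt_obtain[of P] by blast
  qed (use pt_mem in auto)
  have card_fibre: "card {k. k < n \<and> Q (pt k)} = card {P \<in> N. Q P}" for Q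
  proof -
    have "card (pt ` {k. k < n \<and> Q (pt k)}) = card {k. k < n \<and> Q (pt k)}"
      using inj_pt by (intro card_image) (auto intro: inj_on_subset)
    then show ?thesis unfolding fibre_image by simp
  qed

  have recovery: "\<exists>I :: nat \<Rightarrow> nat set.
      (\<forall>j<length [t2 + 1, t1 + 1]. recovery_set n C i (I j) \<and> card (I j) = [t2 + 1, t1 + 1] ! j) \<and>
      disjoint_family_on I {..<length [t2 + 1, t1 + 1]}" if i: "i < n" for i
  proof -
    obtain a b where ab: "pt i = (a, b)" by (cases "pt i") 
    then have P: "(a, b) \<in> N" using pt_mem[OF i] by simp
    \<comment> \<open>The other points on the horizontal and on the vertical line through the point number \<open>i\<close>.\<close>
    let ?H = "{k. k < n \<and> snd (pt k) = b \<and> k \<noteq> i}" and ?V = "{k. k < n \<and> fst (pt k) = a \<and> k \<noteq> i}"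
    have "card {P \<in> N. snd P = b} = card {a'. (a', b) \<in> N}"
      by (rule bij_betw_same_card[of fst]) (auto simp: bij_betw_def inj_on_def image_iff)
    then have "card {k. k < n \<and> snd (pt k) = b} \<ge> \<alpha>" using horizontal[OF P] card_fibre[of "\<lambda>P. snd P = b"] by simp
    moreover have "?H = {k. k < n \<and> snd (pt k) = b} - {i}" by auto
    ultimately have "t2 + 1 \<le> card ?H" using i ab t by (simp add: card_Diff_singleton)
    then obtain H where H: "H \<subseteq> ?H" "card H = t2 + 1" by (rule obtain_subset_with_card_n)
    have "card {P \<in> N. fst P = a} = card {b'. (a, b') \<in> N}"
      by (rule bij_betw_same_card[of snd]) (auto simp: bij_betw_def inj_on_def image_iff)
    then have "card {k. k < n \<and> fst (pt k) = a} \<ge> \<beta>" using vertical[OF P] card_fibre[of "\<lambda>P. fst P = a"] by simp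
    moreover have "?V = {k. k < n \<and> fst (pt k) = a} - {i}" by auto
    ultimately have "t1 + 1 \<le> card ?V" using i ab t by (simp add: card_Diff_singleton)
    then obtain V' where V': "V' \<subseteq> ?V" "card V' = t1 + 1" by (rule obtain_subset_with_card_n)
    have "recovery_set n C i H"
    proof (rule recover[OF i])
      show "H \<noteq> {}" "H \<subseteq> {..<n} - {i}" using H by auto
      fix g assume g: "g \<in> supported ?J" and zero: "\<And>k. k \<in> H \<Longrightarrow> poly (poly g [:snd (pt k):]) (fst (pt k)) = 0"
      have "inj_on (\<lambda>k. fst (pt k)) H"
        using H(1) inj_pt by (intro inj_onI) (auto simp: inj_on_def prod_eq_iff subset_iff)
      then have "card ((\<lambda>k. fst (pt k)) ` H) = t2 + 1" using H(2) card_image by metis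
      then have "poly g [:b:] = 0"
        using zero H(1) by (intro vanish_on_horizontal_fibre[OF g, of "(\<lambda>k. fst (pt k)) ` H"]) auto
      then show "poly (poly g [:snd (pt i):]) (fst (pt i)) = 0" by (simp add: ab)
    qed
    moreover have "recovery_set n C i V'"
    proof (rule recover[OF i])
      show "V' \<noteq> {}" "V' \<subseteq> {..<n} - {i}" using V' by auto
      fix g assume g: "g \<in> supported ?J" and zero: "\<And>k. k \<in> V' \<Longrightarrow> poly (poly g [:snd (pt k):]) (fst (pt k)) = 0"
      have "inj_on (\<lambda>k. snd (pt k)) V'"
        using V'(1) inj_pt by (intro inj_onI) (auto simp: inj_on_def prod_eq_iff subset_iff)
      then have "card ((\<lambda>k. snd (pt k)) ` V') = t1 + 1" using V'(2) card_image by metis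
      then have "map_poly (\<lambda>p. poly p a) g = 0"
        using zero V'(1) by (intro vanish_on_vertical_fibre[OF g, of "(\<lambda>k. snd (pt k)) ` V'"]) auto
      then have "poly (poly g [:b:]) a = 0" using poly_map_poly_poly[of a g b] by simp
      then show "poly (poly g [:snd (pt i):]) (fst (pt i)) = 0" by (simp add: ab)
    qed
    moreover have "H \<inter> V' = {}"
    proof (rule ccontr)
      assume "H \<inter> V' \<noteq> {}"
      then obtain k where "k < n" "k \<noteq> i" "snd (pt k) = b" "fst (pt k) = a" using H V' by blast
      then show False using inj_onD[OF inj_pt, of k i] i ab by (auto simp: prod_eq_iff)
    qed
    ultimately show ?thesis
      using H(2) V'(2)
      by (intro exI[of _ "\<lambda>j. if j = 0 then H else V'"])
        (auto simp: less_Suc_eq disjoint_family_on_def)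
  qed

  have dist: "int n - int \<alpha> * int t1 - int \<beta> * int t2 \<le> int (hamming_dist n c c')"
    if c: "c \<in> C" "c' \<in> C" "c \<noteq> c'" for c c'
  proof -
    obtain g g' where g: "g \<in> supported ?J" "g' \<in> supported ?J" "c = ?w g" "c' = ?w g'"
      using c by (auto simp: C_def)
    define f where "f = g - g'"
    have f: "f \<in> supported ?J" "f \<noteq> 0" using g c(3) supported_diff by (auto simp: f_def)
    have deg: "degree f < \<beta>" using supported_rectangle(1)[OF f(1)] t by simp
    have "?J \<subseteq> weights (\<beta> * t2 + \<alpha> * t1)"
      using t assms(7) by (auto simp: weights_def intro: add_mono)
    then have "f \<in> supported (weights (\<beta> * t2 + \<alpha> * t1))" using f(1) supported_mono by blast
    then have weight: "- fls_subdegree (curve_eval x y f) \<le> int (\<beta> * t2 + \<alpha> * t1)"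
      using supported_weights_iff[OF f(2)] by blast
    define Z where "Z = {P \<in> N. poly (poly f [:snd P:]) (fst P) = 0}"
    have "int (card Z) \<le> - fls_subdegree (curve_eval x y f)"
      by (rule card_zeros_le[OF xy deg f(2)]) (auto simp: Z_def N_def)
    moreover have "hamming_dist n c c' = card {P \<in> N. poly (poly f [:snd P:]) (fst P) \<noteq> 0}"
    proof -
      have "{k. k < n \<and> c k \<noteq> c' k} = {k. k < n \<and> poly (poly f [:snd (pt k):]) (fst (pt k)) \<noteq> 0}"
        by (auto simp: g evaluation_word_def f_def)
      then show ?thesis
        unfolding hamming_dist_def using card_fibre[of "\<lambda>P. poly (poly f [:snd P:]) (fst P) \<noteq> 0"] by simp
    qed
    moreover have "n = card Z + card {P \<in> N. poly (poly f [:snd P:]) (fst P) \<noteq> 0}"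
    proof -
      have "N = Z \<union> {P \<in> N. poly (poly f [:snd P:]) (fst P) \<noteq> 0}" by (auto simp: Z_def)
      then have "card N = card (Z \<union> {P \<in> N. poly (poly f [:snd P:]) (fst P) \<noteq> 0})" by simp
      also have "\<dots> = card Z + card {P \<in> N. poly (poly f [:snd P:]) (fst P) \<noteq> 0}"
        by (rule card_Un_disjoint) (auto simp: Z_def)
      finally show ?thesis using \<open>card N = n\<close> by simp
    qed
    ultimately show ?thesis using weight by (simp add: algebra_simps)
  qed
  have "?w 0 \<in> C" "?w 1 \<in> C" "?w 0 \<noteq> ?w 1"
  proof -
    show "?w 0 \<in> C" by (auto simp: C_def supported_0)
    have one: "(1 :: 'a poly poly) \<in> supported ?J" by (auto simp: supported_def coeff_1 split: if_splits)
    then show "?w 1 \<in> C" by (simp add: C_def)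
    show "?w 0 \<noteq> ?w 1" using w_inj[OF one] by (metis evaluation_word_0 one_neq_zero)
  qed
  then obtain c c' where "c \<in> C" "c' \<in> C" "c \<noteq> c'" "min_dist n C = hamming_dist n c c'"
    using min_dist_attained by blast
  then have "int (min_dist n C) \<ge> int n - int \<alpha> * int t1 - int \<beta> * int t2"
    using dist by metis
  moreover have "lrc n ((t1 + 1) * (t2 + 1)) (min_dist n C) [t2 + 1, t1 + 1] C"
    unfolding lrc_def using code recovery by blast
  ultimately show ?thesis by blast
qed

end
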